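(* There exist a constant $c>0$, an infinite family of graphs $\{G_n=([n],E_n)\}_{n\in\mathbb{N}}$ such that each $G_n$ is $c\cdot n$-robustly self-ordered, and an algorithm that, given $n$ and $u,v\in[n]$, determines whether $u$ and $v$ are adjacent in $G_n$ in time polynomial in $\log n$. Furthermore, these graphs are efficiently self-ordered, and every vertex of $G_n$ has degree in $[0.06n,0.73n]$.
   Context: A graph $G=(V,E)$ is $\rho$-robustly self-ordered if for every permutation $\pi$ of $V$, $|E\triangle\{\{\pi(u),\pi(v)\}:\{u,v\}\in E\}|\ge\rho|\{v:\pi(v)\ne v\}|$. A graph $G=([n],E)$ is self-ordered if for every graph $G'=(V',E')$ isomorphic to it there is a unique bijection $\phi:V'\to[n]$ with $\phi(G')=G$ (where $\phi(G')$ has edges $\{\{\phi(u),\phi(v)\}:\{u,v\}\in E'\}$); it is efficiently self-ordered if there is a polynomial-time algorithm that, given any graph $G'$ isomorphic to $G$, finds this unique bijection $\phi$.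
   Formalization: Robustness, efficient self-ordering and the degree bounds are proved for all sufficiently large n rather than every n, since they fail for n = 1 (degree 0) and for n = 2,…,5 (every graph has a nontrivial automorphism); graphs G' isomorphic to G_n have natural numbers as vertices. *)

theory Defs
  imports
    Complex_Main
    "HOL-Library.FuncSet"
    "HOL-Combinatorics.Permutations"
    "HOL-Computational_Algebra.Polynomial"
begin

section \<open>Graphs\<close>

text \<open>
  Finite simple undirected graphs, given by a vertex set and a set of edges, each edge being
  the set of its two endpoints. Hence \<open>(`) \<pi> ` E\<close> is the edge set
  \<open>{{\<pi> u, \<pi> v} | {u, v} \<in> E}\<close>.
\<close>

definition simple_graph :: "'a set \<Rightarrow> 'a set set \<Rightarrow> bool" where
  "simple_graph V E \<longleftrightarrow> finite V \<and> (\<forall>e\<in>E. \<exists>u\<in>V. \<exists>v\<in>V. u \<noteq> v \<and> e = {u, v})"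

definition vertex_degree :: "'a set set \<Rightarrow> 'a \<Rightarrow> nat" where
  "vertex_degree E v = card {e \<in> E. v \<in> e}"

definition robustly_self_ordered :: "real \<Rightarrow> 'a set \<Rightarrow> 'a set set \<Rightarrow> bool" where
  "robustly_self_ordered \<rho> V E \<longleftrightarrow>
     (\<forall>\<pi>. \<pi> permutes V \<longrightarrow>
        real (card (sym_diff E ((`) \<pi> ` E))) \<ge> \<rho> * real (card {v \<in> V. \<pi> v \<noteq> v}))"

definition graph_bij :: "('a \<Rightarrow> 'b) \<Rightarrow> 'a set \<Rightarrow> 'a set set \<Rightarrow> 'b set \<Rightarrow> 'b set set \<Rightarrow> bool" where
  "graph_bij \<phi> V' E' V E \<longleftrightarrow> bij_betw \<phi> V' V \<and> (`) \<phi> ` E' = E"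

definition isomorphic :: "'a set \<Rightarrow> 'a set set \<Rightarrow> 'b set \<Rightarrow> 'b set set \<Rightarrow> bool" where
  "isomorphic V' E' V E \<longleftrightarrow> (\<exists>\<phi>. graph_bij \<phi> V' E' V E)"

text \<open>
  The isomorphic copies range over all graphs whose vertices are natural numbers; as graphs are
  finite, this covers every graph up to renaming of the vertices. Bijections are taken in
  \<^const>\<open>extensional\<close> form, so that uniqueness refers to the values on \<open>V'\<close> only.
\<close>

definition self_ordered :: "nat \<Rightarrow> nat set set \<Rightarrow> bool" where
  "self_ordered n E \<longleftrightarrow>
     (\<forall>(V' :: nat set) E'. simple_graph V' E' \<and> isomorphic V' E' {1..n} E \<longrightarrow>
        (\<exists>!\<phi>. \<phi> \<in> extensional V' \<and> graph_bij \<phi> V' E' {1..n} E))"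


section \<open>Algorithms and their running time\<close>

text \<open>
  Algorithms are first-order call-by-value functional programs over binary trees (pure LISP
  S-expressions with a single atom). Evaluation with cost \<open>t\<close> performs \<open>t\<close> elementary steps,
  each of which copies, creates, follows or tests a constant number of pointers. In particular
  a tree is passed in one step, and there is no unit-cost arithmetic or comparison of trees.
  With respect to polynomial time, and to time polynomial in the length of the input, this is
  equivalent to Turing machines (N. D. Jones, Computability and Complexity from a Programming
  Perspective, MIT Press 1997).

  A program is a list of function bodies; \<open>Call f es\<close> refers to functions by their position
  in this list. The environment of a body consists of its actual arguments, \<open>Var i\<close> being the
  \<open>i\<close>-th one, and \<open>Let_In\<close> adds a new variable in front (de Bruijn indices).
\<close>

datatype tree = Leaf | Node tree tree

primrec tree_hd :: "tree \<Rightarrow> tree" where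
  "tree_hd Leaf = Leaf"
| "tree_hd (Node a b) = a"

primrec tree_tl :: "tree \<Rightarrow> tree" where
  "tree_tl Leaf = Leaf"
| "tree_tl (Node a b) = b"

datatype expr =
    Var nat
  | Const_Leaf
  | Mk_Node expr expr
  | Hd expr
  | Tl expr
  | If_Node expr expr expr
  | Let_In expr expr
  | Call nat "expr list"

type_synonym program = "expr list"

text \<open>
  \<open>eval P env e v t\<close>: in the program \<open>P\<close>, the expression \<open>e\<close> evaluates in the environment \<open>env\<close>
  to \<open>v\<close> with cost \<open>t\<close>. Diverging evaluations, unbound variables and undefined functions have
  no derivation.
\<close>

inductive eval :: "program \<Rightarrow> tree list \<Rightarrow> expr \<Rightarrow> tree \<Rightarrow> nat \<Rightarrow> bool"
  and evals :: "program \<Rightarrow> tree list \<Rightarrow> expr list \<Rightarrow> tree list \<Rightarrow> nat \<Rightarrow> bool"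
  for P :: program
where
  Var: "i < length env \<Longrightarrow> eval P env (Var i) (env ! i) 1"
| Const_Leaf: "eval P env Const_Leaf Leaf 1"
| Mk_Node: "eval P env e1 v1 t1 \<Longrightarrow> eval P env e2 v2 t2 \<Longrightarrow>
     eval P env (Mk_Node e1 e2) (Node v1 v2) (t1 + t2 + 1)"
| Hd: "eval P env e v t \<Longrightarrow> eval P env (Hd e) (tree_hd v) (t + 1)"
| Tl: "eval P env e v t \<Longrightarrow> eval P env (Tl e) (tree_tl v) (t + 1)"
| If_Node: "eval P env e0 (Node a b) t0 \<Longrightarrow> eval P env e1 v t \<Longrightarrow>
     eval P env (If_Node e0 e1 e2) v (t0 + t + 1)"
| If_Leaf: "eval P env e0 Leaf t0 \<Longrightarrow> eval P env e2 v t \<Longrightarrow>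
     eval P env (If_Node e0 e1 e2) v (t0 + t + 1)"
| Let_In: "eval P env e1 v1 t1 \<Longrightarrow> eval P (v1 # env) e2 v2 t2 \<Longrightarrow>
     eval P env (Let_In e1 e2) v2 (t1 + t2 + 1)"
| Call: "evals P env es vs t1 \<Longrightarrow> f < length P \<Longrightarrow> eval P vs (P ! f) v t2 \<Longrightarrow>
     eval P env (Call f es) v (t1 + t2 + 1)"
| Empty: "evals P env [] [] 1"
| Cons: "eval P env e v t1 \<Longrightarrow> evals P env es vs t2 \<Longrightarrow>
     evals P env (e # es) (v # vs) (t1 + t2 + 1)"

lemma eval_deterministic:
  "eval P env e v t \<Longrightarrow> eval P env e v' t' \<Longrightarrow> v' = v \<and> t' = t"
  "evals P env es vs t \<Longrightarrow> evals P env es vs' t' \<Longrightarrow> vs' = vs \<and> t' = t"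
proof (induction arbitrary: v' t' and vs' t' rule: eval_evals.inducts)
  case (Var i env) from Var.prems show ?case by cases auto
next
  case (Const_Leaf env) from Const_Leaf.prems show ?case by cases auto
next
  case (Mk_Node env e1 v1 t1 e2 v2 t2)
  from Mk_Node.prems show ?case by cases (use Mk_Node.IH in blast)+
next
  case (Hd env e v t) from Hd.prems show ?case by cases (use Hd.IH in blast)+
next
  case (Tl env e v t) from Tl.prems show ?case by cases (use Tl.IH in blast)+
next
  case (If_Node env e0 a b t0 e1 v t e2)
  from If_Node.prems show ?case by cases (use If_Node.IH in blast)+
next
  case (If_Leaf env e0 t0 e2 v t e1)
  from If_Leaf.prems show ?case by cases (use If_Leaf.IH in blast)+
next
  case (Let_In env e1 v1 t1 e2 v2 t2)
  from Let_In.prems show ?case by cases (use Let_In.IH in blast)+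
next
  case (Call env es vs t1 f v t2)
  from Call.prems show ?case by cases (use Call.IH in blast)+
next
  case (Empty env) from Empty.prems show ?case by cases auto
next
  case (Cons env e v t1 es vs t2)
  from Cons.prems show ?case by cases (use Cons.IH in blast)+
qed

definition computes_within :: "program \<Rightarrow> tree \<Rightarrow> tree \<Rightarrow> real \<Rightarrow> bool" where
  "computes_within P x y T \<longleftrightarrow>
     P \<noteq> [] \<and> (\<exists>t. eval P [x] (P ! 0) y t \<and> real t \<le> T)"


subsection \<open>Encoding of inputs and outputs\<close>

fun enc_bool :: "bool \<Rightarrow> tree" where
  "enc_bool False = Leaf"
| "enc_bool True = Node Leaf Leaf"

definition enc_list :: "('a \<Rightarrow> tree) \<Rightarrow> 'a list \<Rightarrow> tree" where
  "enc_list f xs = foldr (\<lambda>x. Node (f x)) xs Leaf"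

fun enc_pair :: "('a \<Rightarrow> tree) \<Rightarrow> ('b \<Rightarrow> tree) \<Rightarrow> 'a \<times> 'b \<Rightarrow> tree" where
  "enc_pair f g (x, y) = Node (f x) (g y)"

text \<open>Binary representation, least significant bit first, without leading zeros.\<close>

fun bits :: "nat \<Rightarrow> bool list" where
  "bits n = (if n = 0 then [] else odd n # bits (n div 2))"

declare bits.simps [simp del]

definition enc_nat :: "nat \<Rightarrow> tree" where
  "enc_nat n = enc_list enc_bool (bits n)"

text \<open>
  A graph is presented to an algorithm by listing its vertices (with arbitrary natural numbers as
  names) and its edges, in any order; the endpoints of each edge also come in any order.
  The length of a binary tree, seen as an input, is its number \<^term>\<open>size x\<close> of inner nodes.
\<close>

definition lists_graph :: "'a list \<Rightarrow> ('a \<times> 'a) list \<Rightarrow> 'a set \<Rightarrow> 'a set set \<Rightarrow> bool" where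
  "lists_graph vs es V E \<longleftrightarrow>
     distinct vs \<and> set vs = V \<and>
     distinct (map (\<lambda>(u, v). {u, v}) es) \<and> (\<lambda>(u, v). {u, v}) ` set es = E"

definition enc_graph :: "nat list \<Rightarrow> (nat \<times> nat) list \<Rightarrow> tree" where
  "enc_graph vs es = Node (enc_list enc_nat vs) (enc_list (enc_pair enc_nat enc_nat) es)"

definition enc_fun :: "nat list \<Rightarrow> (nat \<Rightarrow> nat) \<Rightarrow> tree" where
  "enc_fun vs \<phi> = enc_list (enc_pair enc_nat enc_nat) (map (\<lambda>v. (v, \<phi> v)) vs)"


subsection \<open>Efficiently computable families of graphs\<close>

text \<open>Families consist of graphs \<open>([n], E n)\<close> with \<open>[n] = {1..n}\<close>.\<close>

definition polylog_time_adjacency :: "(nat \<Rightarrow> nat set set) \<Rightarrow> bool" where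
  "polylog_time_adjacency E \<longleftrightarrow>
     (\<exists>(P :: program) (p :: real poly). \<forall>n. \<forall>u\<in>{1..n}. \<forall>v\<in>{1..n}.
        computes_within P
          (enc_list enc_nat [n, u, v])
          (enc_bool ({u, v} \<in> E n))
          (poly p (log 2 (real n))))"

text \<open>
  A single polynomial-time algorithm serves all members of the family with index in \<open>I\<close>. For a
  self-ordered graph, the bijection \<open>\<phi>\<close> below is unique on \<open>V'\<close>, which is all that the output
  depends on; \<open>n\<close> is not part of the input, being the number of vertices of the given graph.
\<close>

definition efficiently_self_ordered :: "nat set \<Rightarrow> (nat \<Rightarrow> nat set set) \<Rightarrow> bool" where
  "efficiently_self_ordered I E \<longleftrightarrow>
     (\<forall>n\<in>I. self_ordered n (E n)) \<and>
     (\<exists>(P :: program) (p :: real poly). \<forall>n\<in>I. \<forall>V' E' vs es \<phi>.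
        simple_graph V' E' \<and> lists_graph vs es V' E' \<and> graph_bij \<phi> V' E' {1..n} (E n) \<longrightarrow>
        computes_within P
          (enc_graph vs es)
          (enc_fun vs \<phi>)
          (poly p (real (size (enc_graph vs es)))))"

end

theory Submission
  imports Defs
begin

text \<open>
  The vertices form blocks that are copies of \<open>X = F\<^sub>2\<^sup>k\<close>, with at least 8 and fewer than 16 blocks' worth of
  vertices, and adjacency between blocks is given by inner products of affine images of the two vectors. Block
  1 is a clique, the form between blocks 2 and 3 is \<open>\<langle>y, N z\<rangle>\<close> for the nilpotent shift \<open>N\<close>, and the offsets of
  the remaining blocks make the rows of any two vertices differ on a constant fraction of the blocks 1, 2, 3. Hence a
  permutation that moves few vertices changes \<open>\<Omega>(n)\<close> edges at each of them. A permutation that changes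
  \<open>o(n\<^sup>2)\<close> edges preserves the degrees of almost all vertices approximately, and therefore the blocks 1, 2, 3
  up to few exceptions. Two linear functionals agree either everywhere or on half of \<open>X\<close>; by this gap, the
  permutation agrees with a linear map \<open>T\<close> almost everywhere on each of these blocks. The forms between the blocks force
  \<open>T\<close> to be orthogonal and to commute with \<open>N\<close>, so that \<open>T\<close> is the identity.

  The zero vectors of the blocks 1, 2, 3 are definable by first-order formulas, and so are, by following \<open>N\<close>,
  the unit vectors in blocks 1 and 2. The adjacency to unit vectors gives the binary digits of all labels. The
  self-ordering algorithm is therefore an interpreter for first-order formulas over a finite graph.
\<close>

unbundle bit_operations_syntax

section \<open>The inner product of binary expansions\<close>

text \<open>Linear algebra controls exact maps of a full space \<open>F\<^sub>2\<^sup>k\<close>,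
  whereas an almost automorphism is known only up to a small density of errors and \<open>n\<close>
  is arbitrary. The irregular last block adds to the degrees a character sum over an initial
  segment; its second moment shows that it is far from its mean for at most 256 vectors per block,
  whatever \<open>k\<close> is, so approximate degrees suffice. They differ between blocks because
  block 1 is a clique and block 3 has no inner edges, which puts the typical degrees at least
  \<open>r = q / 2\<close> apart. The negated forms make rows of equal vectors differ by the
  complement of a functional, which is dense even if the functional vanishes, and they make the zero
  vectors \<open>2 * q\<close> and \<open>3 * q\<close> visible. Orthogonality alone leaves a large
  group; the shift removes it: \<open>T\<close> preserves the kernel {0, 1} of \<open>div 2\<close>,
  so it fixes the vector 1, pairing with 1 gives the lowest bit, and \<open>div 2\<close> gives the
  others. The bound \<open>2 ^ 27\<close> makes \<open>q\<close> large enough for the at most 1000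
  atypical vertices to be negligible.\<close>

fun ip :: "nat \<Rightarrow> nat \<Rightarrow> bool" where
  "ip x y = (if x = 0 then False else (odd x \<and> odd y) \<noteq> ip (x div 2) (y div 2))"

declare ip.simps [simp del]

lemma ip_rec: "ip x y = ((odd x \<and> odd y) \<noteq> ip (x div 2) (y div 2))"
  by (cases "x = 0") (simp_all add: ip.simps)

lemma ip_0 [simp]: "\<not> ip 0 y" "\<not> ip x 0"
proof -
  show "\<not> ip 0 y" by (simp add: ip.simps)
  show "\<not> ip x 0"
    by (induction x rule: less_induct) (subst ip.simps, auto)
qed

lemma ip_commute: "ip x y = ip y x"
proof (induction x arbitrary: y rule: less_induct)
  case (less x)
  show ?case
  proof (cases "x = 0")
    case False
    then have "ip (x div 2) (y div 2) = ip (y div 2) (x div 2)"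
      by (intro less) simp
    then show ?thesis by (subst (1 2) ip_rec) auto
  qed simp
qed

lemma odd_xor_nat [simp]: "odd (x XOR y :: nat) \<longleftrightarrow> odd x \<noteq> odd y"
  by (simp add: even_xor_iff)

lemma xor_div_2: "(x XOR y :: nat) div 2 = (x div 2) XOR (y div 2)"
  by (metis drop_bit_Suc drop_bit_0 drop_bit_xor One_nat_def id_apply)

lemma xor_less_two_power: "x < 2 ^ k \<Longrightarrow> y < 2 ^ k \<Longrightarrow> (x XOR y :: nat) < 2 ^ k"
  by (metis take_bit_nat_eq_self_iff take_bit_xor)

lemma ip_xor_left: "ip (x XOR x') y \<longleftrightarrow> ip x y \<noteq> ip x' y"
proof (induction y arbitrary: x x' rule: less_induct)
  case (less y)
  show ?case
  proof (cases "y = 0")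
    case False
    then have "ip ((x div 2) XOR (x' div 2)) (y div 2) \<longleftrightarrow> ip (x div 2) (y div 2) \<noteq> ip (x' div 2) (y div 2)"
      by (intro less) simp
    then show ?thesis by (subst (1 2 3) ip_rec) (auto simp: xor_div_2)
  qed simp
qed

lemma ip_xor_right: "ip x (y XOR y') \<longleftrightarrow> ip x y \<noteq> ip x y'"
  using ip_xor_left ip_commute by metis

lemma ip_double: "ip (2 * x) y = ip x (y div 2)"
  by (subst ip_rec) simp

lemma ip_1: "ip (Suc 0) y = odd y" "ip y (Suc 0) = odd y"
  by (subst ip_rec, simp)+

text \<open>Bits of \<open>x\<close> from position \<open>k\<close> on meet only zeros of
  \<open>y\<close>. Hence vectors such as \<open>2 * w\<close> may be used without
  truncation.\<close>

lemma ip_mod: "y < 2 ^ k \<Longrightarrow> ip (x mod 2 ^ k) y = ip x y"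
proof (induction k arbitrary: x y)
  case (Suc k)
  have "ip ((x div 2) mod 2 ^ k) (y div 2) = ip (x div 2) (y div 2)"
    using Suc.prems by (intro Suc.IH) simp
  moreover have "(x mod 2 ^ Suc k) div 2 = (x div 2) mod 2 ^ k"
    by (simp add: mod_mult2_eq)
  moreover have "odd (x mod 2 ^ Suc k) = odd x"
    by (simp add: mod_mult2_eq even_iff_mod_2_eq_zero)
  ultimately show ?case by (subst (1 2) ip_rec) simp
qed simp

text \<open>The witness is the unit vector at the lowest set bit of \<open>x\<close>: 1 if
  \<open>x\<close> is odd, otherwise twice the witness for \<open>x div 2\<close>.\<close>

lemma ip_nondegenerate:
  assumes "x \<noteq> 0" "x < 2 ^ k"
  obtains y where "y < 2 ^ k" "ip x y"
proof -
  have "\<exists>y < 2 ^ k. ip x y"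
    using assms
  proof (induction k arbitrary: x)
    case (Suc k)
    show ?case
    proof (cases "odd x")
      case True
      moreover have "(1::nat) < 2 ^ Suc k" by (rule one_less_power) auto
      ultimately show ?thesis
        by (intro exI[of _ 1]) (auto simp: ip_1)
    next
      case False
      then have "x div 2 \<noteq> 0" "x div 2 < 2 ^ k"
        using Suc.prems by auto
      from Suc.IH[OF this] obtain y where "y < 2 ^ k" "ip (x div 2) y" by blast
      then show ?thesis using False
        by (intro exI[of _ "2 * y"]) (subst ip_rec, simp)
    qed
  qed simp
  then show thesis using that by blast
qed

text \<open>Adding \<open>a\<close> exchanges the vectors where \<open>f\<close> holds with those
  where it fails.\<close>

lemma card_additive:
  assumes add: "\<And>x y. x < 2 ^ k \<Longrightarrow> y < 2 ^ k \<Longrightarrow> f (x XOR y) \<longleftrightarrow> f x \<noteq> f y"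
    and a: "a < 2 ^ k" "f a"
  shows "2 * card {x. x < (2::nat) ^ k \<and> f x} = 2 ^ k"
    and "2 * card {x. x < (2::nat) ^ k \<and> \<not> f x} = 2 ^ k"
proof -
  have "bij_betw (\<lambda>x. x XOR a) {x. x < (2::nat) ^ k \<and> f x} {x. x < (2::nat) ^ k \<and> \<not> f x}"
    by (rule bij_betw_byWitness[where f' = "\<lambda>x. x XOR a"])
      (auto simp: add a xor_less_two_power xor.assoc)
  then have eq: "card {x. x < (2::nat) ^ k \<and> f x} = card {x. x < (2::nat) ^ k \<and> \<not> f x}"
    by (rule bij_betw_same_card)
  have "{..<(2::nat) ^ k} = {x. x < 2 ^ k \<and> f x} \<union> {x. x < 2 ^ k \<and> \<not> f x}" by auto
  then have "2 ^ k = card ({x. x < (2::nat) ^ k \<and> f x} \<union> {x. x < 2 ^ k \<and> \<not> f x})"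
    using card_lessThan by metis
  also have "\<dots> = card {x. x < (2::nat) ^ k \<and> f x} + card {x. x < (2::nat) ^ k \<and> \<not> f x}"
    by (rule card_Un_disjoint) auto
  finally show "2 * card {x. x < (2::nat) ^ k \<and> f x} = 2 ^ k"
    "2 * card {x. x < (2::nat) ^ k \<and> \<not> f x} = 2 ^ k" using eq by simp_all
qed

lemma card_ip:
  assumes "c < 2 ^ k" "c \<noteq> 0"
  shows "2 * card {x. x < 2 ^ k \<and> ip c x} = 2 ^ k"
    and "2 * card {x. x < 2 ^ k \<and> \<not> ip c x} = 2 ^ k"
proof -
  obtain a where a: "a < 2 ^ k" "ip c a" using ip_nondegenerate assms by blast
  show "2 * card {x. x < 2 ^ k \<and> ip c x} = 2 ^ k"
    and "2 * card {x. x < 2 ^ k \<and> \<not> ip c x} = 2 ^ k"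
    using card_additive[of k "ip c" a] a ip_xor_right by blast+
qed

text \<open>If \<open>c\<close> vanishes modulo \<open>2 ^ k\<close>, the set is everything. So the
  complement of a functional is dense without any condition on \<open>c\<close>, which is what the
  negated entries of the adjacency table exploit.\<close>

lemma card_not_ip_ge: "2 ^ k \<le> 2 * card {x. x < 2 ^ k \<and> \<not> ip c x}"
proof -
  have eq: "{x. x < 2 ^ k \<and> \<not> ip c x} = {x. x < 2 ^ k \<and> \<not> ip (c mod 2 ^ k) x}"
    by (auto simp: ip_mod)
  show ?thesis
  proof (cases "c mod 2 ^ k = 0")
    case True
    then show ?thesis unfolding eq by simp
  next
    case False
    then show ?thesis unfolding eq by (subst card_ip) simp_all
  qed
qed

lemma card_ip_le: "2 * card {x. x < 2 ^ k \<and> ip c x} \<le> 2 ^ k"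
proof -
  have eq: "{x. x < 2 ^ k \<and> ip c x} = {x. x < 2 ^ k \<and> ip (c mod 2 ^ k) x}"
    by (auto simp: ip_mod)
  show ?thesis
  proof (cases "c mod 2 ^ k = 0")
    case False
    then show ?thesis unfolding eq by (subst card_ip) simp_all
  qed (simp add: eq)
qed

lemma ip_eqI:
  assumes "\<And>y. y < 2 ^ k \<Longrightarrow> ip a y = ip b y" "a < 2 ^ k" "b < 2 ^ k"
  shows "a = b"
proof (rule ccontr)
  assume "a \<noteq> b"
  then have "a XOR b \<noteq> 0" by (metis xor.assoc xor.left_neutral xor_self_eq)
  then obtain y where "y < 2 ^ k" "ip (a XOR b) y"
    using ip_nondegenerate xor_less_two_power assms by metis
  then show False using assms by (simp add: ip_xor_left)
qed

lemma card_ip_neq: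
  assumes "a < 2 ^ k" "b < 2 ^ k" "a \<noteq> b"
  shows "2 * card {x. x < 2 ^ k \<and> ip a x \<noteq> ip b x} = 2 ^ k"
proof -
  have "a XOR b \<noteq> 0" using assms by (metis xor.assoc xor.left_neutral xor_self_eq)
  from card_ip(1)[OF xor_less_two_power[OF assms(1,2)] this] show ?thesis
    by (simp add: ip_xor_left)
qed

text \<open>Half of the rows are nonzero at \<open>b\<close>, and each of these holds on half of its
  columns. The gap between 0 and 1/4 later turns "almost everywhere" into "everywhere" for bilinear
  identities.\<close>

lemma card_bilinear_ge:
  assumes add1: "\<And>x x' y. x < 2 ^ k \<Longrightarrow> x' < 2 ^ k \<Longrightarrow> y < 2 ^ k \<Longrightarrow> f (x XOR x') y \<longleftrightarrow> f x y \<noteq> f x' y"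
    and add2: "\<And>x y y'. x < 2 ^ k \<Longrightarrow> y < 2 ^ k \<Longrightarrow> y' < 2 ^ k \<Longrightarrow> f x (y XOR y') \<longleftrightarrow> f x y \<noteq> f x y'"
    and a: "a < 2 ^ k" "b < 2 ^ k" "f a b"
  shows "2 ^ k * 2 ^ k \<le> 4 * card {(x, y). x < (2::nat) ^ k \<and> y < (2::nat) ^ k \<and> f x y}"
proof -
  let ?A = "{x. x < (2::nat) ^ k \<and> f x b}"
  let ?B = "\<lambda>x. {y. y < (2::nat) ^ k \<and> f x y}"
  have cA: "2 * card ?A = 2 ^ k"
    by (rule card_additive(1)[where a = a]) (use add1 a in auto)
  have cB: "2 * card (?B x) = 2 ^ k" if "x \<in> ?A" for x
    by (rule card_additive(1)[where a = b]) (use add2 a that in auto)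
  have "4 * card (Sigma ?A ?B) = 4 * (\<Sum>x\<in>?A. card (?B x))"
    by (subst card_SigmaI) auto
  also have "\<dots> = 2 * (\<Sum>x\<in>?A. 2 * card (?B x))"
    by (simp add: sum_distrib_left)
  also have "\<dots> = 2 * (\<Sum>x\<in>?A. 2 ^ k)" using cB by simp
  also have "\<dots> = 2 ^ k * 2 ^ k" using cA by simp
  finally have "2 ^ k * 2 ^ k = 4 * card (Sigma ?A ?B)" ..
  moreover have "card (Sigma ?A ?B) \<le> card {(x, y). x < (2::nat) ^ k \<and> y < (2::nat) ^ k \<and> f x y}"
  proof (rule card_mono)
    show "finite {(x, y). x < (2::nat) ^ k \<and> y < (2::nat) ^ k \<and> f x y}"
      by (rule finite_subset[of _ "{..<2 ^ k} \<times> {..<2 ^ k}"]) auto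
  qed auto
  ultimately show ?thesis by linarith
qed

text \<open>Parseval for the indicator of \<open>W\<close>: the squares of its character sums add up
  to \<open>2 ^ k * card W\<close>, so at most \<open>1 / \<epsilon>\<^sup>2\<close> of them can
  exceed \<open>\<epsilon> * 2 ^ k\<close> in absolute value. The bound does not depend on
  \<open>k\<close>.\<close>

lemma ip_bias_count:
  assumes W: "W \<subseteq> {..<2 ^ k}" and "0 < \<epsilon>"
  shows "\<epsilon>\<^sup>2 * real (card {x. x < 2 ^ k \<and> \<epsilon> * 2 ^ k < \<bar>2 * real (card {w \<in> W. ip w x}) - real (card W)\<bar>}) \<le> 1"
proof -
  define \<chi> where "\<chi> w x = (if ip w x then -1 else 1 :: real)" for w x
  have \<chi>_mult: "\<chi> v x * \<chi> w x = \<chi> (v XOR w) x" for v w x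
    by (simp add: \<chi>_def ip_xor_left)
  have finW: "finite W" using W finite_subset by blast
  have bias: "(\<Sum>w\<in>W. \<chi> w x) = real (card W) - 2 * real (card {w \<in> W. ip w x})" for x
  proof -
    have "(\<Sum>w\<in>W. \<chi> w x) = (\<Sum>w\<in>W. 1 - 2 * (if ip w x then 1 else 0))"
      by (rule sum.cong) (auto simp: \<chi>_def)
    also have "\<dots> = real (card W) - 2 * real (card {w \<in> W. ip w x})"
      using finW by (simp add: sum_subtractf sum_distrib_left[symmetric] sum.If_cases Int_def)
    finally show ?thesis .
  qed
  have orth: "(\<Sum>x<2 ^ k. \<chi> c x) = (if c = 0 then 2 ^ k else 0)" if "c < 2 ^ k" for c
  proof (cases "c = 0")
    case False
    have "(\<Sum>x<2 ^ k. \<chi> c x) = (\<Sum>x<2 ^ k. 1 - 2 * (if ip c x then 1 else 0))"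
      by (rule sum.cong) (auto simp: \<chi>_def)
    also have "\<dots> = 2 ^ k - 2 * real (card {x. x < 2 ^ k \<and> ip c x})"
      by (simp add: sum_subtractf sum_distrib_left[symmetric] sum.If_cases Int_def)
    also have "\<dots> = 0" using card_ip(1)[OF that False] by (metis diff_self of_nat_mult of_nat_numeral of_nat_power)
    finally show ?thesis using False by simp
  qed (simp add: \<chi>_def)
  \<comment> \<open>After expanding the square and moving the sum over \<open>x\<close> inside, the
    terms with \<open>v \<noteq> w\<close> are sums of nontrivial characters and vanish.\<close>
  have "(\<Sum>x<2 ^ k. (\<Sum>w\<in>W. \<chi> w x)\<^sup>2) = (\<Sum>x<2 ^ k. \<Sum>v\<in>W. \<Sum>w\<in>W. \<chi> (v XOR w) x)"
    by (simp add: power2_eq_square sum_product \<chi>_mult)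
  also have "\<dots> = (\<Sum>v\<in>W. \<Sum>x<2 ^ k. \<Sum>w\<in>W. \<chi> (v XOR w) x)"
    by (rule sum.swap)
  also have "\<dots> = (\<Sum>v\<in>W. \<Sum>w\<in>W. \<Sum>x<2 ^ k. \<chi> (v XOR w) x)"
    by (rule sum.cong[OF refl sum.swap])
  also have "\<dots> = (\<Sum>v\<in>W. \<Sum>w\<in>W. if v = w then 2 ^ k else 0)"
  proof (intro sum.cong refl)
    fix v w assume "v \<in> W" "w \<in> W"
    then have "v XOR w < 2 ^ k" using W by (intro xor_less_two_power) auto
    moreover have "v XOR w = 0 \<longleftrightarrow> v = w" by (metis xor.assoc xor.left_neutral xor_self_eq)
    ultimately show "(\<Sum>x<2 ^ k. \<chi> (v XOR w) x) = (if v = w then 2 ^ k else 0)"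
      by (simp add: orth)
  qed
  also have "\<dots> = 2 ^ k * real (card W)" using finW by simp
  also have "\<dots> \<le> 2 ^ k * 2 ^ k"
    using card_mono[OF _ W] by simp
  finally have le: "(\<Sum>x<2 ^ k. (\<Sum>w\<in>W. \<chi> w x)\<^sup>2) \<le> 2 ^ k * 2 ^ k" .
  let ?B = "{x. x < 2 ^ k \<and> \<epsilon> * 2 ^ k < \<bar>2 * real (card {w \<in> W. ip w x}) - real (card W)\<bar>}"
  have "real (card ?B) * (\<epsilon> * 2 ^ k)\<^sup>2 = (\<Sum>x\<in>?B. (\<epsilon> * 2 ^ k)\<^sup>2)" by simp
  also have "\<dots> \<le> (\<Sum>x\<in>?B. (\<Sum>w\<in>W. \<chi> w x)\<^sup>2)"
  proof (rule sum_mono)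
    fix x assume "x \<in> ?B"
    then have "\<bar>\<epsilon> * 2 ^ k\<bar> \<le> \<bar>\<Sum>w\<in>W. \<chi> w x\<bar>" using \<open>0 < \<epsilon>\<close> by (auto simp: bias)
    then show "(\<epsilon> * 2 ^ k)\<^sup>2 \<le> (\<Sum>w\<in>W. \<chi> w x)\<^sup>2" by (simp add: abs_le_square_iff)
  qed
  also have "\<dots> \<le> (\<Sum>x<2 ^ k. (\<Sum>w\<in>W. \<chi> w x)\<^sup>2)" by (rule sum_mono2) auto
  finally have "real (card ?B) * (\<epsilon> * 2 ^ k)\<^sup>2 \<le> 2 ^ k * 2 ^ k"
    using le by linarith
  moreover have "real (card ?B) * (\<epsilon> * 2 ^ k)\<^sup>2 = \<epsilon>\<^sup>2 * real (card ?B) * (2 ^ k * 2 ^ k)"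
    by (simp add: power2_eq_square)
  ultimately have "\<epsilon>\<^sup>2 * real (card ?B) * (2 ^ k * 2 ^ k) \<le> 1 * (2 ^ k * 2 ^ k)"
    by linarith
  then show ?thesis by (rule mult_right_le_imp_le) simp
qed

section \<open>The graphs\<close>

text \<open>
  The label \<open>h 2\<^sup>k + w\<close> with \<open>w < 2\<^sup>k\<close> stands for the vector \<open>w\<close> in block \<open>h\<close>. The last block is usually
  incomplete, and block 0 lacks its zero vector because labels start at 1. There are no edges among the blocks
  other than 1, 2, 3.
\<close>

definition block_row :: "nat \<Rightarrow> nat \<Rightarrow> nat \<Rightarrow> nat \<Rightarrow> bool" where
  "block_row h w h' x =
     (if h' = 1 then h = 1 \<or> ip w x
      else if h' = 2 then
        (if h = 1 then ip w x else if h = 2 then \<not> ip w x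
         else if h = 3 then \<not> ip (w div 2) x else ip (w XOR h) x)
      else
        (if h = 1 then ip w x else if h = 2 then \<not> ip w (x div 2)
         else if h = 3 then False else ip (w XOR (h div 2)) x))"

definition block_adj :: "nat \<Rightarrow> nat \<Rightarrow> nat \<Rightarrow> nat \<Rightarrow> bool" where
  "block_adj h w h' x =
     (if h' \<in> {1, 2, 3} then block_row h w h' x else h \<in> {1, 2, 3} \<and> block_row h' x h w)"

definition label_adj :: "nat \<Rightarrow> nat \<Rightarrow> nat \<Rightarrow> bool" where
  "label_adj k u v \<longleftrightarrow> u \<noteq> v \<and> block_adj (u div 2 ^ k) (u mod 2 ^ k) (v div 2 ^ k) (v mod 2 ^ k)"

text \<open>The four top bits of \<open>n\<close> become the index of its block, so that
  \<open>8 * 2 ^ dim n \<le> n < 16 * 2 ^ dim n\<close> as soon as \<open>n\<close> has four bits.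
  For shorter \<open>n\<close> the subtraction truncates to 0 and the graph is merely
  defined.\<close>

definition dim :: "nat \<Rightarrow> nat" where
  "dim n = length (bits n) - 4"

definition block_graph :: "nat \<Rightarrow> nat set set" where
  "block_graph n = {{u, v} |u v. u \<in> {1..n} \<and> v \<in> {1..n} \<and> label_adj (dim n) u v}"

text \<open>With a block outside 1, 2, 3 the symmetry is built in; among 1, 2, 3 the table itself is
  symmetric, \<open>w div 2\<close> in row 3 matching \<open>x div 2\<close> in row 2.\<close>

lemma block_adj_commute: "block_adj h w h' x = block_adj h' x h w"
  unfolding block_adj_def block_row_def
  by (auto simp: ip_commute)

lemma label_adj_commute: "label_adj k u v = label_adj k v u"
  using block_adj_commute by (auto simp: label_adj_def)

lemma in_block_graph_iff:
  "{u, v} \<in> block_graph n \<longleftrightarrow> u \<in> {1..n} \<and> v \<in> {1..n} \<and> label_adj (dim n) u v"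
  unfolding block_graph_def by (auto simp: doubleton_eq_iff label_adj_commute)

lemma simple_block_graph: "simple_graph {1..n} (block_graph n)"
  unfolding simple_graph_def block_graph_def label_adj_def by (intro conjI) (simp, blast)

lemma two_power_length_bits: "n < 2 ^ length (bits n)" "n \<noteq> 0 \<Longrightarrow> 2 ^ length (bits n) \<le> 2 * n"
proof (induction n rule: bits.induct)
  case (1 n)
  {
    case 1
    show ?case using "1.IH"(1) by (subst bits.simps) auto
  next
    case 2
    show ?case
    proof (cases "n = 1")
      case False
      then have "n div 2 \<noteq> 0" "n \<noteq> 0" using 2 by auto
      then have "2 ^ length (bits (n div 2)) \<le> 2 * (n div 2)" using "1.IH"(2) 2 by blast
      then show ?thesis using 2 by (subst bits.simps) simp
    qed (simp add: bits.simps)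
  }
qed

locale block_graph_params =
  fixes k n :: nat
  assumes k_ge: "10 \<le> k" and n_ge: "8 * 2 ^ k \<le> n" and n_less: "n < 16 * 2 ^ k"
begin

definition q :: nat where "q = 2 ^ k"
text \<open>The number of vectors at which a nonzero functional holds; all degrees are measured in
  this unit.\<close>

definition r :: nat where "r = 2 ^ (k - 1)"
definition V :: "nat set" where "V = {1..n}"
definition A :: "nat \<Rightarrow> nat \<Rightarrow> bool" where "A = label_adj k"
definition deg :: "nat \<Rightarrow> nat" where "deg u = card {v \<in> V. A u v}"

lemma q_eq: "q = 2 * r"
  unfolding q_def r_def using k_ge by (cases k) simp_all

lemma q_ge: "1024 \<le> q"
proof -
  have "(2::nat) ^ 10 \<le> 2 ^ k" using k_ge by (rule power_increasing) simp
  then show ?thesis by (simp add: q_def)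
qed

lemma q_pos [simp]: "0 < q" by (simp add: q_def)

lemma n_bounds: "8 * q \<le> n" "n < 16 * q"
  using n_ge n_less by (simp_all add: q_def)

lemma finite_V [simp]: "finite V" by (simp add: V_def)

lemma A_commute: "A u v = A v u" by (simp add: A_def label_adj_commute)

lemma A_irrefl [simp]: "\<not> A u u" by (simp add: A_def label_adj_def)

lemma A_label:
  assumes "w < q" "x < q"
  shows "A (h * q + w) (h' * q + x) \<longleftrightarrow> (h, w) \<noteq> (h', x) \<and> block_adj h w h' x"
proof -
  have [simp]: "(h * q + w) div 2 ^ k = h" "(h * q + w) mod 2 ^ k = w" if "w < q" for h w
    using that by (simp_all add: q_def)
  have "h * q + w = h' * q + x \<longleftrightarrow> h = h' \<and> w = x"
    using assms by (metis div_mult_self3 div_less mod_less mod_mult_self3 q_pos add.right_neutral less_numeral_extra(3))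
  then show ?thesis using assms by (simp add: A_def label_adj_def)
qed

lemma A_iff: "A u v \<longleftrightarrow> u \<noteq> v \<and> block_adj (u div q) (u mod q) (v div q) (v mod q)"
  by (simp add: A_def label_adj_def q_def)

lemma label_in_V: "h \<in> {1..7} \<Longrightarrow> w < q \<Longrightarrow> h * q + w \<in> V"
proof -
  assume "h \<in> {1..7}" "w < q"
  then have "h * q \<le> 7 * q" "1 * q \<le> h * q" by (intro mult_right_mono; simp)+
  then show ?thesis using n_bounds(1) \<open>w < q\<close> q_ge unfolding V_def by (simp; linarith)
qed

lemma block_less_16: "u \<in> V \<Longrightarrow> u div q < 16"
  using n_bounds by (simp add: V_def less_mult_imp_div_less)

lemma card_block:
  assumes "h \<in> {1..7}"
  shows "card {v \<in> V. v div q = h \<and> f (v mod q)} = card {x. x < q \<and> f x}"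
proof (rule bij_betw_same_card)
  show "bij_betw (\<lambda>v. v mod q) {v \<in> V. v div q = h \<and> f (v mod q)} {x. x < q \<and> f x}"
  proof (rule bij_betw_byWitness[where f' = "\<lambda>x. h * q + x"])
    show "(\<lambda>x. h * q + x) ` {x. x < q \<and> f x} \<subseteq> {v \<in> V. v div q = h \<and> f (v mod q)}"
      using label_in_V assms by auto
  qed auto
qed

subsection \<open>Distinct rows are far apart\<close>

lemma card_ge_r:
  "r \<le> card {x. x < q \<and> \<not> ip c x}"
  using card_not_ip_ge[of k c] q_eq by (simp add: q_def)

lemma card_ip_neq_r:
  "a < q \<Longrightarrow> b < q \<Longrightarrow> a \<noteq> b \<Longrightarrow> card {x. x < q \<and> ip a x \<noteq> ip b x} = r"
  using card_ip_neq[of a k b] q_eq by (simp add: q_def)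

lemma card_ip_r:
  assumes "c < q" "c \<noteq> 0"
  shows "card {x. x < q \<and> ip c x} = r" "card {x. x < q \<and> \<not> ip c x} = r"
  using card_ip[of c k] q_eq assms by (simp_all add: q_def)

lemma card_ip_le_r: "card {x. x < q \<and> ip c x} \<le> r"
  using card_ip_le[of k c] q_eq by (simp add: q_def)

lemma xor_less_q: "x < q \<Longrightarrow> y < q \<Longrightarrow> x XOR y < q"
  unfolding q_def by (rule xor_less_two_power)

lemma xor_eq_iff: "(x::nat) XOR a = y XOR a \<longleftrightarrow> x = y" "a XOR (x::nat) = a XOR y \<longleftrightarrow> x = y"
  by (metis xor.assoc xor.commute xor.right_neutral xor_self_eq)+

text \<open>In some column block the two rows are either distinct functionals, which differ on
  exactly \<open>r\<close> vectors, or their difference is the complement of a functional, which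
  holds on at least \<open>r\<close> vectors even if the functional is zero. For equal vectors in
  different blocks, one of them block 2 or 3, the negated entries produce the second kind.\<close>

lemma block_rows_far:
  assumes "(h, w) \<noteq> (h', w')" "w < q" "w' < q" "h < 16" "h' < 16"
  shows "\<exists>c\<in>{1, 2, 3}. r \<le> card {x. x < q \<and> block_adj h w c x \<noteq> block_adj h' w' c x}"
proof -
  let ?D = "\<lambda>h w h' w' c. card {x. x < q \<and> block_row h w c x \<noteq> block_row h' w' c x}"
  \<comment> \<open>The condition \<open>le\<close> orients the unordered pair so that a special
    block among 1, 2, 3 comes first, the smaller one if both are special. At least one of the two
    orders satisfies it.\<close>
  have base: "\<exists>c\<in>{1, 2, 3}. r \<le> ?D h w h' w' c"
    if d: "(h, w) \<noteq> (h', w')" "w < q" "w' < q" "h < 16" "h' < 16"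
      and le: "h \<in> {1, 2, 3} \<and> h' \<notin> {1, 2, 3} \<or> h \<in> {1, 2, 3} \<and> h \<le> h' \<or> h \<notin> {1, 2, 3} \<and> h' \<notin> {1, 2, 3}"
    for h w h' w'
  proof -
    consider "h = 1" "h' = 1" | "h = 1" "h' \<noteq> 1" | "h \<noteq> 1" "h' \<noteq> 1" "w \<noteq> w'"
      | "h = 2" "h' = 3" "w = w'" | "h = 2" "h' \<notin> {1, 2, 3}" "w = w'"
      | "h = 3" "h' \<notin> {1, 2, 3}" "w = w'"
      | "h \<notin> {1, 2, 3}" "h' \<notin> {1, 2, 3}" "w = w'" "h \<noteq> h'"
      using le d by (cases "w = w'"; cases "h = h'"; cases "h' = 3") auto
    then show ?thesis
    proof cases
      case 1
      then have "?D h w h' w' 2 = r" using card_ip_neq_r d by (simp add: block_row_def)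
      then show ?thesis by fastforce
    next
      case 2
      then have "r \<le> ?D h w h' w' 1" using card_ge_r by (simp add: block_row_def)
      then show ?thesis by fastforce
    next
      case 3
      then have "?D h w h' w' 1 = r" using card_ip_neq_r d by (simp add: block_row_def)
      then show ?thesis by fastforce
    next
      case 4
      then have "r \<le> ?D h w h' w' 3" using card_ge_r[of "2 * w"] by (simp add: block_row_def ip_double)
      then show ?thesis by fastforce
    next
      case 5
      have "(\<not> ip w x) \<noteq> ip (w XOR h') x \<longleftrightarrow> \<not> ip h' x" for x
        by (auto simp: ip_xor_left)
      then have "r \<le> ?D h w h' w' 2" using card_ge_r[of h'] 5 by (simp add: block_row_def)
      then show ?thesis by fastforce
    next
      case 6
      have "(\<not> ip (w div 2) x) \<noteq> ip (w XOR h') x \<longleftrightarrow> \<not> ip ((w div 2) XOR w XOR h') x" for x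
        by (auto simp: ip_xor_left)
      then have "r \<le> ?D h w h' w' 2" using card_ge_r[of "(w div 2) XOR w XOR h'"] 6
        by (simp add: block_row_def)
      then show ?thesis by fastforce
    next
      case 7
      \<comment> \<open>Both block numbers are below 16 and hence below \<open>q\<close>, so
        distinct blocks have distinct offset vectors.\<close>
      then have "?D h w h' w' 2 = r"
        using card_ip_neq_r[of "w XOR h" "w XOR h'"] d xor_less_q q_ge
        by (simp add: block_row_def xor_eq_iff)
      then show ?thesis by fastforce
    qed
  qed
  have sym: "?D h' w' h w c = ?D h w h' w' c" for c
    by (rule arg_cong[where f = card]) auto
  have "\<exists>c\<in>{1, 2, 3}. r \<le> ?D h w h' w' c"
  proof (rule ccontr)
    assume contr: "\<not> ?thesis"
    have "\<not> (h \<in> {1, 2, 3} \<and> h' \<notin> {1, 2, 3} \<or> h \<in> {1, 2, 3} \<and> h \<le> h' \<or> h \<notin> {1, 2, 3} \<and> h' \<notin> {1, 2, 3})"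
      using base[OF assms] contr by blast
    moreover have "\<not> (h' \<in> {1, 2, 3} \<and> h \<notin> {1, 2, 3} \<or> h' \<in> {1, 2, 3} \<and> h' \<le> h \<or> h' \<notin> {1, 2, 3} \<and> h \<notin> {1, 2, 3})"
      using base[OF assms(1)[symmetric] assms(3,2,5,4)] contr unfolding sym by blast
    ultimately show False by linarith
  qed
  then show ?thesis by (auto simp: block_adj_def)
qed

definition S :: "nat set" where "S = {s \<in> V. s div q \<in> {1, 2, 3}}"

text \<open>The loss of 2 accounts for the columns \<open>u\<close> and \<open>v\<close>: there
  \<open>A\<close> is false because loops are excluded, whatever \<open>block_adj\<close>
  says.\<close>

lemma rows_far:
  assumes "u \<in> V" "v \<in> V" "u \<noteq> v"
  shows "r \<le> card {s \<in> S. A u s \<noteq> A v s} + 2"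
proof -
  have "(u div q, u mod q) \<noteq> (v div q, v mod q)"
    using assms(3) by (metis div_mult_mod_eq prod.inject)
  then obtain c where c: "c \<in> {1, 2, 3}"
    and le: "r \<le> card {x. x < q \<and> block_adj (u div q) (u mod q) c x \<noteq> block_adj (v div q) (v mod q) c x}"
    using block_rows_far[of "u div q" "u mod q" "v div q" "v mod q"] block_less_16 assms(1,2) by auto
  let ?B = "{s \<in> V. s div q = c \<and> block_adj (u div q) (u mod q) c (s mod q) \<noteq> block_adj (v div q) (v mod q) c (s mod q)}"
  have "r \<le> card ?B"
    using c le by (subst card_block) auto
  also have "\<dots> \<le> card ({s \<in> S. A u s \<noteq> A v s} \<union> {u, v})"
    by (rule card_mono) (use c in \<open>auto simp: S_def A_iff\<close>)
  also have "\<dots> \<le> card {s \<in> S. A u s \<noteq> A v s} + card {u, v}" by (rule card_Un_le)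
  also have "card {u, v} \<le> 2" by (simp add: card_insert_if)
  finally show ?thesis by simp
qed

end

context block_graph_params
begin

subsection \<open>Degrees\<close>

definition m :: nat where "m = n div q"
definition \<rho> :: nat where "\<rho> = n mod q"

lemma m_bounds: "8 \<le> m" "m < 16"
  using n_bounds by (simp_all add: m_def less_eq_div_iff_mult_less_eq less_mult_imp_div_less)

lemma n_eq: "n = m * q + \<rho>" by (simp add: m_def \<rho>_def)

lemma r_pos [simp]: "0 < r" by (simp add: r_def)

lemma \<rho>_less: "\<rho> < q" by (simp add: \<rho>_def)

definition block_deg :: "nat \<Rightarrow> nat \<Rightarrow> nat \<Rightarrow> nat" where
  "block_deg h w j = card {x. x < q \<and> (h, w) \<noteq> (j, x) \<and> block_adj h w j x}"

definition offset :: "nat \<Rightarrow> nat \<Rightarrow> nat" where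
  "offset j h = (if j = 1 then 0 else if j = 2 then h else h div 2)"

definition rest_deg :: "nat \<Rightarrow> nat \<Rightarrow> nat" where
  "rest_deg j w = card {v \<in> V. v div q \<notin> {1, 2, 3} \<and> ip (v mod q XOR offset j (v div q)) w}"

text \<open>The label \<open>n\<close> is itself a vertex, hence \<open>x \<le> \<rho>\<close>: the
  last block consists of the \<open>\<rho> + 1\<close> vectors from 0 to
  \<open>\<rho>\<close>.\<close>

definition last_deg :: "nat \<Rightarrow> nat \<Rightarrow> nat" where
  "last_deg j w = card {x. x \<le> \<rho> \<and> ip (x XOR offset j m) w}"

lemma deg_split:
  "deg u = block_deg (u div q) (u mod q) 1 + block_deg (u div q) (u mod q) 2 +
     block_deg (u div q) (u mod q) 3 + card {v \<in> V. v div q \<notin> {1, 2, 3} \<and> A u v}"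
proof -
  have neq: "u \<noteq> v \<longleftrightarrow> (u div q, u mod q) \<noteq> (v div q, v mod q)" for v
    by (metis div_mult_mod_eq prod.inject)
  have "card {v \<in> V. v div q = j \<and> A u v} = block_deg (u div q) (u mod q) j" if "j \<in> {1, 2, 3}" for j
  proof -
    have "{v \<in> V. v div q = j \<and> A u v} = {v \<in> V. v div q = j \<and> (u div q, u mod q) \<noteq> (j, v mod q) \<and>
        block_adj (u div q) (u mod q) j (v mod q)}"
      by (auto simp: A_iff neq)
    also have "card \<dots> = block_deg (u div q) (u mod q) j"
      unfolding block_deg_def by (rule card_block) (use that in auto)
    finally show ?thesis .
  qed
  moreover have "deg u = card {v \<in> V. v div q = 1 \<and> A u v} + card {v \<in> V. v div q = 2 \<and> A u v} +
     card {v \<in> V. v div q = 3 \<and> A u v} + card {v \<in> V. v div q \<notin> {1, 2, 3} \<and> A u v}"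
  proof -
    have "{v \<in> V. A u v} = {v \<in> V. v div q = 1 \<and> A u v} \<union> {v \<in> V. v div q = 2 \<and> A u v} \<union>
       {v \<in> V. v div q = 3 \<and> A u v} \<union> {v \<in> V. v div q \<notin> {1, 2, 3} \<and> A u v}" by auto
    then show ?thesis unfolding deg_def
      by (simp only:) (subst card_Un_disjoint; auto)+
  qed
  ultimately show ?thesis by simp
qed

lemma rest_count:
  assumes "j \<in> {1, 2, 3}" "w < q"
  shows "card {v \<in> V. v div q \<notin> {1, 2, 3} \<and> A (j * q + w) v} = rest_deg j w"
proof -
  have "A (j * q + w) v \<longleftrightarrow> ip (v mod q XOR offset j (v div q)) w"
    if "v div q \<notin> {1, 2, 3}" for v
    using that assms by (auto simp: A_iff block_adj_def block_row_def offset_def)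
  then show ?thesis unfolding rest_deg_def by (metis (lifting))
qed

lemma deg_split_block:
  assumes "j \<in> {1, 2, 3}" "w < q"
  shows "deg (j * q + w) = block_deg j w 1 + block_deg j w 2 + block_deg j w 3 + rest_deg j w"
  using deg_split[of "j * q + w"] assms(2) unfolding rest_count[OF assms] by simp

lemma m_times: "m * r = (m - 3) * r + 3 * r" "(m + 1) * r = (m - 3) * r + 4 * r"
  "(m - 1) * r = (m - 3) * r + 2 * r"
proof -
  obtain j where "m = 8 + j" using m_bounds le_Suc_ex by blast
  then show "m * r = (m - 3) * r + 3 * r" "(m + 1) * r = (m - 3) * r + 4 * r"
    "(m - 1) * r = (m - 3) * r + 2 * r"
    by (simp_all add: algebra_simps)
qed

lemma rest_deg_0 [simp]: "rest_deg j 0 = 0"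
  by (simp add: rest_deg_def)

lemma offset_less: "h < 16 \<Longrightarrow> offset j h < q"
  using q_ge by (auto simp: offset_def)

lemma card_ip_xor_r:
  assumes "c < q" "w < q" "w \<noteq> 0"
  shows "card {x. x < q \<and> ip (x XOR c) w} = r"
proof -
  have "ip (x XOR c) w \<longleftrightarrow> ip w x \<noteq> ip w c" for x
    using ip_xor_right ip_commute by metis
  then have "{x. x < q \<and> ip (x XOR c) w} = {x. x < q \<and> (ip w x \<noteq> ip w c)}" by simp
  then show ?thesis using card_ip_r assms by (cases "ip w c") simp_all
qed

text \<open>The complete blocks outside 1, 2, 3 are block 0 and the blocks 4 to
  \<open>m - 1\<close>, which are \<open>m - 3\<close> in number. Each contributes \<open>r\<close>,
  since an offset only translates the block.\<close>

lemma rest_deg_eq: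
  assumes "w < q" "w \<noteq> 0"
  shows "rest_deg j w = (m - 3) * r + last_deg j w"
proof -
  let ?f = "\<lambda>h. {x. x < q \<and> h * q + x \<in> V \<and> ip (x XOR offset j h) w}"
  let ?H = "insert 0 (insert m {4..<m})"
  have "bij_betw (\<lambda>v. (v div q, v mod q))
      {v \<in> V. v div q \<notin> {1, 2, 3} \<and> ip (v mod q XOR offset j (v div q)) w} (Sigma ?H ?f)"
  proof (rule bij_betw_byWitness[where f' = "\<lambda>(h, x). h * q + x"])
    show "(\<lambda>v. (v div q, v mod q)) ` {v \<in> V. v div q \<notin> {1, 2, 3} \<and> ip (v mod q XOR offset j (v div q)) w}
      \<subseteq> Sigma ?H ?f"
    proof
      fix z assume "z \<in> (\<lambda>v. (v div q, v mod q)) `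
        {v \<in> V. v div q \<notin> {1, 2, 3} \<and> ip (v mod q XOR offset j (v div q)) w}"
      then obtain v where v: "z = (v div q, v mod q)" "v \<in> V" "v div q \<notin> {1, 2, 3}"
        "ip (v mod q XOR offset j (v div q)) w" by blast
      have "v div q \<le> m" using v(2) by (simp add: V_def m_def div_le_mono)
      then have "v div q \<in> ?H" using v(3) by auto
      then show "z \<in> Sigma ?H ?f" using v by simp
    qed
    show "(\<lambda>(h, x). h * q + x) ` Sigma ?H ?f
      \<subseteq> {v \<in> V. v div q \<notin> {1, 2, 3} \<and> ip (v mod q XOR offset j (v div q)) w}"
      using m_bounds by auto
  qed auto
  then have "rest_deg j w = card (Sigma ?H ?f)"
    unfolding rest_deg_def by (rule bij_betw_same_card)
  also have "\<dots> = (\<Sum>h\<in>?H. card (?f h))" by (subst card_SigmaI) auto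
  also have "\<dots> = card (?f 0) + card (?f m) + (\<Sum>h\<in>{4..<m}. card (?f h))"
    using m_bounds by (simp add: ac_simps)
  \<comment> \<open>Label 0 is not a vertex, but block 0 has offset 0 and \<open>ip 0 w\<close> is
    false, so restoring the missing vector does not change the count.\<close>
  also have "?f 0 = {x. x < q \<and> ip (x XOR offset j 0) w}"
    using n_bounds by (auto simp: V_def offset_def intro!: Suc_leI) (metis gr0I ip_0(1))+
  also have "card \<dots> = r" using assms by (intro card_ip_xor_r) (auto simp: offset_def)
  also have "?f m = {x. x \<le> \<rho> \<and> ip (x XOR offset j m) w}"
    using n_eq \<rho>_less m_bounds by (auto simp: V_def Suc_le_eq)
  also have "(\<Sum>h\<in>{4..<m}. card (?f h)) = (\<Sum>h\<in>{4..<m}. r)"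
  proof (rule sum.cong)
    fix h assume h: "h \<in> {4..<m}"
    have "h * q + x \<in> V" if "x < q" for x
    proof -
      have "(h + 1) * q \<le> m * q" "1 * q \<le> h * q" using h by (intro mult_right_mono; simp)+
      moreover have "0 < h * q" using h by simp
      ultimately show ?thesis using that n_eq by (simp add: V_def Suc_le_eq)
    qed
    then have "?f h = {x. x < q \<and> ip (x XOR offset j h) w}" by auto
    then show "card (?f h) = r"
      using card_ip_xor_r offset_less h assms m_bounds by simp
  qed simp
  finally have "rest_deg j w = r + last_deg j w + (m - 4) * r" by (simp add: last_deg_def)
  moreover have "m - 3 = Suc (m - 4)" using m_bounds by simp
  ultimately show ?thesis by simp
qed

lemma last_deg_le:
  assumes "w < q" "w \<noteq> 0"
  shows "last_deg j w \<le> r"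
proof -
  have "last_deg j w \<le> card {x. x < q \<and> ip (x XOR offset j m) w}"
    unfolding last_deg_def by (rule card_mono) (use \<rho>_less in auto)
  then show ?thesis using card_ip_xor_r offset_less m_bounds assms by simp
qed

lemma card_less_q: "card {x. x < q \<and> f x} \<le> q"
proof -
  have "card {x. x < q \<and> f x} \<le> card {..<q}" by (rule card_mono) auto
  then show ?thesis by simp
qed

lemma card_Diff_q: "card {x. x < q \<and> w \<noteq> x \<and> f x} + 1 \<ge> card {x. x < q \<and> f x}"
proof -
  have "card {x. x < q \<and> f x} \<le> card (insert w {x. x < q \<and> w \<noteq> x \<and> f x})"
    by (rule card_mono) auto
  also have "\<dots> \<le> card {x. x < q \<and> w \<noteq> x \<and> f x} + 1"
    using card_insert_le_m1 by (simp add: card_insert_if)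
  finally show ?thesis .
qed

lemma card_neq_q: "w < q \<Longrightarrow> card {x. x < q \<and> w \<noteq> x} = q - 1"
proof -
  assume "w < q"
  have "{x. x < q \<and> w \<noteq> x} = {..<q} - {w}" by auto
  then show ?thesis using \<open>w < q\<close> by simp
qed

lemma deg_1:
  assumes "w < q"
  shows "deg (1 * q + w) = (if w = 0 then q - 1 else (m + 1) * r + last_deg 1 w - 1)"
proof -
  have "block_deg 1 w 1 = q - 1" "block_deg 1 w 2 = card {x. x < q \<and> ip w x}"
    "block_deg 1 w 3 = card {x. x < q \<and> ip w x}"
    using card_neq_q[OF assms] by (simp_all add: block_deg_def block_adj_def block_row_def)
  then have "deg (1 * q + w) = q - 1 + 2 * card {x. x < q \<and> ip w x} + rest_deg 1 w"
    using assms deg_split_block[of 1 w] by simp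
  then show ?thesis
    using q_eq r_pos m_times(2) card_ip_r(1)[OF assms] rest_deg_eq[OF assms, of 1] by (cases "w = 0"; simp; linarith)
qed

text \<open>The slack of 1 comes from the excluded loop, which matters only if \<open>ip w w\<close>
  fails. The vector \<open>r\<close> is the nonzero one that doubling modulo \<open>q\<close> sends
  to 0; it is joined to all of block 3 instead of half of it.\<close>

lemma deg_2:
  assumes "w < q" "w \<noteq> 0"
  shows "deg (2 * q + w) \<le> (m + 1) * r + last_deg 2 w" "m * r + last_deg 2 w \<le> deg (2 * q + w) + 1"
    "w \<noteq> r \<Longrightarrow> deg (2 * q + w) \<le> m * r + last_deg 2 w"
proof -
  have "block_deg 2 w 1 = r"
    using assms by (simp add: block_deg_def block_adj_def block_row_def card_ip_r)
  moreover have "block_deg 2 w 2 = card {x. x < q \<and> w \<noteq> x \<and> \<not> ip w x}"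
    by (simp add: block_deg_def block_adj_def block_row_def)
  moreover have "card {x. x < q \<and> w \<noteq> x \<and> \<not> ip w x} \<le> card {x. x < q \<and> \<not> ip w x}"
    by (rule card_mono) auto
  ultimately have b2: "block_deg 2 w 1 = r" "block_deg 2 w 2 \<le> r" "r \<le> block_deg 2 w 2 + 1"
    using card_Diff_q[where w = w and f = "\<lambda>x. \<not> ip w x"] assms card_ip_r by auto
  have b3: "block_deg 2 w 3 = card {x. x < q \<and> \<not> ip (2 * w) x}"
    by (simp add: block_deg_def block_adj_def block_row_def ip_double)
  have b3': "block_deg 2 w 3 \<le> q" "r \<le> block_deg 2 w 3"
    unfolding b3 using card_less_q card_ge_r by auto
  have "deg (2 * q + w) = block_deg 2 w 1 + block_deg 2 w 2 + block_deg 2 w 3 + ((m - 3) * r + last_deg 2 w)"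
    using assms deg_split_block[of 2 w] rest_deg_eq[of w 2] by simp
  note deg = this m_times
  show "deg (2 * q + w) \<le> (m + 1) * r + last_deg 2 w" "m * r + last_deg 2 w \<le> deg (2 * q + w) + 1"
    "w \<noteq> r \<Longrightarrow> deg (2 * q + w) \<le> m * r + last_deg 2 w"
  proof -
    assume "w \<noteq> r"
    have "2 * w mod q \<noteq> 0"
    proof
      assume "2 * w mod q = 0"
      then obtain c where c: "w = r * c" unfolding q_eq by auto
      then have "c < 2" "c \<noteq> 0" "c \<noteq> 1" using assms \<open>w \<noteq> r\<close> by (auto simp: q_eq)
      then show False by simp
    qed
    then have "card {x. x < q \<and> \<not> ip (2 * w mod q) x} = r" using card_ip_r by simp
    moreover have "{x. x < q \<and> \<not> ip (2 * w mod q) x} = {x. x < q \<and> \<not> ip (2 * w) x}"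
      by (auto simp: q_def ip_mod)
    ultimately have "block_deg 2 w 3 = r" unfolding b3 by simp
    then show "deg (2 * q + w) \<le> m * r + last_deg 2 w"
      using deg(1) b2 unfolding m_times by linarith
  qed (unfold deg(1) m_times, (use b2 b3' q_eq in linarith)+)
qed

lemma deg_2_0: "deg (2 * q) = 2 * q - 1"
proof -
  have "block_deg 2 0 1 = 0" "block_deg 2 0 2 = q - 1" "block_deg 2 0 3 = q"
    using card_neq_q[of 0] by (simp_all add: block_deg_def block_adj_def block_row_def)
  then show ?thesis
    using deg_split_block[of 2 0] by simp
qed

text \<open>The vector 1 is exceptional because it is the nonzero element of the kernel of
  \<open>div 2\<close>; it is joined to all of block 2.\<close>

lemma deg_3:
  assumes "w < q" "w \<noteq> 0"
  shows "deg (3 * q + w) \<le> m * r + last_deg 3 w" "(m - 1) * r + last_deg 3 w \<le> deg (3 * q + w)"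
    "w \<noteq> 1 \<Longrightarrow> deg (3 * q + w) = (m - 1) * r + last_deg 3 w"
proof -
  have b1: "block_deg 3 w 1 = r"
    using assms by (simp add: block_deg_def block_adj_def block_row_def card_ip_r)
  have b2: "block_deg 3 w 2 = card {x. x < q \<and> \<not> ip (w div 2) x}"
    by (simp add: block_deg_def block_adj_def block_row_def)
  have b2': "block_deg 3 w 2 \<le> q" "r \<le> block_deg 3 w 2"
    unfolding b2 using card_less_q card_ge_r by auto
  have b3: "block_deg 3 w 3 = 0"
    by (simp add: block_deg_def block_adj_def block_row_def)
  have "deg (3 * q + w) = block_deg 3 w 1 + block_deg 3 w 2 + block_deg 3 w 3 + ((m - 3) * r + last_deg 3 w)"
    using assms deg_split_block[of 3 w] rest_deg_eq[of w 3] by simp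
  note deg = this m_times
  show "deg (3 * q + w) \<le> m * r + last_deg 3 w" "(m - 1) * r + last_deg 3 w \<le> deg (3 * q + w)"
    "w \<noteq> 1 \<Longrightarrow> deg (3 * q + w) = (m - 1) * r + last_deg 3 w"
  proof -
    assume "w \<noteq> 1"
    then have "w div 2 \<noteq> 0" "w div 2 < q" using assms by auto
    then have "block_deg 3 w 2 = r" unfolding b2 by (intro card_ip_r)
    then show "deg (3 * q + w) = (m - 1) * r + last_deg 3 w"
      using deg(1) b1 b3 unfolding m_times by linarith
  qed (unfold deg(1) m_times, (use b1 b2' b3 q_eq in linarith)+)
qed

lemma deg_3_0: "deg (3 * q) = q"
proof -
  have "block_deg 3 0 1 = 0" "block_deg 3 0 2 = q" "block_deg 3 0 3 = 0"
    by (simp_all add: block_deg_def block_adj_def block_row_def)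
  then show ?thesis
    using deg_split_block[of 3 0] by simp
qed

lemma deg_rest:
  assumes "h \<notin> {1, 2, 3}" "w < q"
  shows "deg (h * q + w) = card {x. x < q \<and> ip w x} + card {x. x < q \<and> ip (w XOR h) x} +
     card {x. x < q \<and> ip (w XOR (h div 2)) x}"
proof -
  have "block_deg h w 1 = card {x. x < q \<and> ip w x}" "block_deg h w 2 = card {x. x < q \<and> ip (w XOR h) x}"
    "block_deg h w 3 = card {x. x < q \<and> ip (w XOR (h div 2)) x}"
    using assms by (simp_all add: block_deg_def block_adj_def block_row_def)
  moreover have "{v \<in> V. v div q \<notin> {1, 2, 3} \<and> A (h * q + w) v} = {}"
    using assms by (auto simp: A_iff block_adj_def)
  ultimately show ?thesis
    using deg_split[of "h * q + w"] assms by (simp add: card_eq_0_iff)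
qed

lemma card_ip_xor_eq:
  assumes "a < q" "b < q" "a \<noteq> b"
  shows "card {x. x < q \<and> ip (a XOR b) x} = r"
proof (rule card_ip_r(1))
  show "a XOR b \<noteq> 0" using assms by (metis xor.assoc xor.left_neutral xor_self_eq)
qed (use assms xor_less_q in auto)

lemma deg_bounds:
  assumes "u \<in> V"
  shows "q - 1 \<le> deg u" "deg u \<le> (m + 2) * r"
proof -
  obtain h w where u: "u = h * q + w" "w < q" by (metis div_mult_mod_eq mod_less_divisor q_pos)
  then have h: "h < 16" using block_less_16[OF assms] by simp
  have mr: "8 * r \<le> m * r" "7 * r \<le> (m - 1) * r" using m_bounds by (intro mult_right_mono; simp)+
  have e: "(m + 2) * r = m * r + 2 * r" "(m + 1) * r = m * r + r" by simp_all
  have "q - 1 \<le> deg u \<and> deg u \<le> (m + 2) * r"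
  proof -
    consider "h = 1" | "h = 2" | "h = 3" | "h \<notin> {1, 2, 3}" by auto
    then show ?thesis
    proof cases
      case 1
      show ?thesis
      proof (cases "w = 0")
        case True
        then have "deg u = q - 1" using u 1 deg_1[of w] by simp
        then show ?thesis using mr(1) q_eq r_pos unfolding e by linarith
      next
        case False
        then have "deg u = m * r + r + last_deg 1 w - 1"
          using deg_1[of w] u 1 unfolding e by auto
        then show ?thesis using mr(1) q_eq last_deg_le[OF u(2) False, of 1] unfolding e by linarith
      qed
    next
      case 2
      show ?thesis
      proof (cases "w = 0")
        case True
        then have "deg u = 2 * q - 1" using u 2 deg_2_0 by simp
        then show ?thesis using mr(1) q_eq r_pos unfolding e by linarith
      next
        case False
        then have "deg u \<le> m * r + r + last_deg 2 w" "m * r + last_deg 2 w \<le> deg u + 1"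
          using deg_2(1,2)[of w] u 2 unfolding e by auto
        then show ?thesis using mr(1) q_eq last_deg_le[OF u(2) False, of 2] unfolding e by linarith
      qed
    next
      case 3
      show ?thesis
      proof (cases "w = 0")
        case True
        then have "deg u = q" using u 3 deg_3_0 by simp
        then show ?thesis using mr(1) q_eq r_pos unfolding e by linarith
      next
        case False
        have "7 * r \<le> deg u"
          using order_trans[OF mr(2) add_leD1[OF deg_3(2)[OF u(2) False]]] u 3 by simp
        moreover have "deg u \<le> m * r + last_deg 3 w"
          using deg_3(1)[OF u(2) False] u 3 by simp
        ultimately have "7 * r \<le> deg u" "deg u \<le> m * r + last_deg 3 w" by blast+
        then show ?thesis using q_eq last_deg_le[OF u(2) False, of 3] unfolding e by linarith
      qed
    next
      case 4
      let ?c = "\<lambda>a. card {x. x < q \<and> ip a x}"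
      have deg: "deg u = ?c w + ?c (w XOR h) + ?c (w XOR (h div 2))" using deg_rest 4 u by simp
      have le: "?c a \<le> r" for a by (rule card_ip_le_r)
      have less: "w XOR h < q" "w XOR (h div 2) < q" using u h q_ge xor_less_q by simp_all
      \<comment> \<open>At least two of the three functionals \<open>w\<close>,
        \<open>w XOR h\<close>, \<open>w XOR (h div 2)\<close> are nonzero: for
        \<open>w \<noteq> 0\<close> the equations \<open>w = h\<close> and
        \<open>w = h div 2\<close> exclude each other, and for \<open>w = 0\<close> the facts that 0
        is no label and that \<open>h\<close> is not 1 make \<open>h div 2\<close> nonzero.\<close>
      have "2 * r \<le> deg u"
      proof (cases "w = 0")
        case False
        show ?thesis
        proof (cases "w = h")
          case True
          then have "w \<noteq> h div 2" using False by simp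
          then have "?c (w XOR (h div 2)) = r" using card_ip_xor_eq u h q_ge by simp
          then show ?thesis using deg card_ip_r u False by simp
        next
          case F: False
          then have "?c (w XOR h) = r" using card_ip_xor_eq u h q_ge by simp
          then show ?thesis using deg card_ip_r u False by simp
        qed
      next
        case True
        then have "h \<noteq> 0" using u assms by (auto simp: V_def)
        then have "h div 2 \<noteq> 0" using 4 by auto
        then show ?thesis using deg True \<open>h \<noteq> 0\<close> card_ip_r less by simp
      qed
      moreover have "3 * r \<le> (m + 2) * r" using m_bounds by (intro mult_le_mono1) simp
      ultimately show ?thesis using deg le[of w] le[of "w XOR h"] le[of "w XOR (h div 2)"] q_eq
        by linarith
    qed
  qed
  then show "q - 1 \<le> deg u" "deg u \<le> (m + 2) * r" by simp_all
qed

section \<open>Recovering the blocks 1, 2, 3 from approximate degrees\<close>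

definition cls :: "nat \<Rightarrow> nat" where
  "cls u = (if u div q \<in> {1, 2, 3} then u div q else 0)"

text \<open>Block 1 receives about \<open>2 * r\<close> from its own clique, block 2 receives
  \<open>r\<close> from itself and block 3 nothing, while all other complete blocks give
  \<open>r\<close> each. The last block is expected to give half of its \<open>\<rho> + 1\<close>
  vectors. Other vertices see three functionals, each true \<open>r\<close> times.\<close>

definition typical_deg :: "nat \<Rightarrow> real" where
  "typical_deg c = (if c = 0 then 3 * r else (real m + 2 - real c) * r + (\<rho> + 1) / 2)"

text \<open>The second moment bound with \<open>\<epsilon> = 1 / 16\<close> for the translated last
  block, whence \<open>256 = 16 * 16\<close>.\<close>

lemma card_exceptional:
  "card {w. w < q \<and> real q / 16 < \<bar>2 * real (last_deg j w) - (\<rho> + 1)\<bar>} \<le> 256"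
proof -
  let ?W = "(\<lambda>x. x XOR offset j m) ` {..\<rho>}"
  have inj: "inj_on (\<lambda>x. x XOR offset j m) X" for X
    by (auto simp: inj_on_def xor_eq_iff)
  have card_W: "card ?W = \<rho> + 1" using card_image[OF inj] by simp
  have last: "last_deg j w = card {v \<in> ?W. ip v w}" for w
  proof -
    have "{v \<in> ?W. ip v w} = (\<lambda>x. x XOR offset j m) ` {x. x \<le> \<rho> \<and> ip (x XOR offset j m) w}" by auto
    then show ?thesis unfolding last_deg_def using card_image[OF inj] by simp
  qed
  have "?W \<subseteq> {..<2 ^ k}"
    using xor_less_q \<rho>_less offset_less m_bounds by (auto simp: q_def)
  from ip_bias_count[OF this, of "1 / 16"]
  have "(1 / 16)\<^sup>2 * real (card {w. w < q \<and> real q / 16 < \<bar>2 * real (last_deg j w) - (\<rho> + 1)\<bar>}) \<le> 1"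
    unfolding last[symmetric] card_W by (simp add: q_def)
  then show ?thesis by (simp add: power2_eq_square)
qed

text \<open>The tolerance \<open>q / 32\<close> is half of the \<open>q / 16\<close> allowed for the
  doubled \<open>last_deg\<close>; the additional 1 absorbs an excluded loop.\<close>

definition atypical :: "nat set" where
  "atypical = {u \<in> V. real q / 32 + 1 < \<bar>real (deg u) - typical_deg (cls u)\<bar>}"

lemma card_atypical: "card atypical \<le> 1000"
proof -
  let ?X = "\<lambda>j. {w. w < q \<and> real q / 16 < \<bar>2 * real (last_deg j w) - (\<rho> + 1)\<bar>}"
  \<comment> \<open>For each of the blocks 1, 2, 3: the vectors with a biased last block, the zero
    vector, and the vector degenerate for the shift (for block 1 the 0 is repeated to give all three
    sets the same shape). The last three sets are the vectors of the other blocks at which one of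
    the three functionals vanishes. In total at most \<open>3 * 258 + 3 * 16 = 822\<close>.\<close>
  let ?B = "(\<lambda>w. 1 * q + w) ` (?X 1 \<union> {0, 0}) \<union> (\<lambda>w. 2 * q + w) ` (?X 2 \<union> {0, r}) \<union>
    (\<lambda>w. 3 * q + w) ` (?X 3 \<union> {0, 1}) \<union> (\<lambda>h. h * q) ` {..<16} \<union>
    (\<lambda>h. h * q + h) ` {..<16} \<union> (\<lambda>h. h * q + h div 2) ` {..<16}"
  have finX: "finite (?X j)" for j by (rule finite_subset[of _ "{..<q}"]) auto
  have cX: "card (g ` (?X j \<union> {a, b})) \<le> 258" for g :: "nat \<Rightarrow> nat" and j a b
  proof -
    have "card (g ` (?X j \<union> {a, b})) \<le> card (?X j \<union> {a, b})" using finX by (intro card_image_le) auto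
    also have "\<dots> \<le> card (?X j) + card {a, b}" by (rule card_Un_le)
    also have "\<dots> \<le> 256 + 2" using card_exceptional by (intro add_mono) (auto simp: card_insert_if)
    finally show ?thesis by simp
  qed
  have c16: "card (g ` {..<16::nat}) \<le> 16" for g :: "nat \<Rightarrow> nat"
    using card_image_le[of "{..<16}" g] by simp
  have sub: "atypical \<subseteq> ?B"
  proof (rule subsetI, rule ccontr)
    fix u assume "u \<in> atypical" and nB: "u \<notin> ?B"
    then have uV: "u \<in> V" and at: "real q / 32 + 1 < \<bar>real (deg u) - typical_deg (cls u)\<bar>"
      by (auto simp: atypical_def)
    obtain h w where u: "u = h * q + w" "w < q" by (metis div_mult_mod_eq mod_less_divisor q_pos)
    then have h: "h < 16" using block_less_16[OF uV] by simp
    have cls: "cls u = (if h \<in> {1, 2, 3} then h else 0)" using u by (simp add: cls_def)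
    have X: "\<bar>2 * real (last_deg h w) - (\<rho> + 1)\<bar> \<le> real q / 16" if "h \<in> {1, 2, 3}"
      using nB u that by auto
    define X where "X = real m * r"
    have m1: "real ((m - 1) * r) = (real m - 1) * r" using m_bounds by (simp add: of_nat_diff)
    consider "h = 1" | "h = 2" | "h = 3" | "h \<notin> {1, 2, 3}" by auto
    then show False
    proof cases
      case 1
      then have w: "w \<noteq> 0" using nB u by auto
      have "1 * 1 \<le> (m + 1) * r" by (rule mult_le_mono) (simp_all add: r_def)
      then have "real (deg u) = real ((m + 1) * r) + last_deg 1 w - 1"
        using deg_1[of w] u 1 w by (simp add: of_nat_diff)
      then have "real (deg u) = X + r + last_deg 1 w - 1" by (simp add: X_def algebra_simps)
      moreover have "typical_deg (cls u) = X + r + (\<rho> + 1) / 2"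
        using cls 1 by (simp add: typical_deg_def X_def algebra_simps)
      moreover have "\<bar>2 * real (last_deg 1 w) - real (\<rho> + 1)\<bar> \<le> real q / 16" using X 1 by simp
      ultimately show False using at by argo
    next
      case 2
      then have w: "w \<noteq> 0" "w \<noteq> r" using nB u by auto
      then have "deg u \<le> m * r + last_deg 2 w" "m * r + last_deg 2 w \<le> deg u + 1"
        using deg_2[of w] u 2 by auto
      then have "real (deg u) \<le> real (m * r + last_deg 2 w)" "real (m * r + last_deg 2 w) \<le> real (deg u + 1)"
        by (simp_all only: of_nat_le_iff)
      then have "real (deg u) \<le> X + last_deg 2 w" "X + last_deg 2 w \<le> real (deg u) + 1"
        by (simp_all add: X_def)
      moreover have "typical_deg (cls u) = X + (\<rho> + 1) / 2"
        using cls 2 by (simp add: typical_deg_def X_def)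
      moreover have "\<bar>2 * real (last_deg 2 w) - real (\<rho> + 1)\<bar> \<le> real q / 16" using X 2 by simp
      ultimately show False using at by argo
    next
      case 3
      then have w: "w \<noteq> 0" "w \<noteq> 1" using nB u by auto
      then have "real (deg u) = (real m - 1) * r + last_deg 3 w"
        using deg_3[of w] u 3 m1 by simp
      then have "real (deg u) = X - r + last_deg 3 w"
        by (simp add: X_def algebra_simps)
      moreover have "typical_deg (cls u) = X - r + (\<rho> + 1) / 2"
        using cls 3 by (simp add: typical_deg_def X_def algebra_simps)
      moreover have "\<bar>2 * real (last_deg 3 w) - real (\<rho> + 1)\<bar> \<le> real q / 16" using X 3 by simp
      ultimately show False using at by argo
    next
      case 4
      have "w \<noteq> 0" "w \<noteq> h" "w \<noteq> h div 2" using nB u h by auto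
      then have "deg u = 3 * r"
        using deg_rest[OF 4 u(2)] u h q_ge
        by (simp add: card_ip_r card_ip_xor_eq)
      then show False using at cls 4 by (simp add: typical_deg_def)
    qed
  qed
  have "card atypical \<le> card ?B" by (rule card_mono[OF _ sub]) (use finX in auto)
  also have "\<dots> \<le> 258 + 258 + 258 + 16 + 16 + 16"
    by (intro order_trans[OF card_Un_le] add_mono) (rule cX c16)+
  finally show ?thesis by simp
qed

text \<open>Typical degrees of different classes are at least \<open>r = q / 2\<close> apart, since
  blocks 1, 2, 3 have at least \<open>7 * r\<close> and differ by multiples of \<open>r\<close>, and
  the rest has \<open>3 * r\<close>. Two deviations of \<open>q / 32 + 1\<close> and a difference
  below \<open>q / 4\<close> do not bridge this.\<close>

lemma cls_eqI:
  assumes "u \<in> V - atypical" "v \<in> V - atypical" "\<bar>real (deg u) - real (deg v)\<bar> < q / 4"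
  shows "cls u = cls v"
proof (rule ccontr)
  assume neq: "cls u \<noteq> cls v"
  have sep: "real q / 2 \<le> \<bar>typical_deg c - typical_deg c'\<bar>" if "c < c'" "c' \<in> {1, 2, 3}" for c c'
  proof -
    have rq: "real q = 2 * r" by (simp add: q_eq)
    have "8 * real r \<le> real m * r" using m_bounds by (intro mult_right_mono) simp_all
    then have "8 * real r \<le> real m * r + (real \<rho> + 1) / 2"
      by (rule order_trans) simp
    moreover have "c \<in> {0, 1, 2}" using that by auto
    ultimately show ?thesis
      using that by (auto simp: typical_deg_def rq algebra_simps abs_if)
  qed
  have cls: "cls u \<in> {0, 1, 2, 3}" "cls v \<in> {0, 1, 2, 3}" by (auto simp: cls_def)
  have "real q / 2 \<le> \<bar>typical_deg (cls u) - typical_deg (cls v)\<bar>"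
  proof (cases "cls u < cls v")
    case True
    then show ?thesis using sep[of "cls u" "cls v"] cls by auto
  next
    case False
    then have "cls v < cls u" using neq by simp
    then show ?thesis using sep[of "cls v" "cls u"] cls by (auto simp: abs_minus_commute)
  qed
  moreover have "\<bar>real (deg u) - typical_deg (cls u)\<bar> \<le> real q / 32 + 1"
    "\<bar>real (deg v) - typical_deg (cls v)\<bar> \<le> real q / 32 + 1"
    using assms by (auto simp: atypical_def)
  moreover have "1024 \<le> real q" using q_ge by simp
  ultimately show False using assms(3) by linarith
qed

end

section \<open>Rigidity of almost inner product preserving maps\<close>

definition pairs :: "nat \<Rightarrow> (nat \<Rightarrow> nat \<Rightarrow> bool) \<Rightarrow> (nat \<times> nat) set" where
  "pairs q f = {(x, y). x < q \<and> y < q \<and> f x y}"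

lemma finite_pairs [simp]: "finite (pairs q f)"
  by (rule finite_subset[of _ "{..<q} \<times> {..<q}"]) (auto simp: pairs_def)

lemma card_times_le: "card {(x::nat, y::nat). P x \<and> x < q \<and> y < q} \<le> card {x. x < q \<and> P x} * q"
proof -
  have "{(x, y). P x \<and> x < q \<and> y < q} = {x. x < q \<and> P x} \<times> {..<q}" by auto
  then show ?thesis by simp
qed

lemma card_times_le': "card {(x::nat, y::nat). P y \<and> x < q \<and> y < q} \<le> q * card {y. y < q \<and> P y}"
proof -
  have "{(x, y). P y \<and> x < q \<and> y < q} = {..<q} \<times> {y. y < q \<and> P y}" by auto
  then show ?thesis by simp
qed

lemma card_pairs_swap: "card (pairs q (\<lambda>x y. f y x)) = card (pairs q f)"
  by (rule bij_betw_same_card[where f = prod.swap],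
      rule bij_betw_byWitness[where f' = prod.swap]) (auto simp: pairs_def)

text \<open>Markov's inequality without division: if the errors have density \<open>1 / N\<close>,
  the rows with error density above 1/32 have density at most \<open>32 / N\<close>.\<close>

lemma card_heavy_rows:
  assumes "N * card (pairs q f) \<le> q * q"
  shows "N * card {x. x < q \<and> q < 32 * card {y. y < q \<and> f x y}} \<le> 32 * q"
proof (cases "q = 0")
  case False
  let ?B = "{x. x < q \<and> q < 32 * card {y. y < q \<and> f x y}}"
  have "pairs q f = Sigma {..<q} (\<lambda>x. {y. y < q \<and> f x y})" by (auto simp: pairs_def)
  then have sum: "card (pairs q f) = (\<Sum>x<q. card {y. y < q \<and> f x y})" by simp
  have "q * card ?B = (\<Sum>x\<in>?B. q)" by simp
  also have "\<dots> \<le> (\<Sum>x\<in>?B. 32 * card {y. y < q \<and> f x y})" by (rule sum_mono) auto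
  also have "\<dots> \<le> (\<Sum>x<q. 32 * card {y. y < q \<and> f x y})" by (rule sum_mono2) auto
  also have "\<dots> = 32 * card (pairs q f)" 
    unfolding sum by (rule sum_distrib_left[symmetric])
  finally have "N * (q * card ?B) \<le> N * (32 * card (pairs q f))" by (rule mult_le_mono2)
  then have "q * (N * card ?B) \<le> 32 * (N * card (pairs q f))"
    by (simp only: mult.left_commute)
  also have "\<dots> \<le> q * (32 * q)" using assms by simp
  finally show ?thesis using False by simp
qed simp

text \<open>The maps \<open>\<sigma>\<close>, \<open>\<pi>\<close>, \<open>\<tau>\<close> will be
  those induced on the blocks 2, 1, 3, and the four error bounds belong to the block pairs (2, 2),
  (1, 2), (1, 3), (2, 3). The error density is \<open>1 / N\<close>.\<close>

locale almost_orthogonal =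
  fixes k N :: nat and \<sigma> \<pi> \<tau> :: "nat \<Rightarrow> nat"
  assumes k_pos: "1 \<le> k" and N: "1024 \<le> N"
    and \<sigma>: "bij_betw \<sigma> {..<2 ^ k} {..<2 ^ k}"
    and \<pi>: "\<And>x. x < 2 ^ k \<Longrightarrow> \<pi> x < 2 ^ k"
    and \<tau>: "\<And>x. x < 2 ^ k \<Longrightarrow> \<tau> x < 2 ^ k"
    and \<sigma>\<sigma>: "N * card (pairs (2 ^ k) (\<lambda>x y. ip x y \<noteq> ip (\<sigma> x) (\<sigma> y))) \<le> 2 ^ k * 2 ^ k"
    and \<pi>\<sigma>: "N * card (pairs (2 ^ k) (\<lambda>x y. ip x y \<noteq> ip (\<pi> x) (\<sigma> y))) \<le> 2 ^ k * 2 ^ k"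
    and \<pi>\<tau>: "N * card (pairs (2 ^ k) (\<lambda>x y. ip x y \<noteq> ip (\<pi> x) (\<tau> y))) \<le> 2 ^ k * 2 ^ k"
    and \<sigma>\<tau>: "N * card (pairs (2 ^ k) (\<lambda>x y. ip x (y div 2) \<noteq> ip (\<sigma> x) (\<tau> y div 2))) \<le> 2 ^ k * 2 ^ k"
begin

definition q :: nat where "q = 2 ^ k"

lemma q_pos: "0 < q" by (simp add: q_def)

lemma \<sigma>_less: "x < q \<Longrightarrow> \<sigma> x < q"
  using \<sigma> by (auto simp: bij_betw_def q_def)

text \<open>The gap principle: distinct functionals differ on exactly half of the space, and the
  bijection \<open>g\<close> preserves this count.\<close>

lemma card_neq_bij:
  assumes "bij_betw g {..<q} {..<q}" "a < q" "b < q" "2 * card {y. y < q \<and> ip a (g y) \<noteq> ip b (g y)} < q"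
  shows "a = b"
proof (rule ccontr)
  assume "a \<noteq> b"
  have "bij_betw g {y. y < q \<and> ip a (g y) \<noteq> ip b (g y)} {y. y < q \<and> ip a y \<noteq> ip b y}"
    by (rule bij_betw_subset[OF assms(1)]) (use assms(1) in \<open>auto simp: bij_betw_def\<close>)
  then have "card {y. y < q \<and> ip a (g y) \<noteq> ip b (g y)} = card {y. y < q \<and> ip a y \<noteq> ip b y}"
    by (rule bij_betw_same_card)
  then show False using card_ip_neq[of a k b] assms \<open>a \<noteq> b\<close> by (simp add: q_def)
qed

section \<open>Self-correction of \<open>\<sigma>\<close> to a linear map \<open>T\<close>\<close>

definition heavy :: "nat set" where
  "heavy = {x. x < q \<and> q < 32 * card {y. y < q \<and> ip x y \<noteq> ip (\<sigma> x) (\<sigma> y)}}"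

lemma card_heavy: "N * card heavy \<le> 32 * q"
  unfolding heavy_def using card_heavy_rows[OF \<sigma>\<sigma>] by (simp add: q_def)

lemma thirtysecond: "N * c \<le> 32 * q \<Longrightarrow> 32 * c \<le> q"
proof -
  assume "N * c \<le> 32 * q"
  moreover have "1024 * c \<le> N * c" using N by simp
  ultimately show ?thesis by linarith
qed

text \<open>The functional of \<open>x\<close>, read through \<open>\<sigma>\<close>, is almost that
  of \<open>a\<close>. The error 1/16 is twice the 1/32 allowed for rows that are not heavy.\<close>

definition represents :: "nat \<Rightarrow> nat \<Rightarrow> bool" where
  "represents a x \<longleftrightarrow> a < q \<and> 16 * card {y. y < q \<and> ip x y \<noteq> ip a (\<sigma> y)} \<le> q"

text \<open>As in linearity testing, \<open>x\<close> is split as \<open>a XOR b\<close> with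
  neither part heavy; \<open>\<sigma> a XOR \<sigma> b\<close> then represents \<open>x\<close>.
  Such a splitting exists because the heavy vectors and their translate by \<open>x\<close> cover at
  most 1/16 of the space.\<close>

lemma ex_represents: "x < q \<Longrightarrow> \<exists>a. represents a x"
proof -
  assume x: "x < q"
  have xor: "y XOR x < q" if "y < q" for y
    using that x xor_less_two_power by (simp add: q_def)
  have inj: "inj_on (\<lambda>y. y XOR x) heavy"
    by (auto simp: inj_on_def) (metis xor.assoc xor.right_neutral xor_self_eq)
  have "card (heavy \<union> (\<lambda>y. y XOR x) ` heavy) \<le> card heavy + card heavy"
    using card_Un_le card_image[OF inj] by metis
  also have "\<dots> < card {..<q}" using thirtysecond[OF card_heavy] q_pos by simp
  finally have less: "card (heavy \<union> (\<lambda>y. y XOR x) ` heavy) < card {..<q}" .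
  have "finite heavy" by (simp add: heavy_def)
  then have "\<not> {..<q} \<subseteq> heavy \<union> (\<lambda>y. y XOR x) ` heavy"
    using less card_mono[of "heavy \<union> (\<lambda>y. y XOR x) ` heavy" "{..<q}"] by (meson finite_UnI finite_imageI not_le)
  then obtain a where a: "a < q" "a \<notin> heavy" "a \<notin> (\<lambda>y. y XOR x) ` heavy" by auto
  define b where "b = a XOR x"
  have x_eq: "x = a XOR b" unfolding b_def by (metis xor.assoc xor_self_eq xor.left_neutral)
  have "a = b XOR x" unfolding b_def by (metis xor.assoc xor.right_neutral xor_self_eq)
  then have b: "b < q" "b \<notin> heavy" using a xor[of a] b_def by auto
  let ?E = "\<lambda>c. {y. y < q \<and> ip c y \<noteq> ip (\<sigma> c) (\<sigma> y)}"
  have "card {y. y < q \<and> ip x y \<noteq> ip (\<sigma> a XOR \<sigma> b) (\<sigma> y)} \<le> card (?E a \<union> ?E b)"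
    unfolding x_eq by (rule card_mono) (auto simp: ip_xor_left)
  also have "\<dots> \<le> card (?E a) + card (?E b)" by (rule card_Un_le)
  finally have "16 * card {y. y < q \<and> ip x y \<noteq> ip (\<sigma> a XOR \<sigma> b) (\<sigma> y)} \<le> q"
    using a b by (simp add: heavy_def)
  moreover have "\<sigma> a XOR \<sigma> b < q"
    using \<sigma>_less a b xor_less_two_power by (simp add: q_def)
  ultimately show ?thesis unfolding represents_def by blast
qed

text \<open>Any choice will do: additivity and agreement with \<open>\<sigma>\<close> follow from
  representation by the gap principle.\<close>

definition T :: "nat \<Rightarrow> nat" where "T x = (SOME a. represents a x)"

lemma T_represents: "x < q \<Longrightarrow> represents (T x) x"
  unfolding T_def using ex_represents by (rule someI_ex)

lemma T_less: "x < q \<Longrightarrow> T x < q"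
  using T_represents by (simp add: represents_def)

lemma xor_less: "x < q \<Longrightarrow> y < q \<Longrightarrow> x XOR y < q"
  using xor_less_two_power by (simp add: q_def)

lemma card_sub3:
  assumes "A \<subseteq> B \<union> C \<union> D" "finite B" "finite C" "finite D"
  shows "card A \<le> card B + card C + card D"
proof -
  have "card A \<le> card (B \<union> C \<union> D)" using assms by (intro card_mono) auto
  also have "\<dots> \<le> card (B \<union> C) + card D" by (rule card_Un_le)
  also have "\<dots> \<le> card B + card C + card D" using card_Un_le by simp
  finally show ?thesis .
qed

text \<open>The functionals of both sides agree at \<open>\<sigma> y\<close> up to three errors of
  density 1/16, less than the gap 1/2.\<close>

lemma T_xor:
  assumes "x < q" "x' < q"
  shows "T (x XOR x') = T x XOR T x'"
proof (rule card_neq_bij)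
  show "bij_betw \<sigma> {..<q} {..<q}" using \<sigma> by (simp add: q_def)
  show "T (x XOR x') < q" "T x XOR T x' < q" using assms T_less xor_less by auto
  let ?E = "\<lambda>c. {y. y < q \<and> ip c y \<noteq> ip (T c) (\<sigma> y)}"
  have "card {y. y < q \<and> ip (T (x XOR x')) (\<sigma> y) \<noteq> ip (T x XOR T x') (\<sigma> y)} \<le>
      card (?E (x XOR x')) + card (?E x) + card (?E x')"
    by (rule card_sub3) (auto simp: ip_xor_left)
  moreover have "16 * card (?E c) \<le> q" if "c < q" for c
    using T_represents[OF that] by (simp add: represents_def)
  then have "16 * card (?E (x XOR x')) \<le> q" "16 * card (?E x) \<le> q" "16 * card (?E x') \<le> q"
    using assms xor_less by auto
  ultimately show "2 * card {y. y < q \<and> ip (T (x XOR x')) (\<sigma> y) \<noteq> ip (T x XOR T x') (\<sigma> y)} < q"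
    using q_pos by linarith
qed

lemma \<sigma>_eq_T: "x < q \<Longrightarrow> x \<notin> heavy \<Longrightarrow> \<sigma> x = T x"
proof (rule card_neq_bij)
  assume x: "x < q" "x \<notin> heavy"
  show "bij_betw \<sigma> {..<q} {..<q}" using \<sigma> by (simp add: q_def)
  show "T x < q" "\<sigma> x < q" using x T_less \<sigma>_less by auto
  have "card {y. y < q \<and> ip (\<sigma> x) (\<sigma> y) \<noteq> ip (T x) (\<sigma> y)} \<le>
      card {y. y < q \<and> ip x y \<noteq> ip (\<sigma> x) (\<sigma> y)} + card {y. y < q \<and> ip x y \<noteq> ip (T x) (\<sigma> y)} + card ({}::nat set)"
    by (rule card_sub3) auto
  moreover have "16 * card {y. y < q \<and> ip x y \<noteq> ip (T x) (\<sigma> y)} \<le> q"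
    using T_represents[OF x(1)] by (simp add: represents_def)
  moreover have "32 * card {y. y < q \<and> ip x y \<noteq> ip (\<sigma> x) (\<sigma> y)} \<le> q"
    using x by (auto simp: heavy_def)
  ultimately show "2 * card {y. y < q \<and> ip (\<sigma> x) (\<sigma> y) \<noteq> ip (T x) (\<sigma> y)} < q"
    using q_pos by (simp only: card.empty)
qed

text \<open>A nonzero bilinear form would hold on a quarter of all pairs, but the three sources of
  error have total density at most \<open>(1 + 32 + 32) / N\<close>, and
  \<open>4 * 65 = 260 < 1024\<close>.\<close>

lemma bilinear_vanishes:
  assumes add1: "\<And>x x' y. x < q \<Longrightarrow> x' < q \<Longrightarrow> y < q \<Longrightarrow> f (x XOR x') y \<longleftrightarrow> f x y \<noteq> f x' y"
    and add2: "\<And>x y y'. x < q \<Longrightarrow> y < q \<Longrightarrow> y' < q \<Longrightarrow> f x (y XOR y') \<longleftrightarrow> f x y \<noteq> f x y'"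
    and sub: "\<And>x y. x < q \<Longrightarrow> y < q \<Longrightarrow> f x y \<Longrightarrow> g x y \<or> x \<in> B \<or> y \<in> C"
    and g: "N * card (pairs q g) \<le> q * q" and B: "N * card {x. x < q \<and> x \<in> B} \<le> 32 * q"
    and C: "N * card {x. x < q \<and> x \<in> C} \<le> 32 * q"
    and xy: "x < q" "y < q"
  shows "\<not> f x y"
proof
  assume "f x y"
  with card_bilinear_ge[of k f x y] add1 add2 xy
  have "q * q \<le> 4 * card (pairs q f)" by (simp add: q_def pairs_def)
  also have "card (pairs q f) \<le> card (pairs q g) + card {(x, y). x \<in> B \<and> x < q \<and> y < q} +
      card {(x, y). y \<in> C \<and> x < q \<and> y < q}"
    by (rule card_sub3)
      (use sub in \<open>auto simp: pairs_def intro: finite_subset[of _ "{..<q} \<times> {..<q}"]\<close>)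
  also have "\<dots> \<le> card (pairs q g) + card {x. x < q \<and> x \<in> B} * q + q * card {x. x < q \<and> x \<in> C}"
    using card_times_le[of "\<lambda>x. x \<in> B" q] card_times_le'[of "\<lambda>x. x \<in> C" q] by simp
  finally have "q * q \<le> 4 * (card (pairs q g) + card {x. x < q \<and> x \<in> B} * q + q * card {x. x < q \<and> x \<in> C})"
    by simp
  then have "N * (q * q) \<le> N * (4 * (card (pairs q g) + card {x. x < q \<and> x \<in> B} * q + q * card {x. x < q \<and> x \<in> C}))"
    by (rule mult_le_mono2)
  also have "\<dots> = 4 * (N * card (pairs q g)) + 4 * (N * card {x. x < q \<and> x \<in> B}) * q + 4 * (N * card {x. x < q \<and> x \<in> C}) * q"
    by (simp add: algebra_simps)
  also have "\<dots> \<le> 4 * (q * q) + 4 * (32 * q) * q + 4 * (32 * q) * q"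
    by (intro add_mono mult_le_mono1 mult_le_mono2 g B C)
  finally have "N * (q * q) \<le> 260 * (q * q)" by simp
  then show False using N q_pos by simp
qed

lemma T_orthogonal: "x < q \<Longrightarrow> y < q \<Longrightarrow> ip (T x) (T y) = ip x y"
proof -
  assume xy: "x < q" "y < q"
  have heavy: "{x. x < q \<and> x \<in> heavy} = heavy" by (auto simp: heavy_def)
  have "\<not> (ip (T x) (T y) \<noteq> ip x y)"
  proof (rule bilinear_vanishes[where f = "\<lambda>x y. ip (T x) (T y) \<noteq> ip x y" and x = x and y = y and g = "\<lambda>x y. ip x y \<noteq> ip (\<sigma> x) (\<sigma> y)" and B = heavy and C = heavy])
    show "N * card (pairs q (\<lambda>x y. ip x y \<noteq> ip (\<sigma> x) (\<sigma> y))) \<le> q * q" using \<sigma>\<sigma> by (simp add: q_def)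
  next
    fix x y assume "x < q" "y < q" "ip (T x) (T y) \<noteq> ip x y"
    then show "(ip x y \<noteq> ip (\<sigma> x) (\<sigma> y)) \<or> x \<in> heavy \<or> y \<in> heavy"
      using \<sigma>_eq_T[of x] \<sigma>_eq_T[of y] by metis
  next
    fix x x' y assume "x < q" "x' < q" "y < q"
    then show "(ip (T (x XOR x')) (T y) \<noteq> ip (x XOR x') y) \<longleftrightarrow>
        (ip (T x) (T y) \<noteq> ip x y) \<noteq> (ip (T x') (T y) \<noteq> ip x' y)"
      unfolding T_xor[OF \<open>x < q\<close> \<open>x' < q\<close>] ip_xor_left by argo
  next
    fix x y y' assume "x < q" "y < q" "y' < q"
    then show "(ip (T x) (T (y XOR y')) \<noteq> ip x (y XOR y')) \<longleftrightarrow>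
        (ip (T x) (T y) \<noteq> ip x y) \<noteq> (ip (T x) (T y') \<noteq> ip x y')"
      unfolding T_xor[OF \<open>y < q\<close> \<open>y' < q\<close>] ip_xor_right by argo
  next
    show "N * card {x. x < q \<and> x \<in> heavy} \<le> 32 * q" "N * card {x. x < q \<and> x \<in> heavy} \<le> 32 * q"
      unfolding heavy by (rule card_heavy)+
    show "x < q" "y < q" using xy .
  qed
  then show ?thesis by simp
qed

lemma T_bij: "bij_betw T {..<q} {..<q}"
proof -
  have "inj_on T {..<q}"
  proof (rule inj_onI)
    fix x y assume xy: "x \<in> {..<q}" "y \<in> {..<q}" "T x = T y"
    have "ip x z = ip y z" if "z < q" for z
      using T_orthogonal[of x z] T_orthogonal[of y z] xy that by simp
    then show "x = y"
      using ip_eqI[of k x y] xy by (simp add: q_def)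
  qed
  moreover have "T ` {..<q} \<subseteq> {..<q}" using T_less by auto
  ultimately show ?thesis by (simp add: bij_betw_def endo_inj_surj)
qed

text \<open>Agreement with \<open>T\<close> passes from \<open>h\<close> to \<open>g\<close> through
  the form between them: on a row that is not heavy, the functionals of \<open>g x\<close> and
  \<open>T x\<close> agree at \<open>T y\<close> up to two errors of density 1/32, so they are
  equal.\<close>

lemma eq_T_almost:
  assumes g: "N * card (pairs q (\<lambda>x y. ip x y \<noteq> ip (g x) (h y))) \<le> q * q"
    and h: "N * card {y. y < q \<and> h y \<noteq> T y} \<le> 32 * q"
    and g_less: "\<And>x. x < q \<Longrightarrow> g x < q"
  shows "N * card {x. x < q \<and> g x \<noteq> T x} \<le> 32 * q"
proof -
  let ?R = "\<lambda>x. {y. y < q \<and> ip x y \<noteq> ip (g x) (h y)}"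
  have "x \<in> {x. x < q \<and> q < 32 * card (?R x)}" if x: "x < q" "g x \<noteq> T x" for x
  proof (rule ccontr)
    assume "x \<notin> {x. x < q \<and> q < 32 * card (?R x)}"
    then have R: "32 * card (?R x) \<le> q" using x by auto
    have "g x = T x"
    proof (rule card_neq_bij[OF T_bij])
      have "card {y. y < q \<and> ip (g x) (T y) \<noteq> ip (T x) (T y)} \<le>
          card (?R x) + card {y. y < q \<and> h y \<noteq> T y} + card ({}::nat set)"
        by (rule card_sub3) (use x T_orthogonal in auto)
      then show "2 * card {y. y < q \<and> ip (g x) (T y) \<noteq> ip (T x) (T y)} < q"
        using R thirtysecond[OF h] q_pos by (simp only: card.empty)
    qed (use x g_less T_less in auto)
    then show False using x by simp
  qed
  then have "card {x. x < q \<and> g x \<noteq> T x} \<le> card {x. x < q \<and> q < 32 * card (?R x)}"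
    by (intro card_mono) auto
  then have "N * card {x. x < q \<and> g x \<noteq> T x} \<le> N * card {x. x < q \<and> q < 32 * card (?R x)}"
    by (rule mult_le_mono2)
  also have "\<dots> \<le> 32 * q" by (rule card_heavy_rows[OF g])
  finally show ?thesis .
qed

lemma \<sigma>_T: "N * card {y. y < q \<and> \<sigma> y \<noteq> T y} \<le> 32 * q"
proof -
  have "card {y. y < q \<and> \<sigma> y \<noteq> T y} \<le> card heavy"
    by (rule card_mono) (use \<sigma>_eq_T in \<open>auto simp: heavy_def\<close>)
  then show ?thesis using card_heavy by (meson mult_le_mono2 order_trans)
qed

lemma \<pi>_T: "N * card {y. y < q \<and> \<pi> y \<noteq> T y} \<le> 32 * q"
  by (rule eq_T_almost[OF _ \<sigma>_T]) (use \<pi>\<sigma> \<pi> in \<open>simp_all add: q_def\<close>)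

text \<open>The comparison goes through \<open>\<pi>\<close>, not \<open>\<sigma>\<close>: the form
  between blocks 1 and 3 is nondegenerate, while the one between blocks 2 and 3 involves the
  singular shift.\<close>

lemma \<tau>_T: "N * card {y. y < q \<and> \<tau> y \<noteq> T y} \<le> 32 * q"
proof (rule eq_T_almost[OF _ \<pi>_T])
  have "pairs q (\<lambda>x y. ip x y \<noteq> ip (\<tau> x) (\<pi> y)) = pairs q (\<lambda>x y. ip y x \<noteq> ip (\<pi> y) (\<tau> x))"
    by (auto simp: pairs_def ip_commute)
  then show "N * card (pairs q (\<lambda>x y. ip x y \<noteq> ip (\<tau> x) (\<pi> y))) \<le> q * q"
    using \<pi>\<tau> card_pairs_swap[of q "\<lambda>x y. ip x y \<noteq> ip (\<pi> x) (\<tau> y)"] by (simp add: q_def)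
qed (use \<tau> in \<open>simp_all add: q_def\<close>)

text \<open>By the gap for bilinear forms, \<open>ip (T y) (T z div 2)\<close> equals
  \<open>ip y (z div 2)\<close>, which by orthogonality is \<open>ip (T y) (T (z div 2))\<close>. As
  \<open>T\<close> is onto, nondegeneracy applies.\<close>

lemma T_div_2:
  assumes "z < q"
  shows "T z div 2 = T (z div 2)"
proof (rule ip_eqI[of k])
  have less: "z div 2 < q" if "z < q" for z using that by simp
  have ip: "ip (T y) (T z div 2) = ip y (z div 2)" if "y < q" "z < q" for y z
  proof -
    have "\<not> (ip (T y) (T z div 2) \<noteq> ip y (z div 2))"
    proof (rule bilinear_vanishes[where f = "\<lambda>y z. ip (T y) (T z div 2) \<noteq> ip y (z div 2)" and x = y and y = z and g = "\<lambda>x y. ip x (y div 2) \<noteq> ip (\<sigma> x) (\<tau> y div 2)"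
          and B = "{x. \<sigma> x \<noteq> T x}" and C = "{x. \<tau> x \<noteq> T x}"])
      show "N * card (pairs q (\<lambda>x y. ip x (y div 2) \<noteq> ip (\<sigma> x) (\<tau> y div 2))) \<le> q * q"
        using \<sigma>\<tau> by (simp add: q_def)
    next
      fix x y assume "x < q" "y < q" "ip (T x) (T y div 2) \<noteq> ip x (y div 2)"
      then show "(ip x (y div 2) \<noteq> ip (\<sigma> x) (\<tau> y div 2)) \<or> x \<in> {x. \<sigma> x \<noteq> T x} \<or> y \<in> {x. \<tau> x \<noteq> T x}"
        by auto
    next
      fix x x' y assume "x < q" "x' < q" "y < q"
      then show "(ip (T (x XOR x')) (T y div 2) \<noteq> ip (x XOR x') (y div 2)) \<longleftrightarrow>
          (ip (T x) (T y div 2) \<noteq> ip x (y div 2)) \<noteq> (ip (T x') (T y div 2) \<noteq> ip x' (y div 2))"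
        unfolding T_xor[OF \<open>x < q\<close> \<open>x' < q\<close>] ip_xor_left by argo
    next
      fix x y y' assume "x < q" "y < q" "y' < q"
      then show "(ip (T x) (T (y XOR y') div 2) \<noteq> ip x ((y XOR y') div 2)) \<longleftrightarrow>
          (ip (T x) (T y div 2) \<noteq> ip x (y div 2)) \<noteq> (ip (T x) (T y' div 2) \<noteq> ip x (y' div 2))"
        unfolding T_xor[OF \<open>y < q\<close> \<open>y' < q\<close>] ip_xor_right xor_div_2 by argo
    next
      show "N * card {x. x < q \<and> x \<in> {x. \<sigma> x \<noteq> T x}} \<le> 32 * q" using \<sigma>_T by simp
      show "N * card {x. x < q \<and> x \<in> {x. \<tau> x \<noteq> T x}} \<le> 32 * q" using \<tau>_T by simp
      show "y < q" "z < q" using that .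
    qed
    then show ?thesis by simp
  qed
  fix y :: nat assume "y < 2 ^ k"
  then have "y \<in> T ` {..<q}" using T_bij by (simp add: bij_betw_def q_def)
  then obtain x where x: "x < q" "y = T x" by auto
  have "ip y (T z div 2) = ip x (z div 2)" using ip x assms by simp
  also have "\<dots> = ip y (T (z div 2))" using T_orthogonal x assms less by simp
  finally show "ip (T z div 2) y = ip (T (z div 2)) y" by (simp add: ip_commute)
qed (use assms T_less[of z] T_less[of "z div 2"] in \<open>simp_all add: q_def\<close>)

text \<open>\<open>T\<close> maps the kernel {0, 1} of \<open>div 2\<close> to itself, so
  \<open>T 1 = 1\<close>. Then \<open>T\<close> preserves the lowest bit, which is the pairing with
  1, and the other bits follow by induction through \<open>T_div_2\<close>.\<close>

lemma T_id: "z < q \<Longrightarrow> T z = z"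
proof (induction z rule: less_induct)
  case (less z)
  have "1 < q" using k_pos unfolding q_def by (intro one_less_power) auto
  have T0: "T 0 = 0" using T_xor[of 0 0] q_pos by simp
  have "T 1 \<noteq> T 0"
    using inj_on_eq_iff[OF bij_betw_imp_inj_on[OF T_bij], of 1 0] \<open>1 < q\<close> by simp
  moreover have "T 1 div 2 = 0" using T_div_2[of 1] \<open>1 < q\<close> T0 by simp
  ultimately have T1: "T 1 = 1" using T0 by linarith
  have "odd (T z) \<longleftrightarrow> ip (T z) (T 1)" by (simp only: T1) (simp add: ip_1)
  also have "\<dots> \<longleftrightarrow> odd z" using T_orthogonal less.prems \<open>1 < q\<close> by (simp add: ip_1)
  finally have odd: "odd (T z) \<longleftrightarrow> odd z" .
  show ?case
  proof (cases "z = 0")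
    case False
    then have "T z div 2 = z div 2" using T_div_2 less by simp
    then show ?thesis using odd by (metis dvd_mult_div_cancel odd_two_times_div_two_succ)
  qed (simp add: T0)
qed

lemma almost_identity:
  "32 * card {y. y < q \<and> \<sigma> y \<noteq> y} \<le> q" "32 * card {y. y < q \<and> \<pi> y \<noteq> y} \<le> q"
  "32 * card {y. y < q \<and> \<tau> y \<noteq> y} \<le> q"
proof -
  have "{y. y < q \<and> g y \<noteq> T y} = {y. y < q \<and> g y \<noteq> y}" for g using T_id by auto
  then show "32 * card {y. y < q \<and> \<sigma> y \<noteq> y} \<le> q" "32 * card {y. y < q \<and> \<pi> y \<noteq> y} \<le> q"
    "32 * card {y. y < q \<and> \<tau> y \<noteq> y} \<le> q"
    using thirtysecond \<sigma>_T \<pi>_T \<tau>_T by metis+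
qed

end

section \<open>Robustness\<close>

text \<open>A permutation that keeps most of a block in place acts there as a partial injection;
  \<open>almost_orthogonal\<close> needs a bijection of the whole block.\<close>

lemma inj_on_extends_bij:
  fixes f :: "nat \<Rightarrow> nat"
  assumes "finite X" "Y \<subseteq> X" "inj_on f Y" "f ` Y \<subseteq> X"
  obtains g where "bij_betw g X X" "\<And>y. y \<in> Y \<Longrightarrow> g y = f y"
proof -
  have "card (X - Y) = card (X - f ` Y)"
    using assms by (simp add: card_Diff_subset finite_subset card_image)
  then obtain h where h: "bij_betw h (X - Y) (X - f ` Y)"
    using assms(1) finite_same_card_bij by blast
  have "bij_betw (\<lambda>x. if x \<in> Y then f x else h x) (Y \<union> (X - Y)) (f ` Y \<union> (X - f ` Y))"
    using bij_betw_disjoint_Un[OF inj_on_imp_bij_betw[OF assms(3)] h] by auto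
  moreover have "Y \<union> (X - Y) = X" "f ` Y \<union> (X - f ` Y) = X" using assms by auto
  ultimately show thesis using that[of "\<lambda>x. if x \<in> Y then f x else h x"] by simp
qed

text \<open>
  The number \<open>264192 = 258 \<sqdot> 1024\<close> leaves room for the \<open>258\<close> many error terms that the maps induced by \<open>\<pi>\<close>
  on the blocks inherit from \<open>\<pi>\<close>.
\<close>

definition scale :: nat where "scale = 264192"

locale block_graph_permutation = block_graph_params +
  fixes \<pi> :: "nat \<Rightarrow> nat"
  assumes \<pi>: "\<pi> permutes V" and k_large: "23 \<le> k"
begin

text \<open>Ordered pairs, so every changed edge is counted twice. This is the source of a factor 2
  in the final constant.\<close>

definition disagree :: "(nat \<times> nat) set" where
  "disagree = {(u, v) \<in> V \<times> V. A u v \<noteq> A (\<pi> u) (\<pi> v)}"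

definition row_disagree :: "nat \<Rightarrow> nat set" where
  "row_disagree u = {v \<in> V. A u v \<noteq> A (\<pi> u) (\<pi> v)}"

definition moved :: "nat set" where "moved = {v \<in> V. \<pi> v \<noteq> v}"

lemma \<pi>_in: "v \<in> V \<Longrightarrow> \<pi> v \<in> V" using \<pi> permutes_in_image by metis

lemma finite_disagree [simp]: "finite disagree"
  by (rule finite_subset[of _ "V \<times> V"]) (auto simp: disagree_def)

lemma finite_row [simp]: "finite (row_disagree u)" by (simp add: row_disagree_def)

lemma q_large: "8388608 \<le> q"
proof -
  have "(2::nat) ^ 23 \<le> 2 ^ k" using k_large by (rule power_increasing) simp
  then show ?thesis by (simp add: q_def)
qed

lemma card_disagree: "card disagree = (\<Sum>u\<in>V. card (row_disagree u))"
proof -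
  have "disagree = Sigma V row_disagree" by (auto simp: disagree_def row_disagree_def)
  then show ?thesis by simp
qed

text \<open>The rows of \<open>u\<close> and \<open>\<pi> u\<close> differ on almost
  \<open>r\<close> columns of \<open>S\<close>, and every such column that \<open>\<pi>\<close>
  fixes is a disagreement in row \<open>u\<close>.\<close>

lemma row_disagree_moved:
  assumes "u \<in> moved"
  shows "r \<le> card (row_disagree u) + 2 + card (S \<inter> moved)"
proof -
  have "r \<le> card {s \<in> S. A u s \<noteq> A (\<pi> u) s} + 2"
    using assms \<pi>_in by (intro rows_far) (auto simp: moved_def)
  also have "{s \<in> S. A u s \<noteq> A (\<pi> u) s} \<subseteq> row_disagree u \<union> (S \<inter> moved)"
    by (auto simp: row_disagree_def moved_def S_def)
  then have "card {s \<in> S. A u s \<noteq> A (\<pi> u) s} \<le> card (row_disagree u \<union> (S \<inter> moved))"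
    by (intro card_mono) (auto simp: S_def)
  also have "\<dots> \<le> card (row_disagree u) + card (S \<inter> moved)" by (rule card_Un_le)
  finally show ?thesis by simp
qed

definition bad :: "nat set" where "bad = {u \<in> V. q < 64 * card (row_disagree u)}"

lemma card_bad:
  assumes "scale * card disagree \<le> q * q"
  shows "scale * card bad \<le> 64 * q"
proof -
  have "q * card bad = (\<Sum>u\<in>bad. q)" by simp
  also have "\<dots> \<le> (\<Sum>u\<in>bad. 64 * card (row_disagree u))" by (rule sum_mono) (auto simp: bad_def)
  also have "\<dots> \<le> (\<Sum>u\<in>V. 64 * card (row_disagree u))" by (rule sum_mono2) (auto simp: bad_def)
  also have "\<dots> = 64 * card disagree"
    unfolding card_disagree by (rule sum_distrib_left[symmetric])
  finally have "scale * (q * card bad) \<le> scale * (64 * card disagree)" by (rule mult_le_mono2)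
  then have "q * (scale * card bad) \<le> 64 * (scale * card disagree)"
    by (simp only: mult.left_commute)
  also have "\<dots> \<le> 64 * (q * q)" using assms by (rule mult_le_mono2)
  also have "\<dots> = q * (64 * q)" by simp
  finally show ?thesis using q_pos by (simp only: mult_le_cancel1)
qed

lemma deg_\<pi>:
  assumes "u \<in> V"
  shows "\<bar>real (deg u) - real (deg (\<pi> u))\<bar> \<le> real (card (row_disagree u))"
proof -
  have "bij_betw \<pi> {v \<in> V. A (\<pi> u) (\<pi> v)} {v \<in> V. A (\<pi> u) v}"
    by (rule bij_betw_byWitness[where f' = "inv \<pi>"])
      (use \<pi> \<pi>_in in \<open>auto simp: permutes_inverses permutes_in_image[OF permutes_inv[OF \<pi>]]\<close>)
  then have deg: "deg (\<pi> u) = card {v \<in> V. A (\<pi> u) (\<pi> v)}"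
    unfolding deg_def using bij_betw_same_card by force
  have "card {v \<in> V. A u v} \<le> card ({v \<in> V. A (\<pi> u) (\<pi> v)} \<union> row_disagree u)"
    "card {v \<in> V. A (\<pi> u) (\<pi> v)} \<le> card ({v \<in> V. A u v} \<union> row_disagree u)"
    by (rule card_mono; auto simp: row_disagree_def)+
  moreover have "card ({v \<in> V. A (\<pi> u) (\<pi> v)} \<union> row_disagree u) \<le> card {v \<in> V. A (\<pi> u) (\<pi> v)} + card (row_disagree u)"
    "card ({v \<in> V. A u v} \<union> row_disagree u) \<le> card {v \<in> V. A u v} + card (row_disagree u)"
    by (rule card_Un_le)+
  ultimately have "deg u \<le> deg (\<pi> u) + card (row_disagree u)" "deg (\<pi> u) \<le> deg u + card (row_disagree u)"
    unfolding deg unfolding deg_def by linarith+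
  then show ?thesis by linarith
qed

definition displaced :: "nat set" where
  "displaced = {u \<in> V. cls (\<pi> u) \<noteq> cls u}"

lemma card_displaced:
  assumes "scale * card disagree \<le> q * q"
  shows "scale * card displaced \<le> 128 * q"
proof -
  have fin: "finite atypical" "finite bad" by (simp_all add: atypical_def bad_def)
  have "displaced \<subseteq> bad \<union> atypical \<union> \<pi> -` atypical \<inter> V"
  proof
    fix u assume u: "u \<in> displaced"
    show "u \<in> bad \<union> atypical \<union> \<pi> -` atypical \<inter> V"
    proof (rule ccontr)
      assume "\<not> ?thesis"
      then have *: "u \<in> V - atypical" "\<pi> u \<in> V - atypical" "64 * card (row_disagree u) \<le> q"
        using u \<pi>_in by (auto simp: displaced_def bad_def)
      then have "real (64 * card (row_disagree u)) \<le> real q" by (simp only: of_nat_le_iff)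
      then have "\<bar>real (deg u) - real (deg (\<pi> u))\<bar> < q / 4"
        using deg_\<pi>[of u] q_large * by simp
      then have "cls u = cls (\<pi> u)" by (rule cls_eqI[OF *(1,2)])
      then show False using u by (simp add: displaced_def)
    qed
  qed
  then have "card displaced \<le> card (bad \<union> atypical \<union> \<pi> -` atypical \<inter> V)"
    using fin by (intro card_mono) auto
  also have "\<dots> \<le> card bad + card atypical + card (\<pi> -` atypical \<inter> V)"
    by (intro order_trans[OF card_Un_le] add_mono card_Un_le order_refl)
  also have "card (\<pi> -` atypical \<inter> V) \<le> card atypical"
    by (rule card_inj_on_le[of \<pi>]) (use fin permutes_inj_on[OF \<pi>] in auto)
  finally have "card displaced \<le> card bad + 2000" using card_atypical by simp
  then have "scale * card displaced \<le> scale * card bad + scale * 2000"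
    by (metis mult_le_mono2 distrib_left)
  \<comment> \<open>The atypical vertices and their preimages number at most 2000, and
    \<open>scale * 2000 \<le> 64 * q\<close> is where \<open>23 \<le> k\<close> is needed: it holds
    for \<open>q = 2 ^ 23\<close> but not for \<open>2 ^ 22\<close>.\<close>
  also have "\<dots> \<le> 64 * q + 64 * q"
    using card_bad[OF assms] q_large by (simp add: scale_def)
  finally show ?thesis by simp
qed

section \<open>The maps induced on blocks 1, 2, 3 are almost orthogonal\<close>

definition \<pi>_block :: "nat \<Rightarrow> nat \<Rightarrow> nat" where
  "\<pi>_block j x = \<pi> (j * q + x) mod q"

definition kept :: "nat \<Rightarrow> nat set" where
  "kept j = {x. x < q \<and> \<pi> (j * q + x) div q = j}"

lemma \<pi>_eq_block: "x \<in> kept j \<Longrightarrow> \<pi> (j * q + x) = j * q + \<pi>_block j x"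
  unfolding \<pi>_block_def kept_def by (metis (mono_tags) div_mult_mod_eq mem_Collect_eq)

lemma card_not_kept:
  assumes "scale * card disagree \<le> q * q" "j \<in> {1, 2, 3}"
  shows "scale * card {x. x < q \<and> x \<notin> kept j} \<le> 128 * q"
proof -
  have j: "j \<in> {1..7}" using assms(2) by auto
  have "card {x. x < q \<and> x \<notin> kept j} \<le> card displaced"
  proof (rule card_inj_on_le[of "\<lambda>x. j * q + x"])
    show "(\<lambda>x. j * q + x) ` {x. x < q \<and> x \<notin> kept j} \<subseteq> displaced"
      using assms(2) label_in_V[OF j] by (auto simp: displaced_def kept_def cls_def)
    show "finite displaced" by (simp add: displaced_def)
  qed (auto simp: inj_on_def)
  then show ?thesis using card_displaced[OF assms(1)] by (meson mult_le_mono2 order_trans)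
qed

lemma ex_extension:
  "\<exists>g. bij_betw g {..<q} {..<q} \<and> (\<forall>x\<in>kept j. g x = \<pi>_block j x)"
proof -
  have "inj_on (\<pi>_block j) (kept j)"
  proof (rule inj_onI)
    fix x y assume "x \<in> kept j" "y \<in> kept j" "\<pi>_block j x = \<pi>_block j y"
    then have "\<pi> (j * q + x) = \<pi> (j * q + y)" by (simp add: \<pi>_eq_block)
    then show "x = y" using permutes_inj[OF \<pi>] by (simp add: inj_eq)
  qed
  then obtain g where "bij_betw g {..<q} {..<q}" "\<And>x. x \<in> kept j \<Longrightarrow> g x = \<pi>_block j x"
    by (rule inj_on_extends_bij[of "{..<q}" "kept j", rotated 2]) (auto simp: kept_def \<pi>_block_def)
  then show ?thesis by blast
qed

definition ext :: "nat \<Rightarrow> nat \<Rightarrow> nat" where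
  "ext j = (SOME g. bij_betw g {..<q} {..<q} \<and> (\<forall>x\<in>kept j. g x = \<pi>_block j x))"

lemma ext: "bij_betw (ext j) {..<q} {..<q}" "x \<in> kept j \<Longrightarrow> ext j x = \<pi>_block j x"
  using someI_ex[OF ex_extension[of j]] unfolding ext_def by blast+

lemma ext_less: "x < q \<Longrightarrow> ext j x < q"
  using ext(1) by (auto simp: bij_betw_def)

text \<open>A form can change only at a pair in \<open>disagree\<close>, at a row or column that
  leaves its block, or for equal vectors, where an excluded loop may be responsible. In units of
  \<open>q * q / scale\<close> these cost 1, 128, 128 and 1, hence the 258 in
  \<open>scale = 258 * 1024\<close>.\<close>

lemma card_ext_disagree:
  assumes "scale * card disagree \<le> q * q" "i \<in> {1, 2, 3}" "j \<in> {1, 2, 3}"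
  shows "1024 * card (pairs q (\<lambda>x y. block_adj i x j y \<noteq> block_adj i (ext i x) j (ext j y))) \<le> q * q"
proof -
  let ?F = "pairs q (\<lambda>x y. block_adj i x j y \<noteq> block_adj i (ext i x) j (ext j y))"
  let ?D = "pairs q (\<lambda>x y. (i * q + x, j * q + y) \<in> disagree)"
  let ?X = "{(x, y). x \<notin> kept i \<and> x < q \<and> y < q}"
  let ?Y = "{(x, y). y \<notin> kept j \<and> x < q \<and> y < q}"
  let ?I = "(\<lambda>x. (x, x)) ` {..<q}"
  have fin: "finite ?X" "finite ?Y"
    by (rule finite_subset[of _ "{..<q} \<times> {..<q}"]; auto)+
  have "?F \<subseteq> ?D \<union> ?X \<union> ?Y \<union> ?I"
  proof
    fix z assume z: "z \<in> ?F"
    then obtain x y where xy: "z = (x, y)" "x < q" "y < q"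
      and neq: "block_adj i x j y \<noteq> block_adj i (ext i x) j (ext j y)" by (auto simp: pairs_def)
    show "z \<in> ?D \<union> ?X \<union> ?Y \<union> ?I"
    proof (rule ccontr)
      assume n: "z \<notin> ?D \<union> ?X \<union> ?Y \<union> ?I"
      then have kept: "x \<in> kept i" "y \<in> kept j" and "x \<noteq> y" using xy by auto
      have "i \<in> {1..7}" "j \<in> {1..7}" using assms(2,3) by auto
      then have inV: "i * q + x \<in> V" "j * q + y \<in> V" using label_in_V xy by blast+
      have "i * q + x \<noteq> j * q + y"
      proof
        assume "i * q + x = j * q + y"
        then have "(i * q + x) mod q = (j * q + y) mod q" by simp
        then show False using xy \<open>x \<noteq> y\<close> by simp
      qed
      then have "\<pi> (i * q + x) \<noteq> \<pi> (j * q + y)" using permutes_inj[OF \<pi>] by (simp add: inj_eq)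
      then have ne: "(i, ext i x) \<noteq> (j, ext j y)" using kept ext(2) \<pi>_eq_block by auto
      have "A (i * q + x) (j * q + y) \<noteq> A (\<pi> (i * q + x)) (\<pi> (j * q + y))"
        unfolding \<pi>_eq_block[OF kept(1)] \<pi>_eq_block[OF kept(2)] ext(2)[OF kept(1), symmetric] ext(2)[OF kept(2), symmetric]
        using neq \<open>x \<noteq> y\<close> ne by (subst (1 2) A_label) (use xy ext_less in auto)
      then show False using n xy inV by (auto simp: disagree_def pairs_def)
    qed
  qed
  then have "card ?F \<le> card (?D \<union> ?X \<union> ?Y \<union> ?I)" using fin by (intro card_mono) auto
  also have "\<dots> \<le> card ?D + card ?X + card ?Y + card ?I"
    by (intro order_trans[OF card_Un_le] add_mono card_Un_le order_refl)
  also have "card ?D \<le> card disagree"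
    by (rule card_inj_on_le[of "\<lambda>(x, y). (i * q + x, j * q + y)"]) (auto simp: inj_on_def pairs_def)
  also have "card ?X \<le> card {x. x < q \<and> x \<notin> kept i} * q" by (rule card_times_le)
  also have "card ?Y \<le> q * card {x. x < q \<and> x \<notin> kept j}" by (rule card_times_le')
  also have "card ?I = q" by (simp add: card_image inj_on_def)
  finally have "card ?F \<le> card disagree + card {x. x < q \<and> x \<notin> kept i} * q + q * card {x. x < q \<and> x \<notin> kept j} + q"
    by simp
  then have "scale * card ?F \<le> scale * (card disagree + card {x. x < q \<and> x \<notin> kept i} * q + q * card {x. x < q \<and> x \<notin> kept j} + q)"
    by (rule mult_le_mono2)
  also have "\<dots> = scale * card disagree + scale * card {x. x < q \<and> x \<notin> kept i} * q +
      scale * card {x. x < q \<and> x \<notin> kept j} * q + scale * q"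
    by (simp add: algebra_simps)
  also have "\<dots> \<le> q * q + 128 * q * q + 128 * q * q + q * q"
    using q_large by (intro add_mono mult_le_mono1 card_not_kept assms) (simp add: scale_def)
  also have "\<dots> = 258 * (q * q)" by simp
  finally show ?thesis by (simp add: scale_def)
qed

lemma almost_orthogonal_ext:
  assumes "scale * card disagree \<le> q * q"
  shows "almost_orthogonal k 1024 (ext 2) (ext 1) (ext 3)"
proof
  note d = card_ext_disagree[OF assms]
  show "1 \<le> k" "(1024::nat) \<le> 1024" using k_large by simp_all
  show "bij_betw (ext 2) {..<2 ^ k} {..<2 ^ k}" using ext(1) by (simp add: q_def)
  show "ext 1 x < 2 ^ k" "ext 3 x < 2 ^ k" if "x < 2 ^ k" for x
    using ext_less that by (simp_all add: q_def)
  show "1024 * card (pairs (2 ^ k) (\<lambda>x y. ip x y \<noteq> ip (ext 2 x) (ext 2 y))) \<le> 2 ^ k * 2 ^ k"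
    using d[of 2 2] by (simp add: block_adj_def block_row_def q_def)
  show "1024 * card (pairs (2 ^ k) (\<lambda>x y. ip x y \<noteq> ip (ext 1 x) (ext 2 y))) \<le> 2 ^ k * 2 ^ k"
    using d[of 1 2] by (simp add: block_adj_def block_row_def q_def)
  show "1024 * card (pairs (2 ^ k) (\<lambda>x y. ip x y \<noteq> ip (ext 1 x) (ext 3 y))) \<le> 2 ^ k * 2 ^ k"
    using d[of 1 3] by (simp add: block_adj_def block_row_def q_def)
  show "1024 * card (pairs (2 ^ k) (\<lambda>x y. ip x (y div 2) \<noteq> ip (ext 2 x) (ext 3 y div 2))) \<le> 2 ^ k * 2 ^ k"
    using d[of 2 3] by (simp add: block_adj_def block_row_def q_def)
qed

lemma card_S_moved:
  assumes "scale * card disagree \<le> q * q"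
  shows "8 * card (S \<inter> moved) \<le> q"
proof -
  interpret ao: almost_orthogonal k 1024 "ext 2" "ext 1" "ext 3"
    by (rule almost_orthogonal_ext[OF assms])
  have q: "ao.q = q" by (simp add: q_def ao.q_def)
  have ext_card: "32 * card {x. x < q \<and> ext j x \<noteq> x} \<le> q" if "j \<in> {1, 2, 3}" for j
    using that ao.almost_identity unfolding q by auto
  let ?B = "\<lambda>j. {x. x < q \<and> ext j x \<noteq> x} \<union> {x. x < q \<and> x \<notin> kept j}"
  \<comment> \<open>Here \<open>2064 = scale / 128\<close> comes from \<open>card_not_kept\<close>,
    and \<open>3 * (1 / 32 + 1 / 2064)\<close> is below the desired 1/8.\<close>
  have B: "2064 * card ((\<lambda>x. j * q + x) ` ?B j) \<le> 2064 * (q div 32) + q" if j: "j \<in> {1, 2, 3}" for j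
  proof -
    have "card ((\<lambda>x. j * q + x) ` ?B j) \<le> card (?B j)" by (rule card_image_le) auto
    also have "\<dots> \<le> card {x. x < q \<and> ext j x \<noteq> x} + card {x. x < q \<and> x \<notin> kept j}" by (rule card_Un_le)
    finally have "card ((\<lambda>x. j * q + x) ` ?B j) \<le> card {x. x < q \<and> ext j x \<noteq> x} + card {x. x < q \<and> x \<notin> kept j}" .
    moreover have "card {x. x < q \<and> ext j x \<noteq> x} \<le> q div 32"
      using ext_card[OF j] by linarith
    moreover have "2064 * card {x. x < q \<and> x \<notin> kept j} \<le> q"
      using card_not_kept[OF assms j] by (simp add: scale_def)
    ultimately show ?thesis by linarith
  qed
  have "S \<inter> moved \<subseteq> (\<lambda>x. 1 * q + x) ` ?B 1 \<union> (\<lambda>x. 2 * q + x) ` ?B 2 \<union> (\<lambda>x. 3 * q + x) ` ?B 3"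
  proof
    fix s assume s: "s \<in> S \<inter> moved"
    define j where "j = s div q"
    define x where "x = s mod q"
    have sjx: "s = j * q + x" "x < q" by (simp_all add: j_def x_def)
    have j: "j \<in> {1, 2, 3}" using s by (auto simp: S_def j_def)
    have "x \<in> ?B j"
    proof (rule ccontr)
      assume "x \<notin> ?B j"
      then have "x \<in> kept j" "ext j x = x" using sjx by auto
      then have "\<pi> s = s" using \<pi>_eq_block ext(2) sjx by simp
      then show False using s by (simp add: moved_def)
    qed
    then have "s \<in> (\<lambda>x. j * q + x) ` ?B j" using sjx by blast
    then show "s \<in> (\<lambda>x. 1 * q + x) ` ?B 1 \<union> (\<lambda>x. 2 * q + x) ` ?B 2 \<union> (\<lambda>x. 3 * q + x) ` ?B 3"
      using j by blast
  qed
  then have "card (S \<inter> moved) \<le> card ((\<lambda>x. 1 * q + x) ` ?B 1 \<union> (\<lambda>x. 2 * q + x) ` ?B 2 \<union> (\<lambda>x. 3 * q + x) ` ?B 3)"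
    by (rule card_mono[rotated]) auto
  also have "\<dots> \<le> card ((\<lambda>x. 1 * q + x) ` ?B 1) + card ((\<lambda>x. 2 * q + x) ` ?B 2) + card ((\<lambda>x. 3 * q + x) ` ?B 3)"
    by (intro order_trans[OF card_Un_le] add_mono card_Un_le order_refl)
  finally show ?thesis using B[of 1] B[of 2] B[of 3] by simp
qed

text \<open>Every moved vertex is bad: otherwise \<open>r\<close> would be at most
  \<open>q / 64 + 2 + q / 8\<close>, which is less than \<open>q / 2\<close>.\<close>

lemma card_moved_small:
  assumes "scale * card disagree \<le> q * q"
  shows "16 * card moved \<le> q"
proof -
  have "moved \<subseteq> bad"
  proof (rule subsetI, rule ccontr)
    fix u assume u: "u \<in> moved" "u \<notin> bad"
    then have "64 * card (row_disagree u) \<le> q" by (auto simp: bad_def moved_def)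
    then show False using row_disagree_moved[OF u(1)] card_S_moved[OF assms] q_eq q_large by linarith
  qed
  then have "card moved \<le> card bad" by (intro card_mono) (auto simp: bad_def)
  then show ?thesis using card_bad[OF assms] by (simp add: scale_def)
qed

text \<open>If at most \<open>q / 16\<close> vertices move, each moved row has at least
  \<open>q / 4\<close> disagreements. Otherwise there are at least \<open>q * q / scale\<close>
  disagreements in all, while \<open>n * card moved\<close> never exceeds
  \<open>(16 * q) * (16 * q)\<close>, whence the 256.\<close>

lemma disagree_ge: "n * card moved \<le> 256 * scale * card disagree"
proof -
  have card_V: "card moved \<le> n"
  proof -
    have "card moved \<le> card V" by (rule card_mono) (auto simp: moved_def)
    then show ?thesis by (simp add: V_def)
  qed
  have n: "n \<le> 16 * q" using n_bounds by simp
  show ?thesis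
  proof (cases "16 * card moved \<le> q")
    case True
    have row: "q \<le> 4 * card (row_disagree u)" if "u \<in> moved" for u
    proof -
      have "card (S \<inter> moved) \<le> card moved" by (rule card_mono) (auto simp: moved_def)
      then show ?thesis using row_disagree_moved[OF that] True q_eq q_large by linarith
    qed
    have "q * card moved = (\<Sum>u\<in>moved. q)" by simp
    also have "\<dots> \<le> (\<Sum>u\<in>moved. 4 * card (row_disagree u))" by (rule sum_mono) (rule row)
    also have "\<dots> \<le> (\<Sum>u\<in>V. 4 * card (row_disagree u))" by (rule sum_mono2) (auto simp: moved_def)
    also have "\<dots> = 4 * card disagree"
      unfolding card_disagree by (rule sum_distrib_left[symmetric])
    finally have "q * card moved \<le> 4 * card disagree" .
    have "n * card moved \<le> 16 * q * card moved" using n by (rule mult_le_mono1)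
    also have "\<dots> = 16 * (q * card moved)" by simp
    also have "\<dots> \<le> 16 * (4 * card disagree)"
      using \<open>q * card moved \<le> 4 * card disagree\<close> by (rule mult_le_mono2)
    also have "\<dots> \<le> 256 * scale * card disagree" by (simp add: scale_def)
    finally show ?thesis .
  next
    case False
    then have "q * q \<le> scale * card disagree" using card_moved_small by linarith
    then have "256 * (q * q) \<le> 256 * (scale * card disagree)" by (rule mult_le_mono2)
    moreover have "n * card moved \<le> (16 * q) * (16 * q)"
      using n card_V by (intro mult_le_mono) auto
    ultimately show ?thesis by simp
  qed
qed

end

lemma dim_params:
  assumes "2 ^ 27 \<le> n"
  shows "block_graph_params (dim n) n" "23 \<le> dim n"
proof -
  have lt: "n < 2 ^ length (bits n)" and le: "2 ^ length (bits n) \<le> 2 * n"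
    using two_power_length_bits[of n] assms by auto
  have "(2::nat) ^ 27 < 2 ^ length (bits n)" using assms lt by (rule le_less_trans)
  then have "27 < length (bits n)" by (simp only: power_strict_increasing_iff)
  then obtain j where j: "length (bits n) = 4 + j" "23 < j" 
    using that[of "length (bits n) - 4"] by simp
  then have d: "dim n = j" by (simp add: dim_def)
  show "23 \<le> dim n" using d j by simp
  show "block_graph_params (dim n) n"
    using lt le j unfolding d j(1) by unfold_locales (simp_all add: power_add)
qed

lemma card_edge_preimage:
  assumes inj: "inj \<pi>"
  shows "finite {(u, v). {\<pi> u, \<pi> v} = e} \<and> card {(u, v). {\<pi> u, \<pi> v} = e} \<le> 2"
proof (cases "\<exists>u v. e = {\<pi> u, \<pi> v}")
  case True
  then obtain u v where e: "e = {\<pi> u, \<pi> v}" by blast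
  have sub: "{(u, v). {\<pi> u, \<pi> v} = e} \<subseteq> {(u, v), (v, u)}"
    unfolding e doubleton_eq_iff inj_eq[OF inj] by auto
  have "finite {(u, v), (v, u)}" by simp
  moreover have "card {(u, v), (v, u)} \<le> 2" by (rule card_insert_le_m1) simp_all
  ultimately show ?thesis using finite_subset[OF sub] card_mono[OF _ sub] by (meson order_trans)
next
  case False
  then have "{(u, v). {\<pi> u, \<pi> v} = e} = {}" by auto
  then show ?thesis by (simp only:) simp
qed

lemma robust_block_graph:
  assumes "2 ^ 27 \<le> n"
  shows "robustly_self_ordered (1 / (512 * real scale) * real n) {1..n} (block_graph n)"
  unfolding robustly_self_ordered_def
proof (intro allI impI)
  fix \<pi> assume \<pi>: "\<pi> permutes {1..n}"
  interpret block_graph_params "dim n" n using dim_params assms by blast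
  interpret block_graph_permutation "dim n" n \<pi>
    by unfold_locales (use \<pi> dim_params assms in \<open>auto simp: V_def\<close>)
  let ?E = "block_graph n"
  let ?\<Delta> = "sym_diff ?E ((`) \<pi> ` ?E)"
  have E_iff: "{u, v} \<in> ?E \<longleftrightarrow> u \<in> V \<and> v \<in> V \<and> A u v" for u v
    by (simp add: in_block_graph_iff V_def A_def)
  have inj: "inj \<pi>" using \<pi> by (rule permutes_inj)
  have \<pi>E_iff: "{\<pi> u, \<pi> v} \<in> (`) \<pi> ` ?E \<longleftrightarrow> {u, v} \<in> ?E" for u v
  proof -
    have "inj ((`) \<pi>)" using inj by (simp add: inj_image_eq_iff inj_def)
    then have "\<pi> ` {u, v} \<in> (`) \<pi> ` ?E \<longleftrightarrow> {u, v} \<in> ?E" by (rule inj_image_mem_iff)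
    then show ?thesis by simp
  qed
  have fin: "finite ?E"
    by (rule finite_subset[of _ "Pow V"]) (auto simp: block_graph_def V_def)
  \<comment> \<open>A disagreement at \<open>(u, v)\<close> puts the image edge into the symmetric
    difference, and at most two ordered pairs lead to the same edge. So 256 becomes 512.\<close>
  have "disagree \<subseteq> (\<Union>e\<in>?\<Delta>. {(u, v). {\<pi> u, \<pi> v} = e})"
  proof
    fix z assume "z \<in> disagree"
    then obtain u v where z: "z = (u, v)" "u \<in> V" "v \<in> V" "A u v \<noteq> A (\<pi> u) (\<pi> v)"
      by (auto simp: disagree_def)
    then have "{\<pi> u, \<pi> v} \<in> ?\<Delta>" using \<pi>E_iff[of u v] E_iff \<pi>_in by auto
    then show "z \<in> (\<Union>e\<in>?\<Delta>. {(u, v). {\<pi> u, \<pi> v} = e})" using z by auto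
  qed
  moreover have two: "finite {(u, v). {\<pi> u, \<pi> v} = e} \<and> card {(u, v). {\<pi> u, \<pi> v} = e} \<le> 2" for e
    by (rule card_edge_preimage[OF inj])
  ultimately have "card disagree \<le> card (\<Union>e\<in>?\<Delta>. {(u, v). {\<pi> u, \<pi> v} = e})"
    using fin by (intro card_mono) auto
  also have "\<dots> \<le> (\<Sum>e\<in>?\<Delta>. card {(u, v). {\<pi> u, \<pi> v} = e})" by (rule card_UN_le) (use fin in auto)
  also have "\<dots> \<le> (\<Sum>e\<in>?\<Delta>. 2)" by (rule sum_mono) (use two in blast)
  finally have "card disagree \<le> 2 * card ?\<Delta>" by simp
  then have "256 * scale * card disagree \<le> 512 * scale * card ?\<Delta>" by simp
  with disagree_ge have "n * card moved \<le> 512 * scale * card ?\<Delta>" by linarith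
  then have "real (n * card moved) \<le> real (512 * scale * card ?\<Delta>)" by (simp only: of_nat_le_iff)
  then have "real n * real (card moved) \<le> real (card ?\<Delta>) * (512 * real scale)"
    by (simp only: of_nat_mult of_nat_numeral mult.commute mult.left_commute)
  moreover have "0 < 512 * real scale" by (simp add: scale_def)
  ultimately have "real n * real (card moved) / (512 * real scale) \<le> real (card ?\<Delta>)"
    by (simp only: pos_divide_le_eq)
  moreover have "1 / (512 * real scale) * real n * real (card moved) =
      real n * real (card moved) / (512 * real scale)"
    by simp
  ultimately show "real (card ?\<Delta>) \<ge> 1 / (512 * real scale) * real n * real (card {v \<in> {1..n}. \<pi> v \<noteq> v})"
    unfolding moved_def V_def by linarith
qed

section \<open>Self-ordering and degrees\<close>

text \<open>Two isomorphisms onto the graph differ by an automorphism. It changes no edge, so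
  positive robustness leaves it no vertex to move.\<close>

lemma self_ordered_if_robust:
  assumes "0 < c" "robustly_self_ordered c {1..n} E"
  shows "self_ordered n E"
  unfolding self_ordered_def
proof (intro allI impI, elim conjE)
  fix V' :: "nat set" and E'
  assume simple: "simple_graph V' E'" and "isomorphic V' E' {1..n} E"
  then obtain \<phi>\<^sub>0 where \<phi>\<^sub>0: "graph_bij \<phi>\<^sub>0 V' E' {1..n} E" by (auto simp: isomorphic_def)
  have sub: "e \<subseteq> V'" if "e \<in> E'" for e using simple that by (fastforce simp: simple_graph_def)
  let ?\<phi> = "restrict \<phi>\<^sub>0 V'"
  have img: "?\<phi> ` e = \<phi>\<^sub>0 ` e" if "e \<in> E'" for e using sub[OF that] by (force simp: image_def)
  have "(`) ?\<phi> ` E' = (`) \<phi>\<^sub>0 ` E'" by (rule image_cong[OF refl img])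
  moreover have "bij_betw ?\<phi> V' {1..n}"
    using \<phi>\<^sub>0 bij_betw_cong[of V' ?\<phi> \<phi>\<^sub>0] by (simp add: graph_bij_def)
  ultimately have \<phi>: "graph_bij ?\<phi> V' E' {1..n} E" using \<phi>\<^sub>0 by (simp add: graph_bij_def)
  show "\<exists>!\<phi>. \<phi> \<in> extensional V' \<and> graph_bij \<phi> V' E' {1..n} E"
  proof (rule ex1I[of _ ?\<phi>])
    show "?\<phi> \<in> extensional V' \<and> graph_bij ?\<phi> V' E' {1..n} E" using \<phi> by simp
    fix \<psi> assume \<psi>: "\<psi> \<in> extensional V' \<and> graph_bij \<psi> V' E' {1..n} E"
    let ?g = "inv_into V' ?\<phi>"
    define \<pi> where "\<pi> x = (if x \<in> {1..n} then \<psi> (?g x) else x)" for x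
    have bij: "bij_betw ?\<phi> V' {1..n}" "bij_betw \<psi> V' {1..n}"
      using \<phi> \<psi> by (simp_all add: graph_bij_def)
    have "bij_betw (\<psi> \<circ> ?g) {1..n} {1..n}"
      using bij_betw_trans[OF bij_betw_inv_into[OF bij(1)] bij(2)] .
    then have "bij_betw \<pi> {1..n} {1..n}"
      by (rule bij_betw_cong[THEN iffD1, rotated]) (simp add: \<pi>_def)
    then have permutes: "\<pi> permutes {1..n}" by (rule bij_imp_permutes) (unfold \<pi>_def, rule if_not_P)
    have \<pi>\<phi>: "\<pi> (?\<phi> v) = \<psi> v" if "v \<in> V'" for v
    proof -
      have "?\<phi> v \<in> {1..n}" using bij(1) that by (auto simp: bij_betw_def)
      then show ?thesis using bij_betw_inv_into_left[OF bij(1) that] by (simp add: \<pi>_def)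
    qed
    have "(`) \<pi> ` E = (`) \<pi> ` (`) ?\<phi> ` E'" using \<phi> by (simp add: graph_bij_def)
    also have "\<dots> = (\<lambda>e. \<pi> ` ?\<phi> ` e) ` E'" by (rule image_image)
    also have "\<dots> = (`) \<psi> ` E'"
    proof (rule image_cong)
      fix e assume "e \<in> E'"
      then have "v \<in> V'" if "v \<in> e" for v using sub that by blast
      then show "\<pi> ` ?\<phi> ` e = \<psi> ` e" using \<pi>\<phi> unfolding image_image by (intro image_cong) auto
    qed simp
    also have "\<dots> = E" using \<psi> by (simp add: graph_bij_def)
    finally have "(`) \<pi> ` E = E" .
    then have "c * real (card {v \<in> {1..n}. \<pi> v \<noteq> v}) \<le> 0"
      using assms(2) permutes unfolding robustly_self_ordered_def by fastforce
    then have "card {v \<in> {1..n}. \<pi> v \<noteq> v} = 0"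
      using assms(1) by (simp add: mult_le_0_iff)
    then have fixed: "\<pi> v = v" if "v \<in> {1..n}" for v using that by auto
    show "\<psi> = ?\<phi>"
    proof (rule extensionalityI[of _ V'])
      fix v assume v: "v \<in> V'"
      then have "?\<phi> v \<in> {1..n}" using bij(1) by (auto simp: bij_betw_def)
      then show "\<psi> v = ?\<phi> v" using \<pi>\<phi>[OF v] fixed by metis
    qed (use \<psi> in auto)
  qed
qed

lemma (in block_graph_params) vertex_degree_eq:
  assumes "dim n = k" "v \<in> V"
  shows "vertex_degree (block_graph n) v = deg v"
proof -
  have "bij_betw (\<lambda>u. {v, u}) {u \<in> V. A v u} {e \<in> block_graph n. v \<in> e}"
    unfolding bij_betw_def
  proof
    show "inj_on (\<lambda>u. {v, u}) {u \<in> V. A v u}" by (auto simp: inj_on_def doubleton_eq_iff)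
    show "(\<lambda>u. {v, u}) ` {u \<in> V. A v u} = {e \<in> block_graph n. v \<in> e}"
    proof (intro equalityI subsetI)
      fix e assume "e \<in> {e \<in> block_graph n. v \<in> e}"
      then obtain u w where e: "e = {u, w}" "u \<in> V" "w \<in> V" "A u w" "v = u \<or> v = w"
        unfolding block_graph_def A_def V_def assms by auto
      then show "e \<in> (\<lambda>u. {v, u}) ` {u \<in> V. A v u}"
        using A_commute by (auto simp: insert_commute)
    qed (use assms in \<open>auto simp: in_block_graph_iff A_def V_def\<close>)
  qed
  then show ?thesis unfolding vertex_degree_def deg_def using bij_betw_same_card by metis
qed

text \<open>The least degree \<open>q - 1\<close> exceeds \<open>0.06 * n\<close> because
  \<open>q > n / 16\<close>. The upper bound \<open>(m + 2) * r\<close> is at most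
  \<open>(1 / 2 + 1 / 8) * n\<close>, by \<open>2 * m * r \<le> n\<close> and
  \<open>8 \<le> m\<close>.\<close>

lemma block_graph_degree_bounds:
  assumes "2 ^ 27 \<le> n" "v \<in> {1..n}"
  shows "0.06 * real n \<le> real (vertex_degree (block_graph n) v)"
    "real (vertex_degree (block_graph n) v) \<le> 0.73 * real n"
proof -
  interpret block_graph_params "dim n" n using dim_params assms by blast
  have deg: "vertex_degree (block_graph n) v = deg v" "v \<in> V"
    using vertex_degree_eq assms by (auto simp: V_def)
  have "real (n + 1) \<le> real (16 * q)" using n_bounds by (simp only: of_nat_le_iff)
  moreover have "real (q - 1) \<le> real (deg v)" using deg_bounds deg by (simp only: of_nat_le_iff)
  moreover have "1024 \<le> real q" using q_ge by simp
  ultimately show "0.06 * real n \<le> real (vertex_degree (block_graph n) v)"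
    using deg(1) by (simp add: of_nat_diff)
  have "real (deg v) \<le> real ((m + 2) * r)" using deg_bounds deg by (simp only: of_nat_le_iff)
  moreover have "real ((m + 2) * r) = real (m * r) + 2 * real r" by (simp add: algebra_simps)
  moreover have "real (m * q) = 2 * real (m * r)" by (simp add: q_eq)
  moreover have "real (m * q) \<le> real n" using n_eq by (simp only: of_nat_le_iff)
  moreover have "8 * r \<le> m * r" using m_bounds by (intro mult_le_mono1)
  then have "8 * real r \<le> real (m * r)" by (metis of_nat_le_iff of_nat_mult of_nat_numeral)
  ultimately have "100 * real (deg v) \<le> 73 * real n" by linarith
  then have "real (deg v) \<le> 0.73 * real n" by simp
  then show "real (vertex_degree (block_graph n) v) \<le> 0.73 * real n" using deg by simp
qed

section \<open>Symbolic evaluation of programs\<close>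

text \<open>A weakest precondition with the cost as second argument of the postcondition; evaluating
  a program becomes rewriting with \<open>wp_simps\<close>.\<close>

definition wp :: "program \<Rightarrow> tree list \<Rightarrow> expr \<Rightarrow> (tree \<Rightarrow> nat \<Rightarrow> bool) \<Rightarrow> bool" where
  "wp P env e Q \<longleftrightarrow> (\<exists>v t. eval P env e v t \<and> Q v t)"

definition wps :: "program \<Rightarrow> tree list \<Rightarrow> expr list \<Rightarrow> (tree list \<Rightarrow> nat \<Rightarrow> bool) \<Rightarrow> bool" where
  "wps P env es Q \<longleftrightarrow> (\<exists>vs t. evals P env es vs t \<and> Q vs t)"

inductive_simps eval_simps:
  "eval P env (Var i) v t"
  "eval P env Const_Leaf v t"
  "eval P env (Mk_Node e1 e2) v t"
  "eval P env (Hd e) v t"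
  "eval P env (Tl e) v t"
  "eval P env (If_Node e0 e1 e2) v t"
  "eval P env (Let_In e1 e2) v t"
  "eval P env (Call f es) v t"
  "evals P env [] vs t"
  "evals P env (e # es) vs t"

lemma wp_simps:
  "wp P env (Var i) Q \<longleftrightarrow> i < length env \<and> Q (env ! i) 1"
  "wp P env Const_Leaf Q \<longleftrightarrow> Q Leaf 1"
  "wp P env (Mk_Node e1 e2) Q \<longleftrightarrow>
     wp P env e1 (\<lambda>v1 t1. wp P env e2 (\<lambda>v2 t2. Q (Node v1 v2) (t1 + t2 + 1)))"
  "wp P env (Hd e) Q \<longleftrightarrow> wp P env e (\<lambda>v t. Q (tree_hd v) (t + 1))"
  "wp P env (Tl e) Q \<longleftrightarrow> wp P env e (\<lambda>v t. Q (tree_tl v) (t + 1))"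
  "wp P env (If_Node e0 e1 e2) Q \<longleftrightarrow>
     wp P env e0 (\<lambda>v0 t0. wp P env (if v0 = Leaf then e2 else e1) (\<lambda>v t. Q v (t0 + t + 1)))"
  "wp P env (Let_In e1 e2) Q \<longleftrightarrow>
     wp P env e1 (\<lambda>v1 t1. wp P (v1 # env) e2 (\<lambda>v t. Q v (t1 + t + 1)))"
  "wp P env (Call f es) Q \<longleftrightarrow>
     wps P env es (\<lambda>vs t1. f < length P \<and> wp P vs (P ! f) (\<lambda>v t2. Q v (t1 + t2 + 1)))"
  "wps P env [] R \<longleftrightarrow> R [] 1"
  "wps P env (e # es) R \<longleftrightarrow>
     wp P env e (\<lambda>v t1. wps P env es (\<lambda>vs t2. R (v # vs) (t1 + t2 + 1)))"
proof -
  show "wp P env (If_Node e0 e1 e2) Q \<longleftrightarrow>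
     wp P env e0 (\<lambda>v0 t0. wp P env (if v0 = Leaf then e2 else e1) (\<lambda>v t. Q v (t0 + t + 1)))"
    unfolding wp_def eval_simps by (auto split: if_splits) (metis tree.exhaust)+
qed (auto simp: wp_def wps_def eval_simps, (blast | metis)+)

text \<open>By determinism a known evaluation decides every postcondition, so the correctness of a
  callee serves as a rewrite rule in its caller.\<close>

lemma wp_known: "eval P env e v t \<Longrightarrow> wp P env e Q \<longleftrightarrow> Q v t"
  unfolding wp_def using eval_deterministic(1) by metis

definition returns :: "program \<Rightarrow> nat \<Rightarrow> tree list \<Rightarrow> tree \<Rightarrow> nat \<Rightarrow> bool" where
  "returns P f vs v T \<longleftrightarrow> (\<exists>t\<le>T. eval P vs (P ! f) v t)"

lemma returnsI: "wp P vs (P ! f) (\<lambda>v' t. v' = v \<and> t \<le> T) \<Longrightarrow> returns P f vs v T"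
  unfolding returns_def wp_def by blast

text \<open>The cost \<open>t\<close> is obtained once for all postconditions \<open>Q\<close>,
  which is what makes the fact usable for rewriting.\<close>

lemma returnsE:
  assumes "returns P f vs v T"
  obtains t where "\<And>Q. wp P vs (P ! f) Q \<longleftrightarrow> Q v t" "t \<le> T"
  using assms wp_known unfolding returns_def by blast

lemma returns_mono: "returns P f vs v T \<Longrightarrow> T \<le> T' \<Longrightarrow> returns P f vs v T'"
  unfolding returns_def using order_trans by blast

lemma returns_computes_within:
  assumes "returns P 0 [x] y T" "P \<noteq> []" "real T \<le> B"
  shows "computes_within P x y B"
proof -
  obtain t where "t \<le> T" "eval P [x] (P ! 0) y t" using assms(1) by (auto simp: returns_def)
  moreover from this(1) have "real t \<le> B" using assms(3) by linarith
  ultimately show ?thesis using assms(2) unfolding computes_within_def by blast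
qed

abbreviation tt :: tree where "tt \<equiv> Node Leaf Leaf"
abbreviation True_Expr :: expr where "True_Expr \<equiv> Mk_Node Const_Leaf Const_Leaf"

lemma enc_bool_if: "enc_bool b = (if b then tt else Leaf)"
  by (cases b) simp_all

text \<open>The parameter \<open>f\<close> is the position of the body in the program, used for its
  recursive calls; the other bodies take their own and their callees' positions likewise. This
  allows reuse in several programs.\<close>

definition eq_body :: "nat \<Rightarrow> expr" where
  "eq_body f =
     If_Node (Var 0)
       (If_Node (Var 1)
         (If_Node (Call f [Hd (Var 0), Hd (Var 1)])
           (Call f [Tl (Var 0), Tl (Var 1)])
           Const_Leaf)
         Const_Leaf)
       (If_Node (Var 1) Const_Leaf True_Expr)"

lemma eq_returns:
  assumes "f < length P" "P ! f = eq_body f"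
  shows "returns P f [a, b] (enc_bool (a = b)) (50 * size a + 20)"
proof (induction a arbitrary: b)
  case Leaf
  show ?case
    by (rule returnsI, subst assms(2)) (simp add: eq_body_def wp_simps enc_bool_if)
next
  case (Node a1 a2)
  show ?case
  proof (cases b)
    case Leaf
    show ?thesis
      by (rule returnsI, subst assms(2)) (simp add: eq_body_def wp_simps enc_bool_if Leaf)
  next
    case b: (Node b1 b2)
    obtain t1 where t1: "\<And>Q. wp P [a1, b1] (P ! f) Q \<longleftrightarrow> Q (enc_bool (a1 = b1)) t1" "t1 \<le> 50 * size a1 + 20"
      using Node.IH(1) returnsE by blast
    obtain t2 where t2: "\<And>Q. wp P [a2, b2] (P ! f) Q \<longleftrightarrow> Q (enc_bool (a2 = b2)) t2" "t2 \<le> 50 * size a2 + 20"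
      using Node.IH(2) returnsE by blast
    show ?thesis
      by (rule returnsI, subst assms(2))
        (use t1(2) t2(2) assms(1) in \<open>simp add: eq_body_def wp_simps enc_bool_if t1(1) t2(1) b\<close>)
  qed
qed

section \<open>The adjacency algorithm\<close>

text \<open>Unlike \<open>bits\<close>, the lists may have leading zeros, which intermediate results
  of the programs do contain.\<close>

fun val :: "bool list \<Rightarrow> nat" where
  "val [] = 0"
| "val (b # bs) = of_bool b + 2 * val bs"

lemma val_bits [simp]: "val (bits n) = n"
proof (induction n rule: bits.induct)
  case (1 n)
  then show ?case by (subst bits.simps) auto
qed

lemma val_tl: "val (tl xs) = val xs div 2"
  by (cases xs) auto

lemma bits_0 [simp]: "bits 0 = []" by (simp add: bits.simps)

lemma drop_bits: "drop k (bits n) = bits (n div 2 ^ k)"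
proof (induction k arbitrary: n)
  case (Suc k)
  show ?case
  proof (cases "n = 0")
    case False
    then have "drop (Suc k) (bits n) = drop k (bits (n div 2))" by (subst bits.simps) simp
    then show ?thesis using Suc by (simp add: div_mult2_eq)
  qed simp
qed simp

lemma length_bits_mono:
  assumes "m \<le> n"
  shows "length (bits m) \<le> length (bits n)"
proof (cases "m = 0")
  case False
  then have "(2::nat) ^ length (bits m) \<le> 2 * n"
    using two_power_length_bits(2)[of m] assms by linarith
  also have "\<dots> < 2 ^ Suc (length (bits n))" using two_power_length_bits(1)[of n] by simp
  finally have "length (bits m) < Suc (length (bits n))" by (simp only: power_strict_increasing_iff)
  then show ?thesis by simp
qed simp

text \<open>Padding makes the length of the result independent of \<open>xs\<close>, so the
  recursion can be driven by another list serving as a unary counter.\<close>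

primrec take_pad :: "nat \<Rightarrow> bool list \<Rightarrow> bool list" where
  "take_pad 0 xs = []"
| "take_pad (Suc k) xs = (xs \<noteq> [] \<and> hd xs) # take_pad k (tl xs)"

lemma length_take_pad [simp]: "length (take_pad k xs) = k"
  by (induction k arbitrary: xs) simp_all

lemma val_take_pad: "val (take_pad k xs) = val xs mod 2 ^ k"
proof (induction k arbitrary: xs)
  case (Suc k)
  have "val xs mod 2 ^ Suc k = val xs mod 2 + 2 * (val xs div 2 mod 2 ^ k)"
    by (simp add: mod_mult2_eq)
  then show ?case using Suc[of "tl xs"] by (cases xs) (auto simp: val_tl)
qed simp

fun xor_list :: "bool list \<Rightarrow> bool list \<Rightarrow> bool list" where
  "xor_list [] ys = ys"
| "xor_list xs [] = xs"
| "xor_list (x # xs) (y # ys) = (x \<noteq> y) # xor_list xs ys"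

lemma val_xor_list: "val (xor_list xs ys) = val xs XOR val ys"
proof (induction xs ys rule: xor_list.induct)
  case (3 x xs y ys)
  have "val (x # xs) XOR val (y # ys) =
      of_bool (odd (val (x # xs) XOR val (y # ys))) + 2 * ((val (x # xs) XOR val (y # ys)) div 2)"
    by (simp add: mod_2_eq_odd[symmetric] del: odd_xor_nat)
  also have "\<dots> = of_bool (x \<noteq> y) + 2 * (val xs XOR val ys)"
    by (simp add: xor_div_2)
  finally show ?case using 3 by simp
qed simp_all

lemma length_xor_list: "length (xor_list xs ys) \<le> length xs + length ys"
  by (induction xs ys rule: xor_list.induct) simp_all

abbreviation enc_bits :: "bool list \<Rightarrow> tree" where "enc_bits \<equiv> enc_list enc_bool"

lemma enc_list_simps [simp]:
  "enc_list f [] = Leaf" "enc_list f (x # xs) = Node (f x) (enc_list f xs)"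
  by (simp_all add: enc_list_def)

lemma enc_list_eq_Leaf_iff [simp]: "enc_list f xs = Leaf \<longleftrightarrow> xs = []"
  by (cases xs) simp_all

lemma tree_tl_enc_list [simp]: "tree_tl (enc_list f xs) = enc_list f (tl xs)"
  by (cases xs) simp_all

lemma tree_hd_enc_bits [simp]: "tree_hd (enc_bits xs) = enc_bool (xs \<noteq> [] \<and> hd xs)"
  by (cases xs) simp_all

lemma enc_bool_eq_Leaf_iff [simp]: "enc_bool b = Leaf \<longleftrightarrow> \<not> b"
  by (cases b) simp_all

lemma size_enc_bits_le: "size (enc_bits xs) \<le> 2 * length xs"
proof (induction xs)
  case (Cons x xs)
  then show ?case by (cases x) simp_all
qed simp

lemma enc_nat_def': "enc_nat n = enc_bits (bits n)" by (simp add: enc_nat_def)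

lemma enc_bits_inject: "enc_bits xs = enc_bits ys \<Longrightarrow> xs = ys"
proof (induction xs arbitrary: ys)
  case Nil
  then show ?case by (metis enc_list_eq_Leaf_iff enc_list_simps(1))
next
  case (Cons x xs)
  then show ?case by (cases ys) (auto simp: enc_bool_if split: if_splits)
qed

lemma enc_bits_bits_inject: "enc_bits (bits u) = enc_bits (bits v) \<longleftrightarrow> u = v"
  using enc_bits_inject val_bits by metis

definition ip_body :: "nat \<Rightarrow> expr" where
  "ip_body f =
     If_Node (Var 0)
       (If_Node (Var 1)
         (If_Node (Hd (Var 0))
           (If_Node (Hd (Var 1))
             (If_Node (Call f [Tl (Var 0), Tl (Var 1)]) Const_Leaf True_Expr)
             (Call f [Tl (Var 0), Tl (Var 1)]))
           (Call f [Tl (Var 0), Tl (Var 1)]))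
         Const_Leaf)
       Const_Leaf"

lemma ip_returns:
  assumes "f < length P" "P ! f = ip_body f"
  shows "returns P f [enc_bits xs, enc_bits ys] (enc_bool (ip (val xs) (val ys))) (40 * length xs + 20)"
proof (induction xs arbitrary: ys)
  case Nil
  show ?case by (rule returnsI, subst assms(2)) (simp add: ip_body_def wp_simps)
next
  case (Cons x xs)
  show ?case
  proof (cases ys)
    case Nil
    then show ?thesis by (intro returnsI, subst assms(2)) (simp add: ip_body_def wp_simps)
  next
    case ys: (Cons y ys')
    obtain t where t: "\<And>Q. wp P [enc_bits xs, enc_bits ys'] (P ! f) Q \<longleftrightarrow> Q (enc_bool (ip (val xs) (val ys'))) t"
      "t \<le> 40 * length xs + 20"
      using Cons.IH returnsE by blast
    have "ip (val (x # xs)) (val (y # ys')) = ((x \<and> y) \<noteq> ip (val xs) (val ys'))"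
      by (subst ip_rec) simp
    then show ?thesis unfolding ys
      by (intro returnsI, subst assms(2))
        (use t(2) assms(1) in \<open>auto simp add: ip_body_def wp_simps enc_bool_if t(1) simp del: val.simps\<close>)
  qed
qed

definition xor_body :: "nat \<Rightarrow> expr" where
  "xor_body f =
     If_Node (Var 0)
       (If_Node (Var 1)
         (Mk_Node
           (If_Node (Hd (Var 0)) (If_Node (Hd (Var 1)) Const_Leaf True_Expr) (Hd (Var 1)))
           (Call f [Tl (Var 0), Tl (Var 1)]))
         (Var 0))
       (Var 1)"

lemma xor_returns:
  assumes "f < length P" "P ! f = xor_body f"
  shows "returns P f [enc_bits xs, enc_bits ys] (enc_bits (xor_list xs ys)) (40 * length xs + 20)"
proof (induction xs ys rule: xor_list.induct)
  case (3 x xs y ys)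
  obtain t where t: "\<And>Q. wp P [enc_bits xs, enc_bits ys] (P ! f) Q \<longleftrightarrow> Q (enc_bits (xor_list xs ys)) t"
    "t \<le> 40 * length xs + 20"
    using 3 returnsE by blast
  show ?case
    by (rule returnsI, subst assms(2))
      (use t(2) assms(1) in \<open>auto simp add: xor_body_def wp_simps enc_bool_if t(1)\<close>)
qed (rule returnsI, subst assms(2), simp add: xor_body_def wp_simps)+

text \<open>Only the length of the first argument matters: it is a unary \<open>k\<close>, and the
  result is the label modulo \<open>2 ^ k\<close>. The next function uses the same counter for the
  quotient.\<close>

definition low_body :: "nat \<Rightarrow> expr" where
  "low_body f =
     If_Node (Var 0) (Mk_Node (Hd (Var 1)) (Call f [Tl (Var 0), Tl (Var 1)])) Const_Leaf"

lemma low_returns: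
  assumes "f < length P" "P ! f = low_body f"
  shows "returns P f [enc_bits ns, enc_bits xs] (enc_bits (take_pad (length ns) xs)) (30 * length ns + 20)"
proof (induction ns arbitrary: xs)
  case Nil
  show ?case by (rule returnsI, subst assms(2)) (simp add: low_body_def wp_simps)
next
  case (Cons b ns)
  obtain t where t: "\<And>Q. wp P [enc_bits ns, enc_bits (tl xs)] (P ! f) Q \<longleftrightarrow>
      Q (enc_bits (take_pad (length ns) (tl xs))) t" "t \<le> 30 * length ns + 20"
    using Cons returnsE by blast
  show ?case
    by (rule returnsI, subst assms(2))
      (use t(2) assms(1) in \<open>simp add: low_body_def wp_simps t(1)\<close>)
qed

definition high_body :: "nat \<Rightarrow> expr" where
  "high_body f = If_Node (Var 0) (Call f [Tl (Var 0), Tl (Var 1)]) (Var 1)"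

lemma high_returns:
  assumes "f < length P" "P ! f = high_body f"
  shows "returns P f [enc_bits ns, enc_bits xs] (enc_bits (drop (length ns) xs)) (30 * length ns + 20)"
proof (induction ns arbitrary: xs)
  case Nil
  show ?case by (rule returnsI, subst assms(2)) (simp add: high_body_def wp_simps)
next
  case (Cons b ns)
  obtain t where t: "\<And>Q. wp P [enc_bits ns, enc_bits (tl xs)] (P ! f) Q \<longleftrightarrow>
      Q (enc_bits (drop (length ns) (tl xs))) t" "t \<le> 30 * length ns + 20"
    using Cons returnsE by blast
  show ?case
    by (rule returnsI, subst assms(2))
      (use t(2) assms(1) in \<open>simp add: high_body_def wp_simps t(1) drop_Suc\<close>)
qed

text \<open>Binary lists have no leading zeros, so their length and first bit identify the numbers 1, 2, 3.\<close>

definition switch :: "nat \<Rightarrow> expr \<Rightarrow> expr \<Rightarrow> expr \<Rightarrow> expr \<Rightarrow> expr" where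
  "switch i e1 e2 e3 e =
     If_Node (Var i)
       (If_Node (Tl (Tl (Var i))) e
         (If_Node (Tl (Var i)) (If_Node (Hd (Var i)) e3 e2) e1))
       e"

lemma bits_cases:
  obtains "h = 0" "bits h = []" | "h = 1" "bits h = [True]" | "h = 2" "bits h = [False, True]"
    | "h = 3" "bits h = [True, True]"
    | x y z zs where "h \<notin> {0, 1, 2, 3}" "bits h = x # y # z # zs"
proof -
  consider "h = 0" | "h = 1" | "h = 2" | "h = 3" | "4 \<le> h" by linarith
  then show thesis
  proof cases
    case 5
    then have "h div 2 div 2 \<noteq> 0" "h div 2 \<noteq> 0" "h \<noteq> 0" by auto
    then have "bits h = odd h # odd (h div 2) # odd (h div 2 div 2) # bits (h div 2 div 2 div 2)"
      by (metis bits.simps)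
    then show thesis using that(5) 5 by auto
  qed (use that in \<open>simp_all add: bits.simps\<close>)
qed

text \<open>The bound 15 covers the cost of the tests in every branch, so that callers need not
  distinguish how far the dispatch went.\<close>

lemma wp_switch:
  assumes "i < length env" "env ! i = enc_bits (bits h)"
    and "\<And>t. t \<le> 15 \<Longrightarrow> h = 1 \<Longrightarrow> wp P env e1 (\<lambda>v' t'. Q v' (t + t'))"
    and "\<And>t. t \<le> 15 \<Longrightarrow> h = 2 \<Longrightarrow> wp P env e2 (\<lambda>v' t'. Q v' (t + t'))"
    and "\<And>t. t \<le> 15 \<Longrightarrow> h = 3 \<Longrightarrow> wp P env e3 (\<lambda>v' t'. Q v' (t + t'))"
    and "\<And>t. t \<le> 15 \<Longrightarrow> h \<notin> {1, 2, 3} \<Longrightarrow> wp P env e (\<lambda>v' t'. Q v' (t + t'))"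
  shows "wp P env (switch i e1 e2 e3 e) Q"
proof (cases h rule: bits_cases)
  case 1
  show ?thesis using 1 assms(1,2) assms(6)[of 2] by (simp add: switch_def wp_simps eval_nat_numeral)
next
  case 2
  show ?thesis using 2 assms(1,2) assms(3)[of 9] by (simp add: switch_def wp_simps eval_nat_numeral)
next
  case 3
  show ?thesis using 3 assms(1,2) assms(4)[of 12] by (simp add: switch_def wp_simps eval_nat_numeral)
next
  case 4
  show ?thesis using 4 assms(1,2) assms(5)[of 12] by (simp add: switch_def wp_simps eval_nat_numeral)
next
  case (5 x y z zs)
  show ?thesis using 5 assms(1,2) assms(6)[of 6] by (simp add: switch_def wp_simps eval_nat_numeral)
qed

text \<open>The variables of the following body are \<open>h\<close>, \<open>w\<close>, \<open>h'\<close>, \<open>x\<close>.\<close>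

definition block_adj_body :: "nat \<Rightarrow> nat \<Rightarrow> nat \<Rightarrow> expr" where
  "block_adj_body f ip_f xor_f =
    (let ip_e = (\<lambda>a b. Call ip_f [a, b]); not_e = (\<lambda>e. If_Node e Const_Leaf True_Expr);
       h = Var 0; w = Var 1; x = Var 3
     in switch 2
       (switch 0 True_Expr (ip_e w x) (ip_e w x) (ip_e w x))
       (switch 0 (ip_e w x) (not_e (ip_e w x)) (not_e (ip_e (Tl w) x))
         (ip_e (Call xor_f [w, h]) x))
       (switch 0 (ip_e w x) (not_e (ip_e w (Tl x))) Const_Leaf
         (ip_e (Call xor_f [w, Tl h]) x))
       (let swap = Call f [Var 2, Var 3, Var 0, Var 1] in switch 0 swap swap swap Const_Leaf))"

lemma block_adj_returns:
  assumes f: "f < length P" "P ! f = block_adj_body f ip_f xor_f"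
    and ip_f: "ip_f < length P" "P ! ip_f = ip_body ip_f"
    and xor_f: "xor_f < length P" "P ! xor_f = xor_body xor_f"
  shows "returns P f [enc_bits (bits h), enc_bits ws, enc_bits (bits h'), enc_bits xs]
    (enc_bool (block_adj h (val ws) h' (val xs)))
    (100 * (length (bits h) + length ws + length (bits h') + length xs) + 200)"
proof -
  have small: "returns P f [enc_bits (bits h), enc_bits ws, enc_bits (bits h'), enc_bits xs]
    (enc_bool (block_adj h (val ws) h' (val xs)))
    (100 * (length (bits h) + length ws) + 130)" if h': "h' \<in> {1, 2, 3}" for h ws h' xs
  proof -
    let ?hs = "bits h"
    have ip: "returns P ip_f [enc_bits as, enc_bits bs] (enc_bool (ip (val as) (val bs))) (40 * length as + 20)" for as bs
      by (rule ip_returns[OF ip_f])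
    have xor: "returns P xor_f [enc_bits as, enc_bits bs] (enc_bits (xor_list as bs)) (40 * length as + 20)" for as bs
      by (rule xor_returns[OF xor_f])
    obtain t1 where t1: "\<And>Q. wp P [enc_bits ws, enc_bits xs] (P ! ip_f) Q \<longleftrightarrow> Q (enc_bool (ip (val ws) (val xs))) t1"
      "t1 \<le> 40 * length ws + 20" using returnsE[OF ip[of ws xs]] by blast
    obtain t2 where t2: "\<And>Q. wp P [enc_bits (tl ws), enc_bits xs] (P ! ip_f) Q \<longleftrightarrow> Q (enc_bool (ip (val ws div 2) (val xs))) t2"
      "t2 \<le> 40 * length (tl ws) + 20" using returnsE[OF ip[of "tl ws" xs]] unfolding val_tl by blast
    obtain t3 where t3: "\<And>Q. wp P [enc_bits ws, enc_bits (tl xs)] (P ! ip_f) Q \<longleftrightarrow> Q (enc_bool (ip (val ws) (val xs div 2))) t3"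
      "t3 \<le> 40 * length ws + 20" using returnsE[OF ip[of ws "tl xs"]] unfolding val_tl by blast
    obtain t4 where t4: "\<And>Q. wp P [enc_bits ws, enc_bits ?hs] (P ! xor_f) Q \<longleftrightarrow> Q (enc_bits (xor_list ws ?hs)) t4"
      "t4 \<le> 40 * length ws + 20" using returnsE[OF xor[of ws ?hs]] by blast
    obtain t5 where t5: "\<And>Q. wp P [enc_bits ws, enc_bits (tl ?hs)] (P ! xor_f) Q \<longleftrightarrow> Q (enc_bits (xor_list ws (tl ?hs))) t5"
      "t5 \<le> 40 * length ws + 20" using returnsE[OF xor[of ws "tl ?hs"]] by blast
    obtain t6 where t6: "\<And>Q. wp P [enc_bits (xor_list ws ?hs), enc_bits xs] (P ! ip_f) Q \<longleftrightarrow>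
        Q (enc_bool (ip (val ws XOR h) (val xs))) t6"
      "t6 \<le> 40 * length (xor_list ws ?hs) + 20"
      using returnsE[OF ip[of "xor_list ws ?hs" xs]] unfolding val_xor_list val_bits by blast
    obtain t7 where t7: "\<And>Q. wp P [enc_bits (xor_list ws (tl ?hs)), enc_bits xs] (P ! ip_f) Q \<longleftrightarrow>
        Q (enc_bool (ip (val ws XOR (h div 2)) (val xs))) t7"
      "t7 \<le> 40 * length (xor_list ws (tl ?hs)) + 20"
      using returnsE[OF ip[of "xor_list ws (tl ?hs)" xs]] unfolding val_xor_list val_tl val_bits by blast
    note t = t1(1) t2(1) t3(1) t4(1) t5(1) t6(1) t7(1)
    have bounds: "t1 \<le> 40 * length ws + 20" "t2 \<le> 40 * length ws + 20" "t3 \<le> 40 * length ws + 20"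
      "t4 \<le> 40 * length ws + 20" "t5 \<le> 40 * length ws + 20"
      "t6 \<le> 40 * (length ws + length ?hs) + 20" "t7 \<le> 40 * (length ws + length ?hs) + 20"
      using t1(2) t2(2) t3(2) t4(2) t5(2) t6(2) t7(2) length_xor_list[of ws ?hs] length_xor_list[of ws "tl ?hs"]
      by simp_all
    show ?thesis
      apply (rule returnsI, subst f(2), unfold block_adj_body_def Let_def)
      apply (rule wp_switch[of _ _ h'], simp, simp)
      subgoal
        apply (rule wp_switch[of _ _ h], simp, simp)
        using ip_f(1) bounds by (simp_all add: wp_simps t block_adj_def block_row_def)
      subgoal
        apply (rule wp_switch[of _ _ h], simp, simp)
        using ip_f(1) xor_f(1) bounds by (auto simp add: wp_simps t block_adj_def block_row_def enc_bool_if)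
      subgoal
        apply (rule wp_switch[of _ _ h], simp, simp)
        using ip_f(1) xor_f(1) bounds by (auto simp add: wp_simps t block_adj_def block_row_def enc_bool_if)
      subgoal using h' by simp
      done
  qed
  show ?thesis
  proof (cases "h' \<in> {1, 2, 3}")
    case True
    show ?thesis by (rule returns_mono[OF small[OF True]]) simp
  next
    case h': False
    show ?thesis
    proof (cases "h \<in> {1, 2, 3}")
      case True
      obtain t where t: "\<And>Q. wp P [enc_bits (bits h'), enc_bits xs, enc_bits (bits h), enc_bits ws] (P ! f) Q \<longleftrightarrow>
          Q (enc_bool (block_adj h' (val xs) h (val ws))) t"
        "t \<le> 100 * (length (bits h') + length xs) + 130"
        using returnsE[OF small[OF True, of h' xs ws]] by blast
      have swap: "wp P [enc_bits (bits h), enc_bits ws, enc_bits (bits h'), enc_bits xs]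
          (Call f [Var 2, Var 3, Var 0, Var 1])
          (\<lambda>v t'. v = enc_bool (block_adj h (val ws) h' (val xs)) \<and>
            t1 + (t2 + t') \<le> 100 * (length (bits h) + length ws + length (bits h') + length xs) + 200)"
        if "t1 \<le> 15" "t2 \<le> 15" for t1 t2
        using that f(1) t(2) by (simp add: wp_simps t(1) block_adj_commute[of h'])
      show ?thesis
        apply (rule returnsI, subst f(2), unfold block_adj_body_def Let_def)
        apply (rule wp_switch[of _ _ h'], simp, simp)
        subgoal using h' by simp
        subgoal using h' by simp
        subgoal using h' by simp
        subgoal
          apply (rule wp_switch[of _ _ h], simp, simp)
          subgoal by (rule swap)
          subgoal by (rule swap)
          subgoal by (rule swap)
          subgoal using True by simp
          done
        done
    next
      case False
      show ?thesis
        apply (rule returnsI, subst f(2), unfold block_adj_body_def Let_def)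
        apply (rule wp_switch[of _ _ h'], simp, simp)
        subgoal using h' by simp
        subgoal using h' by simp
        subgoal using h' by simp
        subgoal
          apply (rule wp_switch[of _ _ h], simp, simp)
          using False h' by (simp_all add: wp_simps block_adj_def)
        done
    qed
  qed
qed

text \<open>Removing four bits of \<open>n\<close> leaves a list of length \<open>dim n\<close>, the
  unary counter for splitting the labels. Equal labels are rejected separately because
  \<open>block_adj\<close> has loops.\<close>

definition adj_prog :: program where
  "adj_prog =
     [Let_In (Tl (Tl (Tl (Tl (Hd (Var 0))))))
        (If_Node (Call 2 [Hd (Tl (Var 1)), Hd (Tl (Tl (Var 1)))])
          Const_Leaf
          (Call 5
            [Call 4 [Var 0, Hd (Tl (Var 1))], Call 3 [Var 0, Hd (Tl (Var 1))],
             Call 4 [Var 0, Hd (Tl (Tl (Var 1)))], Call 3 [Var 0, Hd (Tl (Tl (Var 1)))]])),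
      xor_body 1, eq_body 2, low_body 3, high_body 4, block_adj_body 5 6 1, ip_body 6]"

lemma adj_prog_returns:
  assumes "u \<le> n" "v \<le> n"
  shows "returns adj_prog 0 [enc_list enc_nat [n, u, v]] (enc_bool (label_adj (dim n) u v))
    (700 * length (bits n) + 1000)"
proof -
  let ?P = adj_prog
  let ?ns = "drop 4 (bits n)"
  let ?k = "dim n"
  have len: "length ?P = 7" by (simp add: adj_prog_def)
  have nth: "?P ! 1 = xor_body 1" "?P ! 2 = eq_body 2" "?P ! 3 = low_body 3" "?P ! 4 = high_body 4"
    "?P ! 5 = block_adj_body 5 6 1" "?P ! 6 = ip_body 6"
    by (simp_all add: adj_prog_def)
  have k: "length ?ns = ?k" by (simp add: dim_def)
  have le: "?k \<le> length (bits n)" "length (bits u) \<le> length (bits n)" "length (bits v) \<le> length (bits n)"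
    using assms by (simp_all add: dim_def length_bits_mono)
  have eq_ret: "returns ?P 2 [a, b] (enc_bool (a = b)) (50 * size a + 20)" for a b
    using eq_returns[of 2 ?P] len nth by simp
  obtain t1 where t1: "\<And>Q. wp ?P [enc_bits (bits u), enc_bits (bits v)] (?P ! 2) Q \<longleftrightarrow>
      Q (enc_bool (enc_bits (bits u) = enc_bits (bits v))) t1" "t1 \<le> 50 * size (enc_bits (bits u)) + 20"
    using returnsE[OF eq_ret] by blast
  have low: "returns ?P 3 [enc_bits ?ns, enc_bits (bits w)] (enc_bits (take_pad ?k (bits w))) (30 * ?k + 20)" for w
    using low_returns[of 3 ?P ?ns "bits w"] len nth k by simp
  obtain t2 where t2: "\<And>Q. wp ?P [enc_bits ?ns, enc_bits (bits u)] (?P ! 3) Q \<longleftrightarrow> Q (enc_bits (take_pad ?k (bits u))) t2"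
    "t2 \<le> 30 * ?k + 20" using returnsE[OF low] by blast
  obtain t3 where t3: "\<And>Q. wp ?P [enc_bits ?ns, enc_bits (bits v)] (?P ! 3) Q \<longleftrightarrow> Q (enc_bits (take_pad ?k (bits v))) t3"
    "t3 \<le> 30 * ?k + 20" using returnsE[OF low] by blast
  have high: "returns ?P 4 [enc_bits ?ns, enc_bits (bits w)] (enc_bits (bits (w div 2 ^ ?k))) (30 * ?k + 20)" for w
    using high_returns[of 4 ?P ?ns "bits w"] len nth k by (simp add: drop_bits)
  obtain t4 where t4: "\<And>Q. wp ?P [enc_bits ?ns, enc_bits (bits u)] (?P ! 4) Q \<longleftrightarrow> Q (enc_bits (bits (u div 2 ^ ?k))) t4"
    "t4 \<le> 30 * ?k + 20" using returnsE[OF high] by blast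
  obtain t5 where t5: "\<And>Q. wp ?P [enc_bits ?ns, enc_bits (bits v)] (?P ! 4) Q \<longleftrightarrow> Q (enc_bits (bits (v div 2 ^ ?k))) t5"
    "t5 \<le> 30 * ?k + 20" using returnsE[OF high] by blast
  have "returns ?P 5 [enc_bits (bits (u div 2 ^ ?k)), enc_bits (take_pad ?k (bits u)),
      enc_bits (bits (v div 2 ^ ?k)), enc_bits (take_pad ?k (bits v))]
    (enc_bool (block_adj (u div 2 ^ ?k) (u mod 2 ^ ?k) (v div 2 ^ ?k) (v mod 2 ^ ?k)))
    (100 * (length (bits (u div 2 ^ ?k)) + ?k + length (bits (v div 2 ^ ?k)) + ?k) + 200)"
    using block_adj_returns[of 5 ?P 6 1 "u div 2 ^ ?k" "take_pad ?k (bits u)" "v div 2 ^ ?k" "take_pad ?k (bits v)"] len nth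
    by (simp add: val_take_pad)
  then obtain t6 where t6: "\<And>Q. wp ?P [enc_bits (bits (u div 2 ^ ?k)), enc_bits (take_pad ?k (bits u)),
      enc_bits (bits (v div 2 ^ ?k)), enc_bits (take_pad ?k (bits v))] (?P ! 5) Q \<longleftrightarrow>
      Q (enc_bool (block_adj (u div 2 ^ ?k) (u mod 2 ^ ?k) (v div 2 ^ ?k) (v mod 2 ^ ?k))) t6"
    "t6 \<le> 100 * (length (bits (u div 2 ^ ?k)) + ?k + length (bits (v div 2 ^ ?k)) + ?k) + 200"
    using returnsE by blast
  note t = t1(1) t2(1) t3(1) t4(1) t5(1) t6(1)
  have "length (bits (w div 2 ^ ?k)) \<le> length (bits w)" for w
    by (rule length_bits_mono) simp
  then have "length (bits (u div 2 ^ ?k)) \<le> length (bits n)" "length (bits (v div 2 ^ ?k)) \<le> length (bits n)"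
    using le(2,3) order_trans by blast+
  then have "length (bits (u div 2 ^ ?k)) + ?k + length (bits (v div 2 ^ ?k)) + ?k \<le> 4 * length (bits n)"
    using le(1) by simp
  then have "t6 \<le> 400 * length (bits n) + 200" using t6(2) by simp
  then have
    bounds: "t1 \<le> 100 * length (bits n) + 20" "t2 \<le> 30 * length (bits n) + 20" "t3 \<le> 30 * length (bits n) + 20"
    "t4 \<le> 30 * length (bits n) + 20" "t5 \<le> 30 * length (bits n) + 20" "t6 \<le> 400 * length (bits n) + 200"
    using t1(2) t2(2) t3(2) t4(2) t5(2) le size_enc_bits_le[of "bits u"]
    by linarith+
  have ns: "tl (tl (tl (tl (bits n)))) = ?ns"
    by (simp add: drop_Suc numeral_eq_Suc)
  have "?P ! 0 = Let_In (Tl (Tl (Tl (Tl (Hd (Var 0))))))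
        (If_Node (Call 2 [Hd (Tl (Var 1)), Hd (Tl (Tl (Var 1)))])
          Const_Leaf
          (Call 5
            [Call 4 [Var 0, Hd (Tl (Var 1))], Call 3 [Var 0, Hd (Tl (Var 1))],
             Call 4 [Var 0, Hd (Tl (Tl (Var 1)))], Call 3 [Var 0, Hd (Tl (Tl (Var 1)))]]))"
    by (simp add: adj_prog_def)
  then show ?thesis
    by (intro returnsI) (use bounds in \<open>simp add: wp_simps len t enc_nat_def' ns enc_bits_bits_inject label_adj_def\<close>)
qed

lemma polylog_time_block_graph: "polylog_time_adjacency block_graph"
  unfolding polylog_time_adjacency_def
\<comment> \<open>The cost is \<open>700 * L + 1000\<close> for the bit length \<open>L\<close> of
  \<open>n\<close>, and \<open>L\<close> is at most \<open>1 + log 2 n\<close>.\<close>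
proof (intro exI[of _ adj_prog] exI[of _ "[:1700, 700:]"] allI ballI)
  fix n u v :: nat assume uv: "u \<in> {1..n}" "v \<in> {1..n}"
  then have n: "n \<noteq> 0" by auto
  have "real (2 ^ length (bits n)) \<le> real (2 * n)"
    using two_power_length_bits(2)[OF n] by (simp only: of_nat_le_iff)
  then have "2 ^ length (bits n) \<le> 2 * real n" by simp
  then have "log 2 (2 ^ length (bits n)) \<le> log 2 (2 * real n)" using n by (subst log_le_cancel_iff) auto
  then have "real (length (bits n)) \<le> 1 + log 2 (real n)" using n by (simp add: log_mult)
  then show "computes_within adj_prog (enc_list enc_nat [n, u, v]) (enc_bool ({u, v} \<in> block_graph n))
      (poly [:1700, 700:] (log 2 (real n)))"
    using adj_prog_returns[of u n v] uv
    by (intro returns_computes_within) (auto simp: in_block_graph_iff adj_prog_def)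
qed

section \<open>First-order definability of the labels\<close>

text \<open>Variables are de Bruijn indices into the environment.\<close>

datatype fm = Adj nat nat | Eq nat nat | Neg fm | Conj fm fm | All fm

fun sat :: "('a \<Rightarrow> 'a \<Rightarrow> bool) \<Rightarrow> 'a set \<Rightarrow> 'a list \<Rightarrow> fm \<Rightarrow> bool" where
  "sat R U env (Adj i j) = R (env ! i) (env ! j)"
| "sat R U env (Eq i j) = (env ! i = env ! j)"
| "sat R U env (Neg f) = (\<not> sat R U env f)"
| "sat R U env (Conj f g) = (sat R U env f \<and> sat R U env g)"
| "sat R U env (All f) = (\<forall>x\<in>U. sat R U (x # env) f)"

fun scoped :: "nat \<Rightarrow> fm \<Rightarrow> bool" where
  "scoped n (Adj i j) = (i < n \<and> j < n)"
| "scoped n (Eq i j) = (i < n \<and> j < n)"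
| "scoped n (Neg f) = scoped n f"
| "scoped n (Conj f g) = (scoped n f \<and> scoped n g)"
| "scoped n (All f) = scoped (Suc n) f"

definition Disj :: "fm \<Rightarrow> fm \<Rightarrow> fm" where "Disj f g = Neg (Conj (Neg f) (Neg g))"
definition Imp :: "fm \<Rightarrow> fm \<Rightarrow> fm" where "Imp f g = Neg (Conj f (Neg g))"
definition Xor :: "fm \<Rightarrow> fm \<Rightarrow> fm" where "Xor f g = Conj (Disj f g) (Neg (Conj f g))"
definition Exi :: "fm \<Rightarrow> fm" where "Exi f = Neg (All (Neg f))"

lemma sat_derived [simp]:
  "sat R U env (Disj f g) = (sat R U env f \<or> sat R U env g)"
  "sat R U env (Imp f g) = (sat R U env f \<longrightarrow> sat R U env g)"
  "sat R U env (Xor f g) = (sat R U env f \<noteq> sat R U env g)"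
  "sat R U env (Exi f) = (\<exists>x\<in>U. sat R U (x # env) f)"
  by (auto simp: Disj_def Imp_def Xor_def Exi_def)

lemma scoped_derived [simp]:
  "scoped n (Disj f g) = (scoped n f \<and> scoped n g)"
  "scoped n (Imp f g) = (scoped n f \<and> scoped n g)"
  "scoped n (Xor f g) = (scoped n f \<and> scoped n g)"
  "scoped n (Exi f) = scoped (Suc n) f"
  by (auto simp: Disj_def Imp_def Xor_def Exi_def)

text \<open>Truth of formulas is invariant under isomorphism. This is why a formula that defines a
  label finds its preimage in an arbitrary copy of the graph.\<close>

lemma sat_bij:
  assumes bij: "bij_betw \<phi> U W"
    and R: "\<And>u v. u \<in> U \<Longrightarrow> v \<in> U \<Longrightarrow> R u v \<longleftrightarrow> R' (\<phi> u) (\<phi> v)"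
  shows "set env \<subseteq> U \<Longrightarrow> scoped (length env) f \<Longrightarrow> sat R U env f \<longleftrightarrow> sat R' W (map \<phi> env) f"
proof (induction f arbitrary: env)
  case (Adj i j)
  then have "env ! i \<in> U" "env ! j \<in> U" by (auto dest: nth_mem)
  then show ?case using Adj R by simp
next
  case (Eq i j)
  then have "env ! i \<in> U" "env ! j \<in> U" by (auto dest: nth_mem)
  then show ?case using Eq inj_on_eq_iff[OF bij_betw_imp_inj_on[OF bij]] by simp
next
  case (All f)
  have "sat R U (x # env) f \<longleftrightarrow> sat R' W (\<phi> x # map \<phi> env) f" if "x \<in> U" for x
    using All.IH[of "x # env"] All.prems that by simp
  moreover have "W = \<phi> ` U" using bij by (simp add: bij_betw_def)
  ultimately show ?case by simp
qed auto

text \<open>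
  In a copy of the graph, let \<open>p\<close>, \<open>s\<close>, \<open>t\<close> be the vertices with labels \<open>q\<close>, \<open>2q\<close>, \<open>3q\<close> (zero vectors of the
  blocks 1, 2, 3). The closed neighbourhood of \<open>p\<close> is block 1 and the neighbourhood of \<open>t\<close> is block 2,
  and block 3 consists of the other neighbours of \<open>s\<close>.
\<close>

definition in1 :: "nat \<Rightarrow> nat \<Rightarrow> fm" where "in1 p u = Disj (Eq u p) (Adj u p)"
definition in2 :: "nat \<Rightarrow> nat \<Rightarrow> fm" where "in2 t u = Adj u t"
definition in3 :: "nat \<Rightarrow> nat \<Rightarrow> nat \<Rightarrow> fm" where "in3 s t u = Conj (Adj u s) (Neg (Adj u t))"

text \<open>Defines \<open>q\<close>, whose neighbours are exactly the rest of the clique on block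
  1; every other vertex has two distinct nonadjacent neighbours.\<close>

definition clique_fm :: fm where
  "clique_fm = All (All (Imp (Conj (Adj 2 1) (Adj 2 0)) (Disj (Eq 1 0) (Adj 1 0))))"

text \<open>A vector orthogonal to all of block 1 is zero, so this describes the zero vectors of the
  blocks other than 1. The indices are shifted by \<open>Suc\<close> below the quantifier.\<close>

definition zero_fm :: "nat \<Rightarrow> nat \<Rightarrow> fm" where
  "zero_fm p u = Conj (Neg (in1 p u)) (All (Imp (in1 (Suc p) 0) (Neg (Adj (Suc u) 0))))"

text \<open>The only edge between such zero vectors joins \<open>2 * q\<close> and
  \<open>3 * q\<close>. The final conjunct orients it: the neighbours of \<open>3 * q\<close> form
  block 2 and lie in the closed neighbourhood of \<open>2 * q\<close>, but not conversely.\<close>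

definition zero_edge_fm :: fm where
  "zero_edge_fm = Conj (zero_fm 2 1) (Conj (zero_fm 2 0) (Conj (Adj 1 0)
     (All (Imp (Adj 0 1) (Disj (Eq 0 2) (Adj 0 2))))))"

text \<open>Joined to all of block 2 means annihilated by \<open>div 2\<close>, and the only nonzero
  such vector is 1.\<close>

definition first3_fm :: fm where
  "first3_fm = Conj (in3 2 1 0) (Conj (Neg (Eq 0 1)) (All (Imp (in2 2 0) (Adj 1 0))))"

text \<open>Carries the vector 1 from block 3 to block 2 by comparing the adjacencies to block
  1.\<close>

definition first2_fm :: fm where
  "first2_fm = Conj (in2 2 0) (All (Imp (in1 5 0) (Neg (Xor (Adj 1 0) (Adj 2 0)))))"

text \<open>Carries a vector from block 2 to block 1. The adjacencies to block 2 are opposite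
  because the form inside block 2 is negated; the vertex itself is excepted because it has no
  loop.\<close>

definition to1_fm :: fm where
  "to1_fm = Conj (in1 4 0) (All (Imp (Conj (in2 3 0) (Neg (Eq 0 2))) (Xor (Adj 1 0) (Adj 2 0))))"

text \<open>Doubling is the adjoint of \<open>div 2\<close>: \<open>ip c (z div 2)\<close> is
  \<open>ip (2 * c) z\<close>, and the negation in the form between blocks 2 and 3 again makes the
  adjacencies opposite.\<close>

definition double_fm :: fm where
  "double_fm = Conj (in1 4 0) (All (Imp (in3 4 3 0) (Xor (Adj 1 0) (Adj 2 0))))"

text \<open>The converse of \<open>to1_fm\<close>; now the exception is the vertex that is sought,
  variable 1 below the quantifier.\<close>

definition to2_fm :: fm where
  "to2_fm = Conj (in2 2 0) (All (Imp (Conj (in2 3 0) (Neg (Eq 0 1))) (Xor (Adj 2 0) (Adj 1 0))))"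

text \<open>Variables 1 and 2 are the same unit vector in blocks 1 and 2. Block 1 is a clique and
  shows nothing about its own bits, so its vertices are tested against block 2.\<close>

definition bit_fm :: fm where
  "bit_fm = Disj (Conj (in1 5 0) (Adj 0 2)) (Conj (Neg (in1 5 0)) (Adj 0 1))"

text \<open>Outside the blocks 1, 2, 3, adjacency to the unit vector reads bit \<open>j\<close> of
  \<open>w\<close> in block 1 and of \<open>w XOR h\<close> in block 2; their difference is bit
  \<open>j\<close> of \<open>h\<close>. The bits of the numbers 1, 2, 3 are tabulated, the last
  alternative being false.\<close>

definition block_bit_fm :: "nat \<Rightarrow> fm" where
  "block_bit_fm j = Disj
     (Conj (Neg (Disj (in1 5 0) (Disj (in2 3 0) (in3 4 3 0)))) (Xor (Adj 0 1) (Adj 0 2)))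
     (if j = 0 then Disj (in1 5 0) (in3 4 3 0)
      else if j = 1 then Disj (in2 3 0) (in3 4 3 0) else Neg (Eq 0 0))"

lemmas fm_defs = in1_def in2_def in3_def clique_fm_def zero_fm_def zero_edge_fm_def first3_fm_def
  first2_fm_def to1_fm_def double_fm_def to2_fm_def bit_fm_def block_bit_fm_def

lemma ip_two_power: "ip w (2 ^ i) \<longleftrightarrow> odd (w div 2 ^ i)"
proof (induction i arbitrary: w)
  case (Suc i)
  have "ip w (2 ^ Suc i) = ip (2 * 2 ^ i) w" by (subst ip_commute) simp
  also have "\<dots> = ip (2 ^ i) (w div 2)" by (rule ip_double)
  also have "\<dots> = ip (w div 2) (2 ^ i)" by (rule ip_commute)
  finally show ?case using Suc by (simp add: div_mult2_eq)
qed (simp add: ip_1)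

section \<open>Correctness of the defining formulas\<close>

context block_graph_params
begin

lemma two_less_q: "2 < q" "3 < q" "1 < q" using q_ge by simp_all

lemma ball_block:
  assumes "c \<in> {1, 2, 3}"
  shows "(\<forall>v\<in>V. v div q = c \<longrightarrow> F v) \<longleftrightarrow> (\<forall>x<q. F (c * q + x))"
proof
  assume *: "\<forall>v\<in>V. v div q = c \<longrightarrow> F v"
  have "c \<in> {1..7}" using assms by auto
  then show "\<forall>x<q. F (c * q + x)" using * label_in_V by simp
next
  assume *: "\<forall>x<q. F (c * q + x)"
  show "\<forall>v\<in>V. v div q = c \<longrightarrow> F v"
  proof (intro ballI impI)
    fix v assume "v \<in> V" "v div q = c"
    then show "F v" using *[rule_format, of "v mod q"] by (metis div_mult_mod_eq mod_less_divisor q_pos)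
  qed
qed

lemma zero_labels: "q \<in> V" "2 * q \<in> V" "3 * q \<in> V" "0 \<notin> V"
  using n_bounds q_ge by (simp_all add: V_def)

lemma in1_iff: "u = q \<or> A u q \<longleftrightarrow> u div q = 1"
proof -
  have "u = q \<Longrightarrow> u div q = 1" by simp
  moreover have "A u q \<longleftrightarrow> u \<noteq> q \<and> u div q = 1"
    by (simp add: A_iff[of u q] block_adj_def block_row_def)
  ultimately show ?thesis by blast
qed

lemma in2_iff: "A u (3 * q) \<longleftrightarrow> u div q = 2"
  by (auto simp: A_iff[of u "3 * q"] block_adj_def block_row_def)

lemma adj_2q_iff: "A u (2 * q) \<longleftrightarrow> u \<noteq> 2 * q \<and> (u div q = 2 \<or> u div q = 3)"
  by (auto simp: A_iff[of u "2 * q"] block_adj_def block_row_def)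

lemma in3_iff: "A u (2 * q) \<and> \<not> A u (3 * q) \<longleftrightarrow> u div q = 3"
  unfolding in2_iff adj_2q_iff by auto

lemma two_ip:
  assumes "c < q" "c \<noteq> 0"
  obtains x y where "x < q" "y < q" "x \<noteq> y" "ip c x" "ip c y"
proof -
  have "\<not> card {x. x < q \<and> ip c x} \<le> Suc 0"
    using card_ip_r(1)[OF assms] q_eq q_ge by simp
  then show thesis using that by (subst (asm) card_le_Suc0_iff_eq) auto
qed

text \<open>If a vector at which \<open>b\<close> holds and one at which \<open>b\<close> and
  \<open>x\<close> differ both fail to separate, their sum does.\<close>

lemma separating:
  assumes "b < q" "b \<noteq> 0" "x < q" "x \<noteq> b"
  obtains y where "y < q" "ip b y" "\<not> ip x y"
proof -
  have bk: "b < 2 ^ k" "x < 2 ^ k" using assms by (simp_all add: q_def)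
  obtain y1 where y1: "y1 < q" "ip b y1"
    using ip_nondegenerate[OF assms(2) bk(1)] by (auto simp: q_def)
  obtain y2 where y2: "y2 < q" "ip b y2 \<noteq> ip x y2"
    using ip_eqI[of k b x] bk assms(4) by (auto simp: q_def)
  show thesis
  proof (cases "ip x y1 \<and> \<not> ip b y2")
    case True
    then show thesis using that[of "y1 XOR y2"] y1 y2 xor_less_q by (simp add: ip_xor_right)
  next
    case False
    then show thesis using that y1 y2 by blast
  qed
qed

text \<open>Distinct functionals differ at \<open>r > 1\<close> vectors, so a single exception is
  harmless. The exception is the missing loop in \<open>to1_fm\<close> and
  \<open>to2_fm\<close>.\<close>

lemma ip_eqI_except:
  assumes "\<And>y. y < q \<Longrightarrow> y \<noteq> c \<Longrightarrow> ip a y = ip b y" "a < q" "b < q"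
  shows "a = b"
proof (rule ccontr)
  assume "a \<noteq> b"
  then have "r = card {y. y < q \<and> ip a y \<noteq> ip b y}" using card_ip_neq_r assms by simp
  also have "\<dots> \<le> card {c}" by (rule card_mono) (use assms in auto)
  finally show False using q_eq q_ge by simp
qed

lemma A_blocks:
  assumes "x < q" "y < q"
  shows "A (q + x) (q + y) \<longleftrightarrow> x \<noteq> y" "A (q + x) (2 * q + y) \<longleftrightarrow> ip x y"
    "A (2 * q + y) (q + x) \<longleftrightarrow> ip x y"
    "A (q + x) (3 * q + y) \<longleftrightarrow> ip x y" "A (3 * q + y) (q + x) \<longleftrightarrow> ip x y"
    "A (2 * q + x) (2 * q + y) \<longleftrightarrow> x \<noteq> y \<and> \<not> ip x y"
    "A (2 * q + x) (3 * q + y) \<longleftrightarrow> \<not> ip x (y div 2)"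
    "A (3 * q + y) (2 * q + x) \<longleftrightarrow> \<not> ip x (y div 2)"
    "\<not> A (3 * q + x) (3 * q + y)"
  using A_label[OF assms, of 1 1] A_label[OF assms, of 1 2] A_label[OF assms, of 1 3]
    A_label[OF assms, of 2 2] A_label[OF assms, of 2 3] A_label[OF assms, of 3 3]
    A_commute[of "2 * q + y" "q + x"] A_commute[of "3 * q + y" "q + x"] A_commute[of "3 * q + y" "2 * q + x"]
  by (auto simp: block_adj_def block_row_def)

lemma A_rest:
  assumes "h \<notin> {1, 2, 3}" "w < q" "x < q"
  shows "A (h * q + w) (q + x) \<longleftrightarrow> ip w x" "A (h * q + w) (2 * q + x) \<longleftrightarrow> ip (w XOR h) x"
    "A (h * q + w) (3 * q + x) \<longleftrightarrow> ip (w XOR (h div 2)) x"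
  using A_label[OF assms(2,3), of h 1] A_label[OF assms(2,3), of h 2] A_label[OF assms(2,3), of h 3] assms(1)
  by (auto simp: block_adj_def block_row_def)

lemma label_cases:
  assumes "u \<in> V"
  obtains w where "u = q + w" "w < q" | w where "u = 2 * q + w" "w < q" | w where "u = 3 * q + w" "w < q"
    | h w where "u = h * q + w" "w < q" "h \<notin> {1, 2, 3}" "h < 16"
proof -
  obtain h w where u: "u = h * q + w" "w < q" by (metis div_mult_mod_eq mod_less_divisor q_pos)
  moreover have "h < 16" using block_less_16[OF assms] u by simp
  moreover consider "h = 1" | "h = 2" | "h = 3" | "h \<notin> {1, 2, 3}" by auto
  ultimately show thesis using that by (metis mult_1)
qed

lemma in_V: "x < q \<Longrightarrow> q + x \<in> V" "x < q \<Longrightarrow> 2 * q + x \<in> V" "x < q \<Longrightarrow> 3 * q + x \<in> V"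
  using label_in_V[of 1] label_in_V[of 2] label_in_V[of 3] by simp_all

lemma div_labels: "x < q \<Longrightarrow> (q + x) div q = 1" "x < q \<Longrightarrow> (2 * q + x) div q = 2" "x < q \<Longrightarrow> (3 * q + x) div q = 3"
  by simp_all

lemma sat_clique:
  assumes "u \<in> V"
  shows "sat A V [u] clique_fm \<longleftrightarrow> u = q"
proof -
  have sat: "sat A V [u] clique_fm \<longleftrightarrow> (\<forall>a\<in>V. \<forall>b\<in>V. A u a \<and> A u b \<longrightarrow> a = b \<or> A a b)"
    by (simp add: fm_defs)
  show ?thesis
  proof
    assume "u = q"
    show "sat A V [u] clique_fm"
      unfolding sat
    proof (intro ballI impI)
      fix a b assume ab: "a \<in> V" "b \<in> V" "A u a \<and> A u b"
      then have "a div q = 1" "b div q = 1" using \<open>u = q\<close> in1_iff A_commute by blast+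
      then show "a = b \<or> A a b" by (simp add: A_iff block_adj_def block_row_def)
    qed
  next
    assume s: "sat A V [u] clique_fm"
    show "u = q"
    proof (rule ccontr)
      assume "u \<noteq> q"
      have "\<exists>a\<in>V. \<exists>b\<in>V. A u a \<and> A u b \<and> a \<noteq> b \<and> \<not> A a b"
        using assms
      proof (cases rule: label_cases)
        case (1 w)
        then have "w \<noteq> 0" "w < 2 ^ k" using \<open>u \<noteq> q\<close> by (auto simp: q_def)
        then obtain z where z: "z < q" "ip w z" using ip_nondegenerate by (auto simp: q_def)
        have "A u (q + 0)" "A u (3 * q + z)" "\<not> A (q + 0) (3 * q + z)"
          unfolding 1 using A_blocks(1)[of w 0] A_blocks(4)[of w z] A_blocks(4)[of 0 z] z 1 \<open>w \<noteq> 0\<close> q_pos by simp_all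
        then show ?thesis using in_V z q_pos by force
      next
        case (2 w)
        have "A u (3 * q + 0)" "A u (3 * q + 1)" "\<not> A (3 * q + 0) (3 * q + 1)"
          unfolding 2 using A_blocks(7)[of w 0] A_blocks(7)[of w 1] A_blocks(9)[of 0 1] 2 two_less_q by simp_all
        then show ?thesis using in_V(3)[of 0] in_V(3)[of 1] two_less_q by force
      next
        case (3 w)
        show ?thesis
        proof (cases "w = 0")
          case True
          have "ip 1 3" using ip_1(1)[of 3] by simp
          then have "A u (2 * q + 1)" "A u (2 * q + 3)" "\<not> A (2 * q + 1) (2 * q + 3)"
            unfolding 3 True using A_blocks(8)[of 1 0] A_blocks(8)[of 3 0] A_blocks(6)[of 1 3] two_less_q by simp_all
          then show ?thesis using in_V(2)[of 1] in_V(2)[of 3] two_less_q by force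
        next
          case False
          then have "w \<noteq> 0" "w < 2 ^ k" using 3 by (auto simp: q_def)
          then obtain x where x: "x < q" "ip w x" using ip_nondegenerate by (auto simp: q_def)
          have "A u (q + x)" "A u (2 * q + 0)" "\<not> A (q + x) (2 * q + 0)"
            unfolding 3 using A_blocks(5)[of x w] A_blocks(8)[of 0 w] A_blocks(2)[of x 0] x 3 ip_commute[of w x] by simp_all
          then show ?thesis using in_V(1)[of x] in_V(2)[of 0] x q_pos by force
        qed
      next
        case (4 h w)
        show ?thesis
        proof (cases "w XOR (h div 2) = 0")
          case False
          moreover have "w XOR (h div 2) < q" using xor_less_q 4 q_ge by simp
          ultimately obtain x y where xy: "x < q" "y < q" "x \<noteq> y" "ip (w XOR (h div 2)) x" "ip (w XOR (h div 2)) y"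
            using two_ip by blast
          \<comment> \<open>Two neighbours in block 3, which has no inner edges.\<close>
          have "A u (3 * q + x)" "A u (3 * q + y)" "\<not> A (3 * q + x) (3 * q + y)"
            unfolding 4 using A_blocks(9)[OF xy(1,2)] A_rest(3)[OF 4(3,2) xy(1)] A_rest(3)[OF 4(3,2) xy(2)] xy(4,5) by blast+
          moreover have "3 * q + x \<noteq> 3 * q + y" using xy by simp
          ultimately show ?thesis using in_V(3)[OF xy(1)] in_V(3)[OF xy(2)] by blast
        next
          case True
          then have wh: "w = h div 2" by (metis xor.assoc xor.left_neutral xor_self_eq)
          have h: "h \<noteq> 0" using assms zero_labels(4) unfolding 4(1) wh by (cases "h = 0") auto
          then have w: "w \<noteq> 0" "w \<noteq> h" using wh 4(3) by auto
          have b: "w XOR h \<noteq> 0" "w XOR h < q"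
            using w(2) xor_less_q 4 q_ge by (metis xor.assoc xor.left_neutral xor_self_eq, simp)
          \<comment> \<open>With no neighbour in block 3, both the functional \<open>w\<close> for
            block 1 and \<open>w XOR h\<close> for block 2 are nonzero. Choosing \<open>x\<close>
            different from \<open>w XOR h\<close> allows \<open>separating\<close> to yield a
            neighbour in block 2 that is not adjacent to the one in block 1.\<close>
          obtain x where x: "x < q" "ip w x" "x \<noteq> w XOR h" using two_ip[OF 4(2) w(1)] by metis
          obtain y where y: "y < q" "ip (w XOR h) y" "\<not> ip x y" using separating b x by metis
          have "A u (q + x)" "A u (2 * q + y)" "\<not> A (q + x) (2 * q + y)"
            unfolding 4 using A_blocks(2)[OF x(1) y(1)] A_rest(1)[OF 4(3,2) x(1)] A_rest(2)[OF 4(3,2) y(1)] x(2) y(2,3) by blast+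
          moreover have "q + x \<noteq> 2 * q + y" using x by simp
          ultimately show ?thesis using in_V(1)[OF x(1)] in_V(2)[OF y(1)] by blast
        qed
      qed
      then show False using s unfolding sat by blast
    qed
  qed
qed

lemma zero_iff:
  assumes "u \<in> V"
  shows "\<not> (u = q \<or> A u q) \<and> (\<forall>x\<in>V. x = q \<or> A x q \<longrightarrow> \<not> A u x) \<longleftrightarrow> u div q \<noteq> 1 \<and> u mod q = 0"
proof -
  have "(\<forall>x<q. \<not> A u (q + x)) \<longleftrightarrow> u mod q = 0" if "u div q \<noteq> 1"
  proof -
    have ip0: "(\<forall>x<q. \<not> ip x w) \<longleftrightarrow> w = 0" if "w < q" for w
      using ip_nondegenerate[of w k] that ip_commute by (auto simp: q_def)
    then have ip0': "(\<forall>x<q. \<not> ip w x) \<longleftrightarrow> w = 0" if "w < q" for w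
      using that ip_commute by auto
    from assms show ?thesis
    proof (cases rule: label_cases)
      case (4 h w)
      then show ?thesis using A_rest(1)[OF 4(3,2)] ip0'[OF 4(2)] by auto
    qed (use that A_blocks ip0 in auto)
  qed
  then show ?thesis unfolding in1_iff using ball_block[of 1 "\<lambda>x. \<not> A u x"] by auto
qed

lemma zero_edge_iff:
  assumes "s \<in> V" "t \<in> V"
  shows "sat A V [t, s, q] zero_edge_fm \<longleftrightarrow> s = 2 * q \<and> t = 3 * q"
proof -
  have sat: "sat A V [t, s, q] zero_edge_fm \<longleftrightarrow>
      (s div q \<noteq> 1 \<and> s mod q = 0) \<and> (t div q \<noteq> 1 \<and> t mod q = 0) \<and> A s t \<and> (\<forall>u\<in>V. A u t \<longrightarrow> u = s \<or> A u s)"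
    unfolding zero_iff[OF assms(1), symmetric] zero_iff[OF assms(2), symmetric] by (simp add: fm_defs)
  show ?thesis
  proof
    assume "s = 2 * q \<and> t = 3 * q"
    then show "sat A V [t, s, q] zero_edge_fm"
      unfolding sat using in2_iff adj_2q_iff by (auto simp: in2_iff adj_2q_iff)
  next
    assume "sat A V [t, s, q] zero_edge_fm"
    then have st: "s div q \<noteq> 1" "s mod q = 0" "t div q \<noteq> 1" "t mod q = 0" "A s t"
      and nb: "\<forall>u\<in>V. A u t \<longrightarrow> u = s \<or> A u s" unfolding sat by auto
    have "s div q = 2 \<and> t div q = 3 \<or> s div q = 3 \<and> t div q = 2"
      using st unfolding A_iff[of s t] block_adj_def block_row_def
      by (auto split: if_splits) (metis dvd_div_mult_self)
    then have "s = 2 * q \<and> t = 3 * q \<or> s = 3 * q \<and> t = 2 * q"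
      using st by (metis div_mult_mod_eq add.right_neutral)
    moreover have False if "s = 3 * q" "t = 2 * q"
    proof -
      have "(3 * q + 1) div q = 3" using div_labels(3)[OF two_less_q(3)] .
      then show False using nb[rule_format, OF in_V(3), of 1] two_less_q unfolding that in2_iff adj_2q_iff by simp
    qed
    ultimately show "s = 2 * q \<and> t = 3 * q" by blast
  qed
qed

lemma sat_zero_edge_2: "s \<in> V \<Longrightarrow> sat A V [s, q] (Exi zero_edge_fm) \<longleftrightarrow> s = 2 * q"
  using zero_edge_iff zero_labels by auto

lemma sat_zero_edge_3: "t \<in> V \<Longrightarrow> sat A V [t, 2 * q, q] zero_edge_fm \<longleftrightarrow> t = 3 * q"
  using zero_edge_iff zero_labels by auto

abbreviation base :: "nat list" where "base \<equiv> [3 * q, 2 * q, q]"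

lemma label_eqI: "u div q = c \<Longrightarrow> u mod q = x \<Longrightarrow> u = c * q + x"
  by (metis div_mult_mod_eq)

lemma sat_first3:
  assumes "u \<in> V"
  shows "sat A V (u # base) first3_fm \<longleftrightarrow> u = 3 * q + 1"
proof -
  have sat: "sat A V (u # base) first3_fm \<longleftrightarrow> u div q = 3 \<and> u \<noteq> 3 * q \<and> (\<forall>y<q. A u (2 * q + y))"
    by (simp add: fm_defs in2_iff ball_block in3_iff[unfolded in2_iff])
  show ?thesis
  proof
    assume "sat A V (u # base) first3_fm"
    then have u: "u div q = 3" "u \<noteq> 3 * q" "\<forall>y<q. A u (2 * q + y)" unfolding sat by auto
    define z where "z = u mod q"
    have z: "z < q" "u = 3 * q + z" using label_eqI[OF u(1)] by (simp_all add: z_def)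
    then have "\<forall>y<q. \<not> ip y (z div 2)" using u(3) A_blocks by simp
    then have "z div 2 = 0" using ip_nondegenerate[of "z div 2" k] z ip_commute
      by (metis div_le_dividend le_less_trans q_def)
    then have "z = 1" using u(2) z by (cases "z = 0") auto
    then show "u = 3 * q + 1" using z by simp
  next
    assume u: "u = 3 * q + 1"
    then show "sat A V (u # base) first3_fm"
      unfolding sat using A_blocks(8)[OF _ two_less_q(3)] div_labels(3)[OF two_less_q(3)] by simp
  qed
qed

lemma sat_first2:
  assumes "u \<in> V"
  shows "sat A V (u # (3 * q + 1) # base) first2_fm \<longleftrightarrow> u = 2 * q + 1"
proof -
  have sat: "sat A V (u # (3 * q + 1) # base) first2_fm \<longleftrightarrow>
      u div q = 2 \<and> (\<forall>x<q. A u (q + x) \<longleftrightarrow> A (3 * q + 1) (q + x))"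
    using ball_block[of 1 "\<lambda>v. A u v \<longleftrightarrow> A (3 * q + 1) v"] by (simp add: fm_defs in2_iff in1_iff[simplified])
  show ?thesis
  proof
    assume "sat A V (u # (3 * q + 1) # base) first2_fm"
    then have u: "u div q = 2" "\<forall>x<q. A u (q + x) \<longleftrightarrow> A (3 * q + 1) (q + x)" unfolding sat by auto
    define z where "z = u mod q"
    have z: "z < q" "u = 2 * q + z" using label_eqI[OF u(1)] by (simp_all add: z_def)
    then have "\<forall>x<q. ip x z = ip x 1" using u(2) A_blocks(3) A_blocks(5)[OF _ two_less_q(3)] by simp
    then have "z = 1" using ip_eqI[of k z 1] z two_less_q ip_commute by (metis q_def)
    then show "u = 2 * q + 1" using z by simp
  next
    assume u: "u = 2 * q + 1"
    then show "sat A V (u # (3 * q + 1) # base) first2_fm"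
      unfolding sat using A_blocks(3,5)[OF _ two_less_q(3)] div_labels(2)[OF two_less_q(3)] by simp
  qed
qed

lemma sat_to1:
  assumes "u \<in> V" "c < q"
  shows "sat A V (u # (2 * q + c) # base) to1_fm \<longleftrightarrow> u = q + c"
proof -
  have sat: "sat A V (u # (2 * q + c) # base) to1_fm \<longleftrightarrow>
      u div q = 1 \<and> (\<forall>y<q. y \<noteq> c \<longrightarrow> A u (2 * q + y) \<noteq> A (2 * q + c) (2 * q + y))"
    using ball_block[of 2 "\<lambda>v. v \<noteq> 2 * q + c \<longrightarrow> A u v \<noteq> A (2 * q + c) v"]
    by (auto simp add: fm_defs in2_iff in1_iff[simplified])
  show ?thesis
  proof
    assume "sat A V (u # (2 * q + c) # base) to1_fm"
    then have u: "u div q = 1" "\<forall>y<q. y \<noteq> c \<longrightarrow> A u (2 * q + y) \<noteq> A (2 * q + c) (2 * q + y)" unfolding sat by auto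
    define z where "z = u mod q"
    have z: "z < q" "u = q + z" using label_eqI[OF u(1)] by (simp_all add: z_def)
    then have "\<forall>y<q. y \<noteq> c \<longrightarrow> ip z y = ip c y" using u(2) A_blocks assms by simp
    then have "z = c" using ip_eqI_except[of c z c] z assms by simp
    then show "u = q + c" using z by simp
  next
    assume u: "u = q + c"
    then show "sat A V (u # (2 * q + c) # base) to1_fm"
      unfolding sat using A_blocks assms by simp
  qed
qed

lemma sat_double:
  assumes "u \<in> V" "c < q"
  shows "sat A V (u # (2 * q + c) # base) double_fm \<longleftrightarrow> u = q + 2 * c mod q"
proof -
  have sat: "sat A V (u # (2 * q + c) # base) double_fm \<longleftrightarrow>
      u div q = 1 \<and> (\<forall>z<q. A u (3 * q + z) \<noteq> A (2 * q + c) (3 * q + z))"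
    using ball_block[of 3 "\<lambda>v. A u v \<noteq> A (2 * q + c) v"]
    by (simp add: fm_defs in1_iff[simplified] in3_iff)
  have ip: "ip c (z div 2) = ip (2 * c mod q) z" if "z < q" for z
    using that by (simp add: ip_double q_def ip_mod)
  show ?thesis
  proof
    assume "sat A V (u # (2 * q + c) # base) double_fm"
    then have u: "u div q = 1" "\<forall>z<q. A u (3 * q + z) \<noteq> A (2 * q + c) (3 * q + z)" unfolding sat by auto
    define x where "x = u mod q"
    have x: "x < q" "u = q + x" using label_eqI[OF u(1)] by (simp_all add: x_def)
    then have "\<forall>z<q. ip x z = ip (2 * c mod q) z" using u(2) A_blocks assms ip by simp
    then have "x = 2 * c mod q" using ip_eqI[of k x "2 * c mod q"] x by (simp add: q_def)
    then show "u = q + 2 * c mod q" using x by simp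
  next
    assume u: "u = q + 2 * c mod q"
    then show "sat A V (u # (2 * q + c) # base) double_fm"
      unfolding sat using A_blocks assms ip by simp
  qed
qed

lemma sat_to2:
  assumes "u \<in> V" "c < q"
  shows "sat A V (u # (q + c) # base) to2_fm \<longleftrightarrow> u = 2 * q + c"
proof -
  have sat: "sat A V (u # (q + c) # base) to2_fm \<longleftrightarrow>
      u div q = 2 \<and> (\<forall>y<q. 2 * q + y \<noteq> u \<longrightarrow> A (q + c) (2 * q + y) \<noteq> A u (2 * q + y))"
    using ball_block[of 2 "\<lambda>v. v \<noteq> u \<longrightarrow> A (q + c) v \<noteq> A u v"]
    by (auto simp add: fm_defs in2_iff)
  show ?thesis
  proof
    assume "sat A V (u # (q + c) # base) to2_fm"
    then have u: "u div q = 2" "\<forall>y<q. 2 * q + y \<noteq> u \<longrightarrow> A (q + c) (2 * q + y) \<noteq> A u (2 * q + y)" unfolding sat by auto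
    define z where "z = u mod q"
    have z: "z < q" "u = 2 * q + z" using label_eqI[OF u(1)] by (simp_all add: z_def)
    then have "\<forall>y<q. y \<noteq> z \<longrightarrow> ip z y = ip c y" using u(2) A_blocks assms by auto
    then have "z = c" using ip_eqI_except[of z z c] z assms by simp
    then show "u = 2 * q + c" using z by simp
  next
    assume u: "u = 2 * q + c"
    then show "sat A V (u # (q + c) # base) to2_fm"
      unfolding sat using A_blocks assms by auto
  qed
qed

lemma two_power_less_q: "i < k \<Longrightarrow> 2 ^ i < q"
  by (simp add: q_def)

lemma sat_bit:
  assumes "u \<in> V" "i < k"
  shows "sat A V (u # (q + 2 ^ i) # (2 * q + 2 ^ i) # base) bit_fm \<longleftrightarrow> odd (u mod q div 2 ^ i)"
proof -
  note less = two_power_less_q[OF assms(2)]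
  have sat: "sat A V (u # (q + 2 ^ i) # (2 * q + 2 ^ i) # base) bit_fm \<longleftrightarrow>
      (if u div q = 1 then A u (2 * q + 2 ^ i) else A u (q + 2 ^ i))"
    by (simp add: fm_defs in1_iff[simplified])
  from assms(1) show ?thesis
  proof (cases rule: label_cases)
    case (4 h w)
    then have "(h * q + w) div q = h" by simp
    then show ?thesis unfolding sat using A_rest(1)[OF 4(3,2) less] 4 by (simp add: ip_two_power)
  next
    case (1 w)
    then show ?thesis unfolding sat using A_blocks[OF _ less] by (simp add: ip_two_power)
  next
    case (2 w)
    then show ?thesis unfolding sat using A_blocks(3)[OF less 2(2)] by (simp add: ip_two_power ip_commute)
  next
    case (3 w)
    then show ?thesis unfolding sat using A_blocks(5)[OF less 3(2)] by (simp add: ip_two_power ip_commute)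
  qed
qed

lemma sat_block_bit:
  assumes "u \<in> V" "j < 4"
  shows "sat A V (u # (q + 2 ^ j) # (2 * q + 2 ^ j) # base) (block_bit_fm j) \<longleftrightarrow> odd (u div q div 2 ^ j)"
proof -
  have less: "2 ^ j < q" using two_power_less_q assms(2) k_ge by simp
  have j: "j \<in> {0, 1, 2, 3}" using assms(2) by auto
  have sat: "sat A V (u # (q + 2 ^ j) # (2 * q + 2 ^ j) # base) (block_bit_fm j) \<longleftrightarrow>
      (if u div q = 1 then j = 0 else if u div q = 2 then j = 1 else if u div q = 3 then j = 0 \<or> j = 1
       else A u (q + 2 ^ j) \<noteq> A u (2 * q + 2 ^ j))"
    by (auto simp: fm_defs in1_iff[simplified] in2_iff adj_2q_iff)
  from assms(1) show ?thesis
  proof (cases rule: label_cases)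
    case (4 h w)
    then have "(h * q + w) div q = h" by simp
    then show ?thesis unfolding sat
      using A_rest(1,2)[OF 4(3,2) less] 4 ip_two_power[of h j] by (auto simp: ip_xor_left)
  qed (unfold sat, use j in auto)
qed

end

section \<open>Polynomially bounded functions\<close>

definition poly_bounded :: "(nat \<Rightarrow> nat) \<Rightarrow> bool" where
  "poly_bounded T \<longleftrightarrow> (\<exists>C d. \<forall>s. T s \<le> C * (s + 1) ^ d)"

lemma poly_bounded_const: "poly_bounded (\<lambda>s. c)"
  unfolding poly_bounded_def by (rule exI[of _ c], rule exI[of _ 0]) simp

lemma poly_bounded_id: "poly_bounded (\<lambda>s. s)"
  unfolding poly_bounded_def by (rule exI[of _ 1], rule exI[of _ 1]) simp

lemma poly_bounded_add:
  assumes "poly_bounded f" "poly_bounded g"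
  shows "poly_bounded (\<lambda>s. f s + g s)"
proof -
  obtain C d C' d' where f: "\<And>s. f s \<le> C * (s + 1) ^ d" and g: "\<And>s. g s \<le> C' * (s + 1) ^ d'"
    using assms unfolding poly_bounded_def by blast
  have "f s + g s \<le> (C + C') * (s + 1) ^ (d + d')" for s
  proof -
    have "(s + 1) ^ d \<le> (s + 1) ^ (d + d')" "(s + 1) ^ d' \<le> (s + 1) ^ (d + d')"
      by (rule power_increasing; simp)+
    from mult_le_mono2[OF this(1), of C] mult_le_mono2[OF this(2), of C'] show ?thesis
      using f[of s] g[of s] unfolding add_mult_distrib by linarith
  qed
  then show ?thesis unfolding poly_bounded_def by blast
qed

lemma poly_bounded_mult:
  assumes "poly_bounded f" "poly_bounded g"
  shows "poly_bounded (\<lambda>s. f s * g s)"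
proof -
  obtain C d C' d' where f: "\<And>s. f s \<le> C * (s + 1) ^ d" and g: "\<And>s. g s \<le> C' * (s + 1) ^ d'"
    using assms unfolding poly_bounded_def by blast
  have "f s * g s \<le> (C * C') * (s + 1) ^ (d + d')" for s
    using mult_le_mono[OF f[of s] g[of s]] by (simp add: power_add ac_simps)
  then show ?thesis unfolding poly_bounded_def by blast
qed

lemmas poly_bounded_intros = poly_bounded_const poly_bounded_id poly_bounded_add poly_bounded_mult

section \<open>An interpreter for first-order formulas\<close>

primrec unary :: "nat \<Rightarrow> tree" where
  "unary 0 = Leaf"
| "unary (Suc n) = Node Leaf (unary n)"

fun enc_fm :: "fm \<Rightarrow> tree" where
  "enc_fm (Adj i j) = Node (unary 0) (Node (unary i) (unary j))"
| "enc_fm (Eq i j) = Node (unary 1) (Node (unary i) (unary j))"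
| "enc_fm (Neg f) = Node (unary 2) (enc_fm f)"
| "enc_fm (Conj f g) = Node (unary 3) (Node (enc_fm f) (enc_fm g))"
| "enc_fm (All f) = Node (unary 4) (enc_fm f)"

primrec const_expr :: "tree \<Rightarrow> expr" where
  "const_expr Leaf = Const_Leaf"
| "const_expr (Node a b) = Mk_Node (const_expr a) (const_expr b)"

lemma wp_const_expr: "wp P env (const_expr x) Q \<longleftrightarrow> Q x (2 * size x + 1)"
  by (induction x arbitrary: Q) (simp_all add: wp_simps)

definition nth_body :: "nat \<Rightarrow> expr" where
  "nth_body f = If_Node (Var 0) (Call f [Tl (Var 0), Tl (Var 1)]) (Hd (Var 1))"

text \<open>Both orientations are tested because the endpoints of a listed edge come in any order.
  Inside \<open>Let_In\<close> the arguments are shifted to the variables 1, 2, 3.\<close>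

definition mem_body :: "nat \<Rightarrow> nat \<Rightarrow> expr" where
  "mem_body f eq_f =
    (let rest = Call f [Var 1, Var 2, Tl (Var 3)];
         swapped = If_Node (Call eq_f [Var 1, Tl (Var 0)])
           (If_Node (Call eq_f [Var 2, Hd (Var 0)]) True_Expr rest) rest
     in If_Node (Var 2)
       (Let_In (Hd (Var 2))
         (If_Node (Call eq_f [Var 1, Hd (Var 0)])
           (If_Node (Call eq_f [Var 2, Tl (Var 0)]) True_Expr swapped) swapped))
       Const_Leaf)"

text \<open>Variables: formula, environment, graph.\<close>

definition ev_body :: "nat \<Rightarrow> nat \<Rightarrow> nat \<Rightarrow> nat \<Rightarrow> nat \<Rightarrow> expr" where
  "ev_body f nth_f eq_f mem_f all_f =
    (let tag = Hd (Var 0); arg = Tl (Var 0);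
         lookup = (\<lambda>i. Call nth_f [i, Var 1])
     in If_Node tag
       (If_Node (Tl tag)
         (If_Node (Tl (Tl tag))
           (If_Node (Tl (Tl (Tl tag)))
             (Call all_f [Hd (Var 2), arg, Var 1, Var 2])
             (If_Node (Call f [Hd arg, Var 1, Var 2]) (Call f [Tl arg, Var 1, Var 2]) Const_Leaf))
           (If_Node (Call f [arg, Var 1, Var 2]) Const_Leaf True_Expr))
         (Call eq_f [lookup (Hd arg), lookup (Tl arg)]))
       (Call mem_f [lookup (Hd arg), lookup (Tl arg), Tl (Var 2)]))"

text \<open>Variables of the next two bodies: list of vertices, formula, environment, graph.\<close>

definition all_body :: "nat \<Rightarrow> nat \<Rightarrow> expr" where
  "all_body f ev_f =
     If_Node (Var 0)
       (If_Node (Call ev_f [Var 1, Mk_Node (Hd (Var 0)) (Var 2), Var 3])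
         (Call f [Tl (Var 0), Var 1, Var 2, Var 3]) Const_Leaf)
       True_Expr"

definition find_body :: "nat \<Rightarrow> nat \<Rightarrow> expr" where
  "find_body f ev_f =
     If_Node (Call ev_f [Var 1, Mk_Node (Hd (Var 0)) (Var 2), Var 3])
       (Hd (Var 0))
       (Call f [Tl (Var 0), Var 1, Var 2, Var 3])"

definition mem_cost :: "nat \<Rightarrow> nat" where "mem_cost s = s * (200 * s + 200) + 20"

text \<open>Each quantifier multiplies by \<open>s\<close>, so the degree of the polynomial grows
  with the formula. Only finitely many fixed formulas are ever evaluated.\<close>

fun ev_cost :: "fm \<Rightarrow> nat \<Rightarrow> nat" where
  "ev_cost (Adj i j) s = mem_cost s + (20 * i + 20 * j + 100)"
| "ev_cost (Eq i j) s = 50 * s + (20 * i + 20 * j + 120)"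
| "ev_cost (Neg f) s = ev_cost f s + 40"
| "ev_cost (Conj f g) s = ev_cost f s + ev_cost g s + 60"
| "ev_cost (All f) s = s * (ev_cost f s + 60) + 60"

definition find_cost :: "fm \<Rightarrow> nat \<Rightarrow> nat" where
  "find_cost f s = s * (ev_cost f s + 60) + 60"

lemma poly_bounded_ev_cost: "poly_bounded (ev_cost f)"
proof (induction f)
  case (Adj i j)
  have "ev_cost (Adj i j) = (\<lambda>s. s * (200 * s + 200) + 20 + (20 * i + 20 * j + 100))"
    by (rule ext) (simp add: mem_cost_def)
  then show ?case by (simp only:) (intro poly_bounded_intros)
next
  case (Eq i j)
  have "ev_cost (Eq i j) = (\<lambda>s. 50 * s + (20 * i + 20 * j + 120))" by (rule ext) simp
  then show ?case by (simp only:) (intro poly_bounded_intros)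
next
  case (Neg f)
  have "ev_cost (Neg f) = (\<lambda>s. ev_cost f s + 40)" by (rule ext) simp
  then show ?case using Neg by (simp only:) (intro poly_bounded_intros)
next
  case (Conj f g)
  have "ev_cost (Conj f g) = (\<lambda>s. ev_cost f s + ev_cost g s + 60)" by (rule ext) simp
  then show ?case using Conj by (simp only:) (intro poly_bounded_intros)
next
  case (All f)
  have "ev_cost (All f) = (\<lambda>s. s * (ev_cost f s + 60) + 60)" by (rule ext) simp
  then show ?case using All by (simp only:) (intro poly_bounded_intros)
qed

lemma poly_bounded_find_cost: "poly_bounded (find_cost f)"
proof -
  have "find_cost f = (\<lambda>s. s * (ev_cost f s + 60) + 60)" by (rule ext) (simp add: find_cost_def)
  then show ?thesis by (simp only:) (intro poly_bounded_intros poly_bounded_ev_cost)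
qed

lemma tree_hd_enc_list: "xs \<noteq> [] \<Longrightarrow> tree_hd (enc_list f xs) = f (hd xs)"
  by (cases xs) simp_all

lemma enc_nat_inject: "enc_nat u = enc_nat v \<longleftrightarrow> u = v"
  by (simp add: enc_nat_def' enc_bits_bits_inject)

text \<open>The single parameter \<open>s\<close>, later the size of the input, bounds the numbers
  of vertices and edges and the length of the vertex names, which governs the cost of comparing
  them.\<close>

locale fm_program =
  fixes P :: program and nth_f eq_f mem_f ev_f all_f find_f :: nat
    and vs :: "nat list" and es :: "(nat \<times> nat) list" and s :: nat
  assumes nth_f: "nth_f < length P" "P ! nth_f = nth_body nth_f"
    and eq_f: "eq_f < length P" "P ! eq_f = eq_body eq_f"
    and mem_f: "mem_f < length P" "P ! mem_f = mem_body mem_f eq_f"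
    and ev_f: "ev_f < length P" "P ! ev_f = ev_body ev_f nth_f eq_f mem_f all_f"
    and all_f: "all_f < length P" "P ! all_f = all_body all_f ev_f"
    and find_f: "find_f < length P" "P ! find_f = find_body find_f ev_f"
    and vs_le: "length vs \<le> s" and es_le: "length es \<le> s"
    and size_le: "\<And>v. v \<in> set vs \<Longrightarrow> size (enc_nat v) \<le> s"
begin

definition R :: "nat \<Rightarrow> nat \<Rightarrow> bool" where
  "R u v \<longleftrightarrow> {u, v} \<in> (\<lambda>(a, b). {a, b}) ` set es"

abbreviation "enc_nats \<equiv> enc_list enc_nat"
abbreviation "enc_pairs \<equiv> enc_list (enc_pair enc_nat enc_nat)"
abbreviation "G \<equiv> enc_graph vs es"

lemma enc_graph_parts [simp]: "tree_hd G = enc_nats vs" "tree_tl G = enc_pairs es"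
  by (simp_all add: enc_graph_def)

lemma nth_returns:
  "i < length xs \<Longrightarrow> returns P nth_f [unary i, enc_nats xs] (enc_nat (xs ! i)) (20 * i + 20)"
proof (induction i arbitrary: xs)
  case 0
  then have "tree_hd (enc_nats xs) = enc_nat (xs ! 0)" by (cases xs) simp_all
  then show ?case
    by (intro returnsI, subst nth_f(2)) (simp add: nth_body_def wp_simps)
next
  case (Suc i)
  then have "i < length (tl xs)" "tl xs ! i = xs ! Suc i" by (simp_all add: nth_tl)
  then obtain t where t: "\<And>Q. wp P [unary i, enc_nats (tl xs)] (P ! nth_f) Q \<longleftrightarrow> Q (enc_nat (xs ! Suc i)) t"
    "t \<le> 20 * i + 20" using returnsE[OF Suc.IH[of "tl xs"]] by metis
  show ?case
    by (rule returnsI, subst nth_f(2)) (use nth_f(1) t(2) in \<open>simp add: nth_body_def wp_simps t(1)\<close>)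
qed

lemma eq_returns':
  assumes "size (enc_nat u) \<le> s"
  obtains t where "\<And>Q. wp P [enc_nat u, enc_nat v] (P ! eq_f) Q \<longleftrightarrow> Q (enc_bool (u = v)) t" "t \<le> 50 * s + 20"
proof -
  have "returns P eq_f [enc_nat u, enc_nat v] (enc_bool (u = v)) (50 * size (enc_nat u) + 20)"
    using eq_returns[OF eq_f, of "enc_nat u" "enc_nat v"] by (simp add: enc_nat_inject)
  then have "returns P eq_f [enc_nat u, enc_nat v] (enc_bool (u = v)) (50 * s + 20)"
    by (rule returns_mono) (use assms in simp)
  then show thesis using returnsE that by blast
qed

lemma mem_returns:
  assumes "size (enc_nat u) \<le> s" "size (enc_nat v) \<le> s"
  shows "returns P mem_f [enc_nat u, enc_nat v, enc_pairs fs]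
    (enc_bool ({u, v} \<in> (\<lambda>(a, b). {a, b}) ` set fs)) (length fs * (200 * s + 200) + 20)"
proof (induction fs)
  case Nil
  show ?case by (rule returnsI, subst mem_f(2)) (simp add: mem_body_def Let_def wp_simps)
next
  case (Cons e fs)
  obtain a b where e: "e = (a, b)" by (cases e)
  obtain t where t: "\<And>Q. wp P [enc_nat u, enc_nat v, enc_pairs fs] (P ! mem_f) Q \<longleftrightarrow>
      Q (enc_bool ({u, v} \<in> (\<lambda>(a, b). {a, b}) ` set fs)) t" "t \<le> length fs * (200 * s + 200) + 20"
    using returnsE[OF Cons] by blast
  obtain t1 where t1: "\<And>Q. wp P [enc_nat u, enc_nat a] (P ! eq_f) Q \<longleftrightarrow> Q (enc_bool (u = a)) t1" "t1 \<le> 50 * s + 20"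
    using eq_returns'[OF assms(1)] by blast
  obtain t2 where t2: "\<And>Q. wp P [enc_nat u, enc_nat b] (P ! eq_f) Q \<longleftrightarrow> Q (enc_bool (u = b)) t2" "t2 \<le> 50 * s + 20"
    using eq_returns'[OF assms(1)] by blast
  obtain t3 where t3: "\<And>Q. wp P [enc_nat v, enc_nat a] (P ! eq_f) Q \<longleftrightarrow> Q (enc_bool (v = a)) t3" "t3 \<le> 50 * s + 20"
    using eq_returns'[OF assms(2)] by blast
  obtain t4 where t4: "\<And>Q. wp P [enc_nat v, enc_nat b] (P ! eq_f) Q \<longleftrightarrow> Q (enc_bool (v = b)) t4" "t4 \<le> 50 * s + 20"
    using eq_returns'[OF assms(2)] by blast
  let ?m = "{u, v} \<in> (\<lambda>(a, b). {a, b}) ` set fs"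
  \<comment> \<open>Opaque names for the comparisons: with the equations themselves, a case
    distinction would substitute one vertex for another and the four call rules would no longer
    match.\<close>
  define b1 b2 b3 b4 where b: "b1 = (u = a)" "b2 = (u = b)" "b3 = (v = a)" "b4 = (v = b)"
  note t_simps = t(1) t1(1)[folded b] t2(1)[folded b] t3(1)[folded b] t4(1)[folded b]
  have m: "{u, v} \<in> (\<lambda>(a, b). {a, b}) ` set (e # fs) \<longleftrightarrow> b1 \<and> b4 \<or> b2 \<and> b3 \<or> ?m"
    unfolding b by (auto simp: e doubleton_eq_iff)
  have bound: "t + t1 + t2 + t3 + t4 + 100 \<le> length (e # fs) * (200 * s + 200) + 20"
    using t(2) t1(2) t2(2) t3(2) t4(2) by simp
  show ?case
    unfolding m
    by (rule returnsI, subst mem_f(2))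
      (use mem_f(1) eq_f(1) bound in \<open>cases b1; cases b2; cases b3; cases b4;
        simp add: mem_body_def Let_def wp_simps t_simps e\<close>)
qed

lemma unary_simps: "unary (Suc 0) = Node Leaf Leaf" "unary 2 = Node Leaf (Node Leaf Leaf)"
  "unary 3 = Node Leaf (Node Leaf (Node Leaf Leaf))"
  "unary 4 = Node Leaf (Node Leaf (Node Leaf (Node Leaf Leaf)))"
  by (simp_all add: numeral_eq_Suc)

lemma ev_returns:
  "set env \<subseteq> set vs \<Longrightarrow> scoped (length env) f \<Longrightarrow>
   returns P ev_f [enc_fm f, enc_nats env, G] (enc_bool (sat R (set vs) env f)) (ev_cost f s)"
proof (induction f arbitrary: env)
  case (Adj i j)
  then have ij: "i < length env" "j < length env" "env ! i \<in> set vs" "env ! j \<in> set vs"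
    by (auto dest: nth_mem)
  obtain t1 where t1: "\<And>Q. wp P [unary i, enc_nats env] (P ! nth_f) Q \<longleftrightarrow> Q (enc_nat (env ! i)) t1" "t1 \<le> 20 * i + 20"
    using returnsE[OF nth_returns[OF ij(1)]] by blast
  obtain t2 where t2: "\<And>Q. wp P [unary j, enc_nats env] (P ! nth_f) Q \<longleftrightarrow> Q (enc_nat (env ! j)) t2" "t2 \<le> 20 * j + 20"
    using returnsE[OF nth_returns[OF ij(2)]] by blast
  obtain t3 where t3: "\<And>Q. wp P [enc_nat (env ! i), enc_nat (env ! j), enc_pairs es] (P ! mem_f) Q \<longleftrightarrow>
      Q (enc_bool (R (env ! i) (env ! j))) t3" "t3 \<le> length es * (200 * s + 200) + 20"
    using returnsE[OF mem_returns[OF size_le[OF ij(3)] size_le[OF ij(4)], of es]] unfolding R_def by blast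
  have "length es * (200 * s + 200) \<le> s * (200 * s + 200)" using es_le by (rule mult_le_mono1)
  then have "t3 \<le> mem_cost s" using t3(2) unfolding mem_cost_def by linarith
  then show ?case
    by (intro returnsI, subst ev_f(2))
      (use nth_f(1) mem_f(1) t1(2) t2(2) in \<open>simp add: ev_body_def Let_def wp_simps t1(1) t2(1) t3(1)\<close>)
next
  case (Eq i j)
  then have ij: "i < length env" "j < length env" "env ! i \<in> set vs" "env ! j \<in> set vs"
    by (auto dest: nth_mem)
  obtain t1 where t1: "\<And>Q. wp P [unary i, enc_nats env] (P ! nth_f) Q \<longleftrightarrow> Q (enc_nat (env ! i)) t1" "t1 \<le> 20 * i + 20"
    using returnsE[OF nth_returns[OF ij(1)]] by blast
  obtain t2 where t2: "\<And>Q. wp P [unary j, enc_nats env] (P ! nth_f) Q \<longleftrightarrow> Q (enc_nat (env ! j)) t2" "t2 \<le> 20 * j + 20"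
    using returnsE[OF nth_returns[OF ij(2)]] by blast
  obtain t3 where t3: "\<And>Q. wp P [enc_nat (env ! i), enc_nat (env ! j)] (P ! eq_f) Q \<longleftrightarrow>
      Q (enc_bool (env ! i = env ! j)) t3" "t3 \<le> 50 * s + 20"
    using eq_returns'[OF size_le[OF ij(3)]] by blast
  show ?case
    by (intro returnsI, subst ev_f(2))
      (use nth_f(1) eq_f(1) t1(2) t2(2) t3(2) in
        \<open>simp add: ev_body_def Let_def wp_simps t1(1) t2(1) t3(1) unary_simps\<close>)
next
  case (Neg f)
  obtain t where t: "\<And>Q. wp P [enc_fm f, enc_nats env, G] (P ! ev_f) Q \<longleftrightarrow>
      Q (enc_bool (sat R (set vs) env f)) t" "t \<le> ev_cost f s"
    using returnsE[OF Neg.IH] Neg.prems by auto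
  show ?case
    by (intro returnsI, subst ev_f(2))
      (use ev_f(1) t(2) in \<open>simp add: ev_body_def Let_def wp_simps t(1) unary_simps enc_bool_if\<close>)
next
  case (Conj f g)
  obtain t where t: "\<And>Q. wp P [enc_fm f, enc_nats env, G] (P ! ev_f) Q \<longleftrightarrow>
      Q (enc_bool (sat R (set vs) env f)) t" "t \<le> ev_cost f s"
    using returnsE[OF Conj.IH(1)] Conj.prems by auto
  obtain t' where t': "\<And>Q. wp P [enc_fm g, enc_nats env, G] (P ! ev_f) Q \<longleftrightarrow>
      Q (enc_bool (sat R (set vs) env g)) t'" "t' \<le> ev_cost g s"
    using returnsE[OF Conj.IH(2)] Conj.prems by auto
  show ?case
    by (intro returnsI, subst ev_f(2))
      (use ev_f(1) t(2) t'(2) in \<open>simp add: ev_body_def Let_def wp_simps t(1) t'(1) unary_simps enc_bool_if\<close>)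
next
  case (All f)
  \<comment> \<open>Only the list of vertices still to be visited shrinks; the range of the
    quantifiers inside \<open>f\<close> remains \<open>set vs\<close>.\<close>
  have "returns P all_f [enc_nats xs, enc_fm f, enc_nats env, G]
      (enc_bool (\<forall>x\<in>set xs. sat R (set vs) (x # env) f)) (length xs * (ev_cost f s + 60) + 20)"
    if "set xs \<subseteq> set vs" for xs
    using that
  proof (induction xs)
    case Nil
    show ?case by (rule returnsI, subst all_f(2)) (simp add: all_body_def wp_simps)
  next
    case (Cons x xs)
    obtain t where t: "\<And>Q. wp P [enc_nats xs, enc_fm f, enc_nats env, G] (P ! all_f) Q \<longleftrightarrow>
        Q (enc_bool (\<forall>x\<in>set xs. sat R (set vs) (x # env) f)) t" "t \<le> length xs * (ev_cost f s + 60) + 20"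
      using returnsE[OF Cons.IH] Cons.prems by auto
    obtain t' where t': "\<And>Q. wp P [enc_fm f, Node (enc_nat x) (enc_nats env), G] (P ! ev_f) Q \<longleftrightarrow>
        Q (enc_bool (sat R (set vs) (x # env) f)) t'" "t' \<le> ev_cost f s"
      using returnsE[OF All.IH[of "x # env"]] All.prems Cons.prems by auto
    show ?case
      by (rule returnsI, subst all_f(2))
        (use all_f(1) ev_f(1) t(2) t'(2) in \<open>simp add: all_body_def wp_simps t(1) t'(1) enc_bool_if\<close>)
  qed
  then obtain t where t: "\<And>Q. wp P [enc_nats vs, enc_fm f, enc_nats env, G] (P ! all_f) Q \<longleftrightarrow>
        Q (enc_bool (\<forall>x\<in>set vs. sat R (set vs) (x # env) f)) t" "t \<le> length vs * (ev_cost f s + 60) + 20"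
    using returnsE by blast
  have "length vs * (ev_cost f s + 60) \<le> s * (ev_cost f s + 60)" using vs_le by (rule mult_le_mono1)
  then have "t + 40 \<le> ev_cost (All f) s" unfolding ev_cost.simps using t(2) by linarith
  then show ?case
    by (intro returnsI, subst ev_f(2))
      (use all_f(1) in \<open>simp add: ev_body_def Let_def wp_simps t(1) unary_simps del: ev_cost.simps\<close>)
qed

text \<open>The search has no case for an exhausted list: \<open>x\<^sub>0\<close> lies ahead until
  it is found, and by uniqueness the first hit is \<open>x\<^sub>0\<close>.\<close>

lemma find_returns:
  assumes "set env \<subseteq> set vs" "scoped (Suc (length env)) f" "x\<^sub>0 \<in> set vs"
    and unique: "\<And>x. x \<in> set vs \<Longrightarrow> sat R (set vs) (x # env) f \<longleftrightarrow> x = x\<^sub>0"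
  shows "returns P find_f [enc_nats vs, enc_fm f, enc_nats env, G] (enc_nat x\<^sub>0) (find_cost f s)"
proof -
  have "returns P find_f [enc_nats xs, enc_fm f, enc_nats env, G] (enc_nat x\<^sub>0) (length xs * (ev_cost f s + 60) + 20)"
    if "set xs \<subseteq> set vs" "x\<^sub>0 \<in> set xs" for xs
    using that
  proof (induction xs)
    case (Cons x xs)
    obtain t' where t': "\<And>Q. wp P [enc_fm f, Node (enc_nat x) (enc_nats env), G] (P ! ev_f) Q \<longleftrightarrow>
        Q (enc_bool (x = x\<^sub>0)) t'" "t' \<le> ev_cost f s"
      using returnsE[OF ev_returns[of "x # env" f]] assms(1,2) Cons.prems unique by auto
    show ?case
    proof (cases "x = x\<^sub>0")
      case True
      have t'': "\<And>Q. wp P [enc_fm f, Node (enc_nat x) (enc_nats env), G] (P ! ev_f) Q \<longleftrightarrow> Q tt t'"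
        unfolding t'(1) using True by simp
      show ?thesis
        unfolding True[symmetric]
        by (rule returnsI, subst find_f(2))
          (use ev_f(1) t'(2) in \<open>simp add: find_body_def wp_simps t''\<close>)
    next
      case False
      obtain t where t: "\<And>Q. wp P [enc_nats xs, enc_fm f, enc_nats env, G] (P ! find_f) Q \<longleftrightarrow> Q (enc_nat x\<^sub>0) t"
        "t \<le> length xs * (ev_cost f s + 60) + 20"
        using returnsE[OF Cons.IH] Cons.prems False by auto
      show ?thesis
        by (rule returnsI, subst find_f(2))
          (use find_f(1) ev_f(1) t(2) t'(2) False in \<open>simp add: find_body_def wp_simps t(1) t'(1)\<close>)
    qed
  qed simp
  from this[of vs] have "returns P find_f [enc_nats vs, enc_fm f, enc_nats env, G] (enc_nat x\<^sub>0)
      (length vs * (ev_cost f s + 60) + 20)" using assms(3) by simp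
  moreover have "length vs * (ev_cost f s + 60) \<le> s * (ev_cost f s + 60)"
    using vs_le by (rule mult_le_mono1)
  then have "length vs * (ev_cost f s + 60) + 20 \<le> find_cost f s" unfolding find_cost_def by linarith
  ultimately show ?thesis by (rule returns_mono)
qed

end

section \<open>The self-ordering algorithm\<close>

text \<open>
  Starting from the vertices \<open>x\<close>, \<open>y\<close> labelled \<open>q + c\<close>, \<open>2q + c\<close>, the next body lists these pairs for \<open>c\<close>,
  \<open>2c\<close>, \<open>4c\<close>, \<dots>; it stops when doubling leads to the zero vector of block 1. Its variables are \<open>x\<close>, \<open>y\<close>, the
  list of the zero vectors of the blocks 3, 2, 1, and the graph.
\<close>

definition chain_body :: "nat \<Rightarrow> nat \<Rightarrow> nat \<Rightarrow> expr" where
  "chain_body f find_f eq_f =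
     Mk_Node (Mk_Node (Var 0) (Var 1))
       (Let_In (Call find_f [Hd (Var 3), const_expr (enc_fm double_fm), Mk_Node (Var 1) (Var 2), Var 3])
         (If_Node (Call eq_f [Var 0, Hd (Tl (Tl (Var 3)))])
           Const_Leaf
           (Let_In (Call find_f [Hd (Var 4), const_expr (enc_fm to2_fm), Mk_Node (Var 0) (Var 3), Var 4])
             (Call f [Var 1, Var 0, Var 4, Var 5]))))"

text \<open>Variables: vertex, chain, bits to be appended, zero vectors, graph.\<close>

definition bits_body :: "nat \<Rightarrow> nat \<Rightarrow> expr" where
  "bits_body f ev_f =
     If_Node (Var 1)
       (Mk_Node
         (Call ev_f [const_expr (enc_fm bit_fm),
           Mk_Node (Var 0) (Mk_Node (Hd (Hd (Var 1))) (Mk_Node (Tl (Hd (Var 1))) (Var 3))), Var 4])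
         (Call f [Var 0, Tl (Var 1), Var 2, Var 3, Var 4]))
       (Var 2)"

text \<open>With the least significant bit in front, leading zeros are at the end of the list, so
  the tail has to be stripped before it is known whether a zero in front remains.\<close>

definition strip_body :: "nat \<Rightarrow> expr" where
  "strip_body f =
     If_Node (Var 0)
       (Let_In (Call f [Tl (Var 0)])
         (If_Node (Var 0) (Mk_Node (Hd (Var 1)) (Var 0))
           (If_Node (Hd (Var 1)) (Mk_Node (Hd (Var 1)) Const_Leaf) Const_Leaf)))
       Const_Leaf"

text \<open>Variables of the next two expressions: list of vertices, chain, zero vectors, graph.\<close>

definition block_bit_expr :: "nat \<Rightarrow> nat \<Rightarrow> expr" where
  "block_bit_expr ev_f j =
     Call ev_f [const_expr (enc_fm (block_bit_fm j)),
       Mk_Node (Hd (Var 0)) (Mk_Node (Hd (Hd ((Tl ^^ j) (Var 1)))) (Mk_Node (Tl (Hd ((Tl ^^ j) (Var 1)))) (Var 2))),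
       Var 3]"

definition out_body :: "nat \<Rightarrow> nat \<Rightarrow> nat \<Rightarrow> nat \<Rightarrow> expr" where
  "out_body f ev_f bits_f strip_f =
     If_Node (Var 0)
       (Mk_Node
         (Mk_Node (Hd (Var 0))
           (Call strip_f [Call bits_f [Hd (Var 0), Var 1,
              Mk_Node (block_bit_expr ev_f 0) (Mk_Node (block_bit_expr ev_f 1)
                (Mk_Node (block_bit_expr ev_f 2) (Mk_Node (block_bit_expr ev_f 3) Const_Leaf))),
              Var 2, Var 3]]))
         (Call f [Tl (Var 0), Var 1, Var 2, Var 3]))
       Const_Leaf"

text \<open>The bound values are, in order, the vertices labelled \<open>q\<close> and
  \<open>2 * q\<close>, the list of these two, \<open>3 * q\<close>, the list of all three zero
  vectors, \<open>3 * q + 1\<close>, \<open>2 * q + 1\<close> and \<open>q + 1\<close>. The graph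
  thereby moves from variable 0 to variable 8.\<close>

definition self_order_body :: "nat \<Rightarrow> nat \<Rightarrow> nat \<Rightarrow> expr" where
  "self_order_body find_f chain_f out_f =
    (let find = (\<lambda>g f env. Call find_f [Hd (Var g), const_expr (enc_fm f), env, Var g]) in
     Let_In (find 0 clique_fm Const_Leaf)
    (Let_In (find 1 (Exi zero_edge_fm) (Mk_Node (Var 0) Const_Leaf))
    (Let_In (Mk_Node (Var 0) (Mk_Node (Var 1) Const_Leaf))
    (Let_In (find 3 zero_edge_fm (Var 0))
    (Let_In (Mk_Node (Var 0) (Var 1))
    (Let_In (find 5 first3_fm (Var 0))
    (Let_In (find 6 first2_fm (Mk_Node (Var 0) (Var 1)))
    (Let_In (find 7 to1_fm (Mk_Node (Var 0) (Var 2)))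
    (Call out_f [Hd (Var 8), Call chain_f [Var 0, Var 1, Var 3, Var 8], Var 3, Var 8])))))))))"

lemma strip_returns:
  assumes "f < length P" "P ! f = strip_body f"
  shows "returns P f [enc_bits xs] (enc_bits (bits (val xs))) (40 * length xs + 20)"
proof (induction xs)
  case Nil
  show ?case by (rule returnsI, subst assms(2)) (simp add: strip_body_def wp_simps)
next
  case (Cons b xs)
  obtain t where t: "\<And>Q. wp P [enc_bits xs] (P ! f) Q \<longleftrightarrow> Q (enc_bits (bits (val xs))) t"
    "t \<le> 40 * length xs + 20"
    using returnsE[OF Cons] by blast
  have nil: "bits m = [] \<longleftrightarrow> m = 0" for m by (subst bits.simps) simp
  have "bits (val (b # xs)) = (if val xs = 0 \<and> \<not> b then [] else b # bits (val xs))"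
    by (subst bits.simps) (auto simp: nil)
  then show ?case
    by (intro returnsI, subst assms(2))
      (use assms(1) t(2) in \<open>cases b; simp add: strip_body_def wp_simps t(1) nil\<close>)
qed

lemma val_append: "val (xs @ ys) = val xs + 2 ^ length xs * val ys"
  by (induction xs) (simp_all add: algebra_simps)

lemma val_odd_bits: "val (map (\<lambda>j. odd (w div 2 ^ j)) [0..<k]) = w mod 2 ^ k"
proof (induction k arbitrary: w)
  case (Suc k)
  have "map (\<lambda>j. odd (w div 2 ^ j)) [0..<Suc k] = odd w # map (\<lambda>j. odd (w div 2 div 2 ^ j)) [0..<k]"
    by (simp add: upt_rec[of 0] map_Suc_upt[symmetric] div_mult2_eq comp_def del: upt_Suc)
  then have "val (map (\<lambda>j. odd (w div 2 ^ j)) [0..<Suc k]) = of_bool (odd w) + 2 * (w div 2 mod 2 ^ k)"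
    using Suc[of "w div 2"] by simp
  also have "\<dots> = w mod 2 ^ Suc k" by (simp add: mod_mult2_eq mod_2_eq_odd)
  finally show ?case .
qed simp

definition chain_step :: "nat \<Rightarrow> nat" where
  "chain_step s = find_cost double_fm s + find_cost to2_fm s + 50 * s +
     (2 * size (enc_fm double_fm) + 2 * size (enc_fm to2_fm) + 200)"

definition bits_step :: "nat \<Rightarrow> nat" where
  "bits_step s = ev_cost bit_fm s + (2 * size (enc_fm bit_fm) + 100)"

definition block_bit_cost :: "nat \<Rightarrow> nat \<Rightarrow> nat" where
  "block_bit_cost j s = ev_cost (block_bit_fm j) s + (2 * size (enc_fm (block_bit_fm j)) + 100)"

definition out_step :: "nat \<Rightarrow> nat" where
  "out_step s = s * bits_step s + block_bit_cost 0 s + block_bit_cost 1 s + block_bit_cost 2 s +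
     block_bit_cost 3 s + 40 * s + 1000"

definition self_order_cost :: "nat \<Rightarrow> nat" where
  "self_order_cost s = find_cost clique_fm s + find_cost (Exi zero_edge_fm) s + find_cost zero_edge_fm s +
     find_cost first3_fm s + find_cost first2_fm s + find_cost to1_fm s + s * chain_step s + s * out_step s +
     (2 * size (enc_fm clique_fm) + 2 * size (enc_fm (Exi zero_edge_fm)) + 2 * size (enc_fm zero_edge_fm) +
      2 * size (enc_fm first3_fm) + 2 * size (enc_fm first2_fm) + 2 * size (enc_fm to1_fm) + 1000)"

lemma poly_bounded_self_order_cost: "poly_bounded self_order_cost"
proof -
  have ev: "poly_bounded (\<lambda>s. ev_cost f s)" for f using poly_bounded_ev_cost[of f] by simp
  have find: "poly_bounded (\<lambda>s. find_cost f s)" for f using poly_bounded_find_cost[of f] by simp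
  show ?thesis
    unfolding self_order_cost_def[abs_def] chain_step_def out_step_def bits_step_def block_bit_cost_def
    by (intro poly_bounded_intros ev find)
qed

locale self_order_program =
  fm_program P nth_f eq_f mem_f ev_f all_f find_f vs es s + block_graph_params k n
  for P nth_f eq_f mem_f ev_f all_f find_f vs es s k n +
  fixes chain_f bits_f strip_f out_f :: nat and \<phi> :: "nat \<Rightarrow> nat"
  assumes chain_f: "chain_f < length P" "P ! chain_f = chain_body chain_f find_f eq_f"
    and bits_f: "bits_f < length P" "P ! bits_f = bits_body bits_f ev_f"
    and strip_f: "strip_f < length P" "P ! strip_f = strip_body strip_f"
    and out_f: "out_f < length P" "P ! out_f = out_body out_f ev_f bits_f strip_f"
    and \<phi>: "bij_betw \<phi> (set vs) V"
    and R_iff: "\<And>u v. u \<in> set vs \<Longrightarrow> v \<in> set vs \<Longrightarrow> R u v \<longleftrightarrow> A (\<phi> u) (\<phi> v)"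
    and k_le: "k \<le> s"
begin

definition \<psi> :: "nat \<Rightarrow> nat" where "\<psi> = inv_into (set vs) \<phi>"

lemma \<psi>_in: "l \<in> V \<Longrightarrow> \<psi> l \<in> set vs"
  using \<phi> unfolding \<psi>_def by (metis bij_betw_imp_surj_on inv_into_into)

lemma \<phi>_\<psi>: "l \<in> V \<Longrightarrow> \<phi> (\<psi> l) = l"
  using \<phi> unfolding \<psi>_def by (metis bij_betw_inv_into_right)

lemma \<phi>_in: "v \<in> set vs \<Longrightarrow> \<phi> v \<in> V"
  using \<phi> by (metis bij_betw_imp_surj_on imageI)

lemma \<psi>_\<phi>: "v \<in> set vs \<Longrightarrow> \<psi> (\<phi> v) = v"
  using \<phi> unfolding \<psi>_def by (metis bij_betw_inv_into_left)

lemma sat_labels: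
  assumes "set ls \<subseteq> V" "scoped (Suc (length ls)) f" "v \<in> set vs"
  shows "sat R (set vs) (v # map \<psi> ls) f \<longleftrightarrow> sat A V (\<phi> v # ls) f"
proof -
  have "map \<phi> (map \<psi> ls) = ls" unfolding map_map by (rule map_idI) (use assms(1) \<phi>_\<psi> in auto)
  then show ?thesis
    using sat_bij[where R = R and R' = A and env = "v # map \<psi> ls" and f = f, OF \<phi> R_iff] assms \<psi>_in by auto
qed

text \<open>Definability in the original graph and invariance under \<open>\<phi>\<close> combine:
  the search in the copy for a formula that defines \<open>l\<close> ends at the preimage of
  \<open>l\<close>.\<close>

lemma find_label:
  assumes "set ls \<subseteq> V" "scoped (Suc (length ls)) f" "l \<in> V"
    and "\<And>u. u \<in> V \<Longrightarrow> sat A V (u # ls) f \<longleftrightarrow> u = l"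
  obtains t where
    "\<And>Q. wp P [enc_nats vs, enc_fm f, enc_nats (map \<psi> ls), G] (P ! find_f) Q \<longleftrightarrow> Q (enc_nat (\<psi> l)) t"
    "t \<le> find_cost f s"
proof -
  have "sat R (set vs) (x # map \<psi> ls) f \<longleftrightarrow> x = \<psi> l" if x: "x \<in> set vs" for x
    using sat_labels[OF assms(1,2) x] assms(4)[OF \<phi>_in[OF x]] \<psi>_\<phi>[OF x] \<phi>_\<psi>[OF assms(3)] by metis
  then have "returns P find_f [enc_nats vs, enc_fm f, enc_nats (map \<psi> ls), G] (enc_nat (\<psi> l)) (find_cost f s)"
    using assms \<psi>_in by (intro find_returns) auto
  then show thesis using returnsE that by blast
qed

lemma ev_label:
  assumes "set ls \<subseteq> V" "scoped (Suc (length ls)) f" "v \<in> set vs"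
  obtains t where
    "\<And>Q. wp P [enc_fm f, Node (enc_nat v) (enc_nats (map \<psi> ls)), G] (P ! ev_f) Q \<longleftrightarrow>
      Q (enc_bool (sat A V (\<phi> v # ls) f)) t"
    "t \<le> ev_cost f s"
proof -
  have "returns P ev_f [enc_fm f, enc_nats (v # map \<psi> ls), G] (enc_bool (sat R (set vs) (v # map \<psi> ls) f)) (ev_cost f s)"
    using assms \<psi>_in by (intro ev_returns) auto
  then show thesis using returnsE that unfolding sat_labels[OF assms] enc_list_simps by blast
qed

abbreviation base_tree :: tree where "base_tree \<equiv> enc_nats (map \<psi> base)"

definition pair :: "nat \<Rightarrow> nat \<times> nat" where "pair j = (\<psi> (q + 2 ^ j), \<psi> (2 * q + 2 ^ j))"

lemma base_in_V: "set base \<subseteq> V"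
  using zero_labels by simp

lemma scoped_fms:
  "scoped (Suc 0) clique_fm" "scoped (Suc (Suc 0)) (Exi zero_edge_fm)"
  "scoped (Suc (Suc (Suc 0))) zero_edge_fm" "scoped (Suc (Suc (Suc (Suc 0)))) first3_fm"
  "scoped (Suc (Suc (Suc (Suc (Suc 0))))) first2_fm" "scoped (Suc (Suc (Suc (Suc (Suc 0))))) to1_fm"
  "scoped (Suc (Suc (Suc (Suc (Suc 0))))) double_fm" "scoped (Suc (Suc (Suc (Suc (Suc 0))))) to2_fm"
  "scoped (Suc (Suc (Suc (Suc (Suc (Suc 0)))))) bit_fm"
  "scoped (Suc (Suc (Suc (Suc (Suc (Suc 0)))))) (block_bit_fm j)"
  by (simp_all add: fm_defs)

lemma chain_returns:
  assumes "i < k"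
  shows "returns P chain_f [enc_nat (\<psi> (q + 2 ^ i)), enc_nat (\<psi> (2 * q + 2 ^ i)), base_tree, G]
    (enc_pairs (map pair [i..<k])) ((k - i) * chain_step s)"
  using assms
proof (induction "k - i" arbitrary: i)
  case (Suc d)
  have less: "2 ^ i < q" using Suc by (intro two_power_less_q)
  have qi: "2 * q + 2 ^ i \<in> V" using in_V less by simp
  let ?c = "2 * 2 ^ i mod q"
  have cq: "?c < q" by simp
  obtain t1 where t1: "\<And>Q. wp P [enc_nats vs, enc_fm double_fm, enc_nats (map \<psi> ((2 * q + 2 ^ i) # base)), G] (P ! find_f) Q
      \<longleftrightarrow> Q (enc_nat (\<psi> (q + ?c))) t1" "t1 \<le> find_cost double_fm s"
    by (rule find_label[of "(2 * q + 2 ^ i) # base" double_fm "q + ?c"])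
      (use qi base_in_V scoped_fms sat_double[OF _ less] in_V(1)[OF cq] in auto)
  have q_in: "\<psi> (q + ?c) \<in> set vs" using \<psi>_in in_V(1)[OF cq] .
  obtain t2 where t2: "\<And>Q. wp P [enc_nat (\<psi> (q + ?c)), enc_nat (\<psi> q)] (P ! eq_f) Q
      \<longleftrightarrow> Q (enc_bool (\<psi> (q + ?c) = \<psi> q)) t2" "t2 \<le> 50 * s + 20"
    using eq_returns'[OF size_le[OF q_in]] by blast
  have eq: "\<psi> (q + ?c) = \<psi> q \<longleftrightarrow> ?c = 0"
    using \<phi>_\<psi>[OF in_V(1)[OF cq]] \<phi>_\<psi>[OF zero_labels(1)] by auto
  show ?case
  proof (cases "Suc i = k")
    case True
    \<comment> \<open>Doubling the topmost unit vector overflows to zero modulo \<open>q\<close>,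
      which triggers the stopping test.\<close>
    then have c: "?c = 0" by (simp add: q_def flip: power_Suc)
    have t1': "\<And>Q. wp P [enc_nats vs, enc_fm double_fm, enc_nats (map \<psi> ((2 * q + 2 ^ i) # base)), G] (P ! find_f) Q
        \<longleftrightarrow> Q (enc_nat (\<psi> q)) t1"
      using t1(1) unfolding c by simp
    have t2': "\<And>Q. wp P [enc_nat (\<psi> q), enc_nat (\<psi> q)] (P ! eq_f) Q \<longleftrightarrow> Q tt t2"
      using t2(1) unfolding c by simp
    have "[i..<k] = [i]" "k - i = 1" using True by (simp_all add: upt_rec[of i k] upt_rec[of "Suc i" k])
    then show ?thesis
      by (intro returnsI, subst chain_f(2))
        (use find_f(1) eq_f(1) t1(2) t2(2) in
          \<open>simp add: chain_body_def wp_simps wp_const_expr t1'[simplified] t2' pair_def chain_step_def\<close>)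
  next
    case False
    then have i: "Suc i < k" and d: "d = k - Suc i" using Suc by simp_all
    define c where "c = (2::nat) ^ Suc i"
    have less': "c < q" unfolding c_def using two_power_less_q[OF i] .
    have c: "?c = c" "?c \<noteq> 0" using less' by (simp_all add: c_def)
    have t1': "\<And>Q. wp P [enc_nats vs, enc_fm double_fm, enc_nats (map \<psi> ((2 * q + 2 ^ i) # base)), G] (P ! find_f) Q
        \<longleftrightarrow> Q (enc_nat (\<psi> (q + c))) t1"
      using t1(1) unfolding c(1) .
    have t2': "\<And>Q. wp P [enc_nat (\<psi> (q + c)), enc_nat (\<psi> q)] (P ! eq_f) Q \<longleftrightarrow> Q Leaf t2"
      using t2(1) c(2) unfolding eq unfolding c(1) by simp
    obtain t3 where t3: "\<And>Q. wp P [enc_nats vs, enc_fm to2_fm, enc_nats (map \<psi> ((q + c) # base)), G] (P ! find_f) Q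
        \<longleftrightarrow> Q (enc_nat (\<psi> (2 * q + c))) t3" "t3 \<le> find_cost to2_fm s"
      by (rule find_label[of "(q + c) # base" to2_fm "2 * q + c"])
        (use in_V[OF less'] base_in_V scoped_fms sat_to2[OF _ less'] in auto)
    have "returns P chain_f [enc_nat (\<psi> (q + c)), enc_nat (\<psi> (2 * q + c)), base_tree, G]
        (enc_pairs (map pair [Suc i..<k])) ((k - Suc i) * chain_step s)"
      using Suc.hyps(1)[OF d i] unfolding c_def .
    then obtain t4 where t4: "\<And>Q. wp P [enc_nat (\<psi> (q + c)), enc_nat (\<psi> (2 * q + c)), base_tree, G] (P ! chain_f) Q
        \<longleftrightarrow> Q (enc_pairs (map pair [Suc i..<k])) t4" "t4 \<le> (k - Suc i) * chain_step s"
      using returnsE by blast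
    have upt: "[i..<k] = i # [Suc i..<k]" using i by (simp add: upt_rec[of i k])
    have ki: "k - i = Suc (k - Suc i)" using i by simp
    have bound: "t1 + t2 + t3 + t4 + (2 * size (enc_fm double_fm) + 2 * size (enc_fm to2_fm) + 100)
        \<le> Suc (k - Suc i) * chain_step s"
      using t1(2) t2(2) t3(2) t4(2) by (simp add: chain_step_def)
    show ?thesis
      unfolding upt ki
      by (intro returnsI, subst chain_f(2))
        (use find_f(1) eq_f(1) chain_f(1) bound in
          \<open>simp add: chain_body_def wp_simps wp_const_expr t1'[simplified] t2' t3(1)[simplified] t4(1)[simplified] pair_def\<close>)
  qed
qed simp

lemma bits_returns:
  assumes "v \<in> set vs"
  shows "i \<le> k \<Longrightarrow> returns P bits_f [enc_nat v, enc_pairs (map pair [i..<k]), enc_bits bs, base_tree, G]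
    (enc_bits (map (\<lambda>j. odd (\<phi> v mod q div 2 ^ j)) [i..<k] @ bs)) ((k - i) * bits_step s + 20)"
proof (induction "k - i" arbitrary: i)
  case 0
  then show ?case
    by (intro returnsI, subst bits_f(2)) (simp add: bits_body_def wp_simps)
next
  case (Suc d)
  then have i: "i < k" and d: "d = k - Suc i" by simp_all
  have less: "2 ^ i < q" using two_power_less_q[OF i] .
  have sub: "set ((q + 2 ^ i) # (2 * q + 2 ^ i) # base) \<subseteq> V" using in_V[OF less] base_in_V by simp
  have sc: "scoped (Suc (length ((q + 2 ^ i) # (2 * q + 2 ^ i) # base))) bit_fm" by (simp add: scoped_fms)
  obtain t1 where t1: "\<And>Q. wp P [enc_fm bit_fm, Node (enc_nat v) (enc_nats (map \<psi> ((q + 2 ^ i) # (2 * q + 2 ^ i) # base))), G] (P ! ev_f) Q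
      \<longleftrightarrow> Q (enc_bool (odd (\<phi> v mod q div 2 ^ i))) t1" "t1 \<le> ev_cost bit_fm s"
    using ev_label[OF sub sc assms] unfolding sat_bit[OF \<phi>_in[OF assms] i] by blast
  obtain t2 where t2: "\<And>Q. wp P [enc_nat v, enc_pairs (map pair [Suc i..<k]), enc_bits bs, base_tree, G] (P ! bits_f) Q
      \<longleftrightarrow> Q (enc_bits (map (\<lambda>j. odd (\<phi> v mod q div 2 ^ j)) [Suc i..<k] @ bs)) t2"
      "t2 \<le> (k - Suc i) * bits_step s + 20"
    using returnsE[OF Suc.hyps(1)[OF d Suc_leI[OF i]]] by blast
  have upt: "[i..<k] = i # [Suc i..<k]" using i by (simp add: upt_rec[of i k])
  have ki: "k - i = Suc (k - Suc i)" using i by simp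
  have bound: "t1 + t2 + (2 * size (enc_fm bit_fm) + 60) \<le> Suc (k - Suc i) * bits_step s + 20"
    using t1(2) t2(2) by (simp add: bits_step_def)
  show ?case
    unfolding upt ki
    by (intro returnsI, subst bits_f(2))
      (use ev_f(1) bits_f(1) bound in
        \<open>simp add: bits_body_def wp_simps wp_const_expr t1(1)[simplified] t2(1)[simplified] pair_def\<close>)
qed

lemma wp_block_bit:
  assumes "v \<in> set vs" "j < 4"
  obtains t where
    "\<And>Q. wp P [enc_nats (v # xs), enc_pairs (map pair [0..<k]), base_tree, G] (block_bit_expr ev_f j) Q
      \<longleftrightarrow> Q (enc_bool (odd (\<phi> v div q div 2 ^ j))) t"
    "t \<le> block_bit_cost j s"
proof -
  have j: "j < k" using assms(2) k_ge by simp
  have less: "2 ^ j < q" using two_power_less_q[OF j] .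
  have sub: "set ((q + 2 ^ j) # (2 * q + 2 ^ j) # base) \<subseteq> V" using in_V[OF less] base_in_V by simp
  have sc: "scoped (Suc (length ((q + 2 ^ j) # (2 * q + 2 ^ j) # base))) (block_bit_fm j)" by (simp add: scoped_fms)
  obtain t1 where t1: "\<And>Q. wp P [enc_fm (block_bit_fm j), Node (enc_nat v) (enc_nats (map \<psi> ((q + 2 ^ j) # (2 * q + 2 ^ j) # base))), G] (P ! ev_f) Q
      \<longleftrightarrow> Q (enc_bool (odd (\<phi> v div q div 2 ^ j))) t1" "t1 \<le> ev_cost (block_bit_fm j) s"
    using ev_label[OF sub sc assms(1)] unfolding sat_block_bit[OF \<phi>_in[OF assms(1)] assms(2)] by blast
  have tl: "wp P [a, enc_pairs xs, c, d] ((Tl ^^ i) (Var 1)) Q \<longleftrightarrow> Q (enc_pairs (drop i xs)) (i + 1)" for a c d xs i Q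
    by (induction i arbitrary: Q) (simp_all add: wp_simps drop_Suc tl_drop)
  have hd: "tree_hd (enc_pairs (drop j (map pair [0..<k]))) = enc_pair enc_nat enc_nat (pair j)"
    using j by (subst tree_hd_enc_list) (simp_all add: hd_drop_conv_nth)
  have "wp P [enc_nats (v # xs), enc_pairs (map pair [0..<k]), base_tree, G] (block_bit_expr ev_f j)
      (\<lambda>v' t'. v' = enc_bool (odd (\<phi> v div q div 2 ^ j)) \<and> t' \<le> block_bit_cost j s)"
    unfolding block_bit_expr_def wp_simps wp_const_expr tl hd
    using ev_f(1) t1(2) assms(2) by (simp add: t1(1)[simplified] pair_def block_bit_cost_def)
  then show thesis using that wp_known unfolding wp_def by blast
qed

text \<open>Four bits suffice for the block number, which is below 16; they follow the
  \<open>k\<close> bits of the vector and so carry the weight \<open>q\<close>.\<close>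

lemma label_of_bits:
  assumes "u \<in> V"
  shows "val (map (\<lambda>j. odd (u mod q div 2 ^ j)) [0..<k] @
    [odd (u div q), odd (u div q div 2), odd (u div q div 4), odd (u div q div 8)]) = u"
proof -
  have upt: "[0..<4::nat] = [0, 1, 2, 3]" by (simp add: upt_rec)
  have "[odd (u div q), odd (u div q div 2), odd (u div q div 4), odd (u div q div 8)] =
      map (\<lambda>j. odd (u div q div 2 ^ j)) [0..<4]"
    unfolding upt by simp
  then have "val [odd (u div q), odd (u div q div 2), odd (u div q div 4), odd (u div q div 8)] = u div q mod 2 ^ 4"
    by (simp only: val_odd_bits)
  also have "\<dots> = u div q" using block_less_16[OF assms] by simp
  finally have "val [odd (u div q), odd (u div q div 2), odd (u div q div 4), odd (u div q div 8)] = u div q" .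
  then have "val (map (\<lambda>j. odd (u mod q div 2 ^ j)) [0..<k] @
    [odd (u div q), odd (u div q div 2), odd (u div q div 4), odd (u div q div 8)]) = u mod q mod q + q * (u div q)"
    unfolding val_append val_odd_bits by (simp only: q_def length_map length_upt diff_zero)
  then show ?thesis by simp
qed

lemma out_returns:
  "set xs \<subseteq> set vs \<Longrightarrow> returns P out_f [enc_nats xs, enc_pairs (map pair [0..<k]), base_tree, G]
    (enc_pairs (map (\<lambda>v. (v, \<phi> v)) xs)) (length xs * out_step s + 20)"
proof (induction xs)
  case Nil
  show ?case by (rule returnsI, subst out_f(2)) (simp add: out_body_def wp_simps)
next
  case (Cons v xs)
  then have v: "v \<in> set vs" by simp
  let ?h = "\<phi> v div q"
  let ?hs = "[odd ?h, odd (?h div 2), odd (?h div 4), odd (?h div 8)]"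
  let ?bs = "map (\<lambda>j. odd (\<phi> v mod q div 2 ^ j)) [0..<k] @ ?hs"
  obtain t where t: "\<And>Q. wp P [enc_nats xs, enc_pairs (map pair [0..<k]), base_tree, G] (P ! out_f) Q
      \<longleftrightarrow> Q (enc_pairs (map (\<lambda>v. (v, \<phi> v)) xs)) t" "t \<le> length xs * out_step s + 20"
    using returnsE[OF Cons.IH] Cons.prems by auto
  obtain b0 where b0: "\<And>Q. wp P [enc_nats (v # xs), enc_pairs (map pair [0..<k]), base_tree, G] (block_bit_expr ev_f 0) Q
      \<longleftrightarrow> Q (enc_bool (odd (?h div 2 ^ 0))) b0" "b0 \<le> block_bit_cost 0 s" using wp_block_bit[OF v, of 0 xs] by auto
  obtain b1 where b1: "\<And>Q. wp P [enc_nats (v # xs), enc_pairs (map pair [0..<k]), base_tree, G] (block_bit_expr ev_f 1) Q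
      \<longleftrightarrow> Q (enc_bool (odd (?h div 2 ^ 1))) b1" "b1 \<le> block_bit_cost 1 s" using wp_block_bit[OF v, of 1 xs] by auto
  obtain b2 where b2: "\<And>Q. wp P [enc_nats (v # xs), enc_pairs (map pair [0..<k]), base_tree, G] (block_bit_expr ev_f 2) Q
      \<longleftrightarrow> Q (enc_bool (odd (?h div 2 ^ 2))) b2" "b2 \<le> block_bit_cost 2 s" using wp_block_bit[OF v, of 2 xs] by auto
  obtain b3 where b3: "\<And>Q. wp P [enc_nats (v # xs), enc_pairs (map pair [0..<k]), base_tree, G] (block_bit_expr ev_f 3) Q
      \<longleftrightarrow> Q (enc_bool (odd (?h div 2 ^ 3))) b3" "b3 \<le> block_bit_cost 3 s" using wp_block_bit[OF v, of 3 xs] by auto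
  obtain c where c: "\<And>Q. wp P [enc_nat v, enc_pairs (map pair [0..<k]), enc_bits ?hs, base_tree, G] (P ! bits_f) Q
      \<longleftrightarrow> Q (enc_bits ?bs) c" "c \<le> (k - 0) * bits_step s + 20"
    using returnsE[OF bits_returns[OF v, of 0 ?hs]] by blast
  obtain d where d: "\<And>Q. wp P [enc_bits ?bs] (P ! strip_f) Q \<longleftrightarrow> Q (enc_nat (\<phi> v)) d" "d \<le> 40 * (k + 4) + 20"
    using returnsE[OF strip_returns[OF strip_f, of ?bs]] unfolding label_of_bits[OF \<phi>_in[OF v]] enc_nat_def' by auto
  have "k * bits_step s \<le> s * bits_step s" using k_le by (rule mult_le_mono1)
  then have "c \<le> s * bits_step s + 20" using c(2) unfolding diff_zero by linarith
  moreover have "d \<le> 40 * s + 180" using d(2) k_le by simp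
  ultimately have "b0 + b1 + b2 + b3 + c + d + 300 \<le> out_step s"
    using b0(2) b1(2) b2(2) b3(2) unfolding out_step_def by linarith
  then have bound: "t + b0 + b1 + b2 + b3 + c + d + 300 \<le> length (v # xs) * out_step s + 20"
    using t(2) by simp
  \<comment> \<open>The long lists become opaque so that rewriting with the call rules leaves them
    intact.\<close>
  define C where "C = enc_pairs (map pair [0..<k])"
  define B where "B = enc_bits ?bs"
  show ?case
    unfolding C_def[symmetric]
    by (rule returnsI, subst out_f(2))
      (use out_f(1) bits_f(1) strip_f(1) bound in
        \<open>simp add: out_body_def wp_simps b0(1)[folded C_def, simplified] b1(1)[folded C_def, simplified]
           b2(1)[folded C_def, simplified] b3(1)[folded C_def, simplified]
           c(1)[folded C_def B_def, simplified] d(1)[folded B_def] t(1)[folded C_def, simplified]\<close>)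
qed

lemma self_order_returns:
  assumes "0 < length P" "P ! 0 = self_order_body find_f chain_f out_f"
  shows "returns P 0 [G] (enc_fun vs \<phi>) (self_order_cost s)"
proof -
  have q1: "1 < q" by (rule two_less_q)
  note V = zero_labels in_V[OF q1]
  obtain t1 where t1: "\<And>Q. wp P [enc_nats vs, enc_fm clique_fm, enc_nats (map \<psi> []), G] (P ! find_f) Q
      \<longleftrightarrow> Q (enc_nat (\<psi> q)) t1" "t1 \<le> find_cost clique_fm s"
    by (rule find_label[of "[]" clique_fm q]) (use V sat_clique scoped_fms in auto)
  obtain t2 where t2: "\<And>Q. wp P [enc_nats vs, enc_fm (Exi zero_edge_fm), enc_nats (map \<psi> [q]), G] (P ! find_f) Q
      \<longleftrightarrow> Q (enc_nat (\<psi> (2 * q))) t2" "t2 \<le> find_cost (Exi zero_edge_fm) s"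
    by (rule find_label[of "[q]" "Exi zero_edge_fm" "2 * q"])
      (use V sat_zero_edge_2 scoped_fms(2) in \<open>simp_all del: scoped_derived sat_derived\<close>)
  obtain t3 where t3: "\<And>Q. wp P [enc_nats vs, enc_fm zero_edge_fm, enc_nats (map \<psi> [2 * q, q]), G] (P ! find_f) Q
      \<longleftrightarrow> Q (enc_nat (\<psi> (3 * q))) t3" "t3 \<le> find_cost zero_edge_fm s"
    by (rule find_label[of "[2 * q, q]" zero_edge_fm "3 * q"])
      (use V sat_zero_edge_3 scoped_fms in auto)
  obtain t4 where t4: "\<And>Q. wp P [enc_nats vs, enc_fm first3_fm, enc_nats (map \<psi> base), G] (P ! find_f) Q
      \<longleftrightarrow> Q (enc_nat (\<psi> (3 * q + 1))) t4" "t4 \<le> find_cost first3_fm s"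
    by (rule find_label[of base first3_fm "3 * q + 1"]) (use V sat_first3 scoped_fms in auto)
  obtain t5 where t5: "\<And>Q. wp P [enc_nats vs, enc_fm first2_fm, enc_nats (map \<psi> ((3 * q + 1) # base)), G] (P ! find_f) Q
      \<longleftrightarrow> Q (enc_nat (\<psi> (2 * q + 1))) t5" "t5 \<le> find_cost first2_fm s"
    by (rule find_label[of "(3 * q + 1) # base" first2_fm "2 * q + 1"]) (use V sat_first2 scoped_fms in auto)
  obtain t6 where t6: "\<And>Q. wp P [enc_nats vs, enc_fm to1_fm, enc_nats (map \<psi> ((2 * q + 1) # base)), G] (P ! find_f) Q
      \<longleftrightarrow> Q (enc_nat (\<psi> (q + 1))) t6" "t6 \<le> find_cost to1_fm s"
    by (rule find_label[of "(2 * q + 1) # base" to1_fm "q + 1"]) (use V sat_to1[OF _ q1] scoped_fms in auto)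
  have "0 < k" using k_ge by simp
  obtain t7 where t7: "\<And>Q. wp P [enc_nat (\<psi> (q + 1)), enc_nat (\<psi> (2 * q + 1)), base_tree, G] (P ! chain_f) Q
      \<longleftrightarrow> Q (enc_pairs (map pair [0..<k])) t7" "t7 \<le> k * chain_step s"
    using returnsE[OF chain_returns[OF \<open>0 < k\<close>]] by auto
  obtain t8 where t8: "\<And>Q. wp P [enc_nats vs, enc_pairs (map pair [0..<k]), base_tree, G] (P ! out_f) Q
      \<longleftrightarrow> Q (enc_fun vs \<phi>) t8" "t8 \<le> length vs * out_step s + 20"
    using returnsE[OF out_returns[of vs]] unfolding enc_fun_def by auto
  have "k * chain_step s \<le> s * chain_step s" "length vs * out_step s \<le> s * out_step s"
    using k_le vs_le by (auto intro: mult_le_mono1)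
  then have bound: "t1 + t2 + t3 + t4 + t5 + t6 + t7 + t8 +
     (2 * size (enc_fm clique_fm) + 2 * size (enc_fm (Exi zero_edge_fm)) + 2 * size (enc_fm zero_edge_fm) +
      2 * size (enc_fm first3_fm) + 2 * size (enc_fm first2_fm) + 2 * size (enc_fm to1_fm) + 500) \<le> self_order_cost s"
    using t1(2) t2(2) t3(2) t4(2) t5(2) t6(2) t7(2) t8(2) unfolding self_order_cost_def by linarith
  define C where "C = enc_pairs (map pair [0..<k])"
  show ?thesis
    by (rule returnsI, subst assms(2))
      (use find_f(1) chain_f(1) out_f(1) bound in
        \<open>simp add: self_order_body_def Let_def wp_simps wp_const_expr t1(1)[simplified] t2(1)[simplified] t3(1)[simplified]
          t4(1)[simplified] t5(1)[simplified] t6(1)[simplified] t7(1)[folded C_def, simplified] t8(1)[folded C_def, simplified]\<close>)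
qed

end

definition self_order_prog :: program where
  "self_order_prog =
     [self_order_body 6 7 10, nth_body 1, eq_body 2, mem_body 3 2, ev_body 4 1 2 3 5, all_body 5 4,
      find_body 6 4, chain_body 7 6 2, bits_body 8 4, strip_body 9, out_body 10 4 8 9]"

lemma size_enc_list: "length xs \<le> size (enc_list f xs)" "x \<in> set xs \<Longrightarrow> size (f x) \<le> size (enc_list f xs)"
  by (induction xs) auto

lemma self_order_prog_correct:
  assumes n: "2 ^ 27 \<le> n" and simple: "simple_graph V' E'" and lists: "lists_graph vs es V' E'"
    and \<phi>: "graph_bij \<phi> V' E' {1..n} (block_graph n)"
  shows "returns self_order_prog 0 [enc_graph vs es] (enc_fun vs \<phi>) (self_order_cost (size (enc_graph vs es)))"
proof -
  let ?P = self_order_prog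
  let ?s = "size (enc_graph vs es)"
  interpret block_graph_params "dim n" n using dim_params n by blast
  have vs: "set vs = V'" "distinct vs" and es: "(\<lambda>(u, v). {u, v}) ` set es = E'"
    using lists by (auto simp: lists_graph_def)
  have bij: "bij_betw \<phi> V' V" and img: "(`) \<phi> ` E' = block_graph n"
    using \<phi> by (simp_all add: graph_bij_def V_def)
  have s: "?s = size (enc_list enc_nat vs) + size (enc_list (enc_pair enc_nat enc_nat) es) + 1"
    by (simp add: enc_graph_def)
  have vs_s: "length vs \<le> ?s" "length es \<le> ?s" "\<And>v. v \<in> set vs \<Longrightarrow> size (enc_nat v) \<le> ?s"
    using size_enc_list(1)[of vs enc_nat] size_enc_list(1)[of es "enc_pair enc_nat enc_nat"]
      size_enc_list(2)[of _ vs enc_nat] unfolding s by fastforce+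
  interpret fm_program ?P 1 2 3 4 5 6 vs es ?s
    by unfold_locales (use vs_s in \<open>simp_all add: self_order_prog_def\<close>)
  have R_iff: "R u v \<longleftrightarrow> A (\<phi> u) (\<phi> v)" if uv: "u \<in> V'" "v \<in> V'" for u v
  proof -
    have "R u v \<longleftrightarrow> {u, v} \<in> E'" unfolding R_def es ..
    also have "\<dots> \<longleftrightarrow> \<phi> ` {u, v} \<in> (`) \<phi> ` E'"
    proof
      \<comment> \<open>The converse needs injectivity of \<open>\<phi>\<close> on sets of vertices,
        hence that edges of \<open>E'\<close> lie inside \<open>V'\<close>.\<close>
      assume "\<phi> ` {u, v} \<in> (`) \<phi> ` E'"
      then obtain e where e: "e \<in> E'" "\<phi> ` {u, v} = \<phi> ` e" by auto
      have "e \<subseteq> V'" using simple e(1) by (fastforce simp: simple_graph_def)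
      then have "{u, v} = e"
        using e(2) uv inj_on_image_eq_iff[OF bij_betw_imp_inj_on[OF bij], of "{u, v}" e] by simp
      then show "{u, v} \<in> E'" using e(1) by simp
    qed (rule imageI)
    also have "\<dots> \<longleftrightarrow> A (\<phi> u) (\<phi> v)"
      using bij uv unfolding img by (auto simp: in_block_graph_iff A_def V_def bij_betw_def)
    finally show ?thesis .
  qed
  have "card V' = n" using bij bij_betw_same_card by (fastforce simp: V_def)
  then have "length vs = n" using vs distinct_card by metis
  \<comment> \<open>The chain of unit vectors has \<open>dim n\<close> entries, so its length has to
    be bounded by the input size.\<close>
  moreover have "dim n < n"
  proof -
    have "dim n < 2 ^ dim n" by (rule less_exp)
    also have "\<dots> \<le> n" using n_ge by simp
    finally show ?thesis .
  qed
  ultimately have "dim n \<le> ?s" using vs_s by linarith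
  then interpret self_order_program ?P 1 2 3 4 5 6 vs es ?s "dim n" n 7 8 9 10 \<phi>
    by unfold_locales (use bij R_iff vs in \<open>simp_all add: self_order_prog_def\<close>)
  show ?thesis
    by (rule self_order_returns) (simp_all add: self_order_prog_def)
qed

lemma efficiently_self_ordered_block_graph: "efficiently_self_ordered {2 ^ 27..} block_graph"
  unfolding efficiently_self_ordered_def
proof (intro conjI ballI)
  fix n :: nat assume "n \<in> {2 ^ 27..}"
  then have n: "2 ^ 27 \<le> n" by simp
  then have "0 < n" by (rule less_le_trans[rotated]) simp
  then have "0 < 1 / (512 * real scale) * real n" by (simp add: scale_def)
  then show "self_ordered n (block_graph n)"
    using self_ordered_if_robust robust_block_graph[OF n] by blast
next
  obtain C d where bound: "\<And>s. self_order_cost s \<le> C * (s + 1) ^ d"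
    using poly_bounded_self_order_cost unfolding poly_bounded_def by blast
  define p :: "real poly" where "p = smult (real C) ([:1, 1:] ^ d)"
  have p: "poly p (real s) = real (C * (s + 1) ^ d)" for s
    by (simp add: p_def poly_power add.commute)
  show "\<exists>P p. \<forall>n\<in>{2 ^ 27..}. \<forall>V' E' vs es \<phi>.
      simple_graph V' E' \<and> lists_graph vs es V' E' \<and> graph_bij \<phi> V' E' {1..n} (block_graph n) \<longrightarrow>
      computes_within P (enc_graph vs es) (enc_fun vs \<phi>) (poly p (real (size (enc_graph vs es))))"
  proof (intro exI[of _ self_order_prog] exI[of _ p] ballI allI impI, elim conjE)
    fix n :: nat and V' E' and vs :: "nat list" and es \<phi>
    assume "n \<in> {2 ^ 27..}" "simple_graph V' E'" "lists_graph vs es V' E'"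
      "graph_bij \<phi> V' E' {1..n} (block_graph n)"
    then have "returns self_order_prog 0 [enc_graph vs es] (enc_fun vs \<phi>) (self_order_cost (size (enc_graph vs es)))"
      by (intro self_order_prog_correct) auto
    then show "computes_within self_order_prog (enc_graph vs es) (enc_fun vs \<phi>) (poly p (real (size (enc_graph vs es))))"
      by (rule returns_computes_within) (unfold p, use bound in \<open>simp_all only: of_nat_le_iff self_order_prog_def\<close>, simp)
  qed
qed

theorem theorem8p10:
  shows "\<exists>c :: real. c > 0 \<and>
    (\<exists>(E :: nat \<Rightarrow> nat set set) (n0 :: nat).
       (\<forall>n. simple_graph {1..n} (E n)) \<and>
       (\<forall>n\<ge>n0. robustly_self_ordered (c * real n) {1..n} (E n)) \<and>
       polylog_time_adjacency E \<and>
       efficiently_self_ordered {n0..} E \<and>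
       (\<forall>n\<ge>n0. \<forall>v\<in>{1..n}.
          0.06 * real n \<le> real (vertex_degree (E n) v) \<and> real (vertex_degree (E n) v) \<le> 0.73 * real n))"
proof (intro exI[of _ "1 / (512 * real scale)"] exI[of _ block_graph] exI[of _ "2 ^ 27"] conjI allI ballI impI)
  show "0 < 1 / (512 * real scale)" by (simp add: scale_def)
qed (use simple_block_graph robust_block_graph polylog_time_block_graph efficiently_self_ordered_block_graph
      block_graph_degree_bounds in blast)+

end
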